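(* The $\mathbb{Z}$-module $H(M,U)=\bigoplus_{\sigma\in\mathcal{Q}}\mathbb{Z}T_\sigma\subset\mathbb{Q}[M]$ is a unital ring with unit $T_1$ (with the product of the monoid algebra $\mathbb{Q}[M]$), generated as a ring by $T_{s_k}$ with $k\in\{1,\dots,n-1\}$, $T_t$ with $t\in T$, and $T_\nu$. Moreover: (1) For all $t,t',t_I\in T$ and $\sigma\in\mathcal{Q}$, $$T_t^{\,q-1}=T_1,\qquad T_tT_{t'}=T_{t'}T_t,\qquad T_{t_I}T_\sigma=T_{t_I\sigma}=T_{\sigma t_J}=T_\sigma T_{t_J},$$ where $t_J:=(t_I)^\sigma$. (2) For each $k\in\{1,\dots,n-1\}$ and each $\sigma\in\mathcal{Q}$, $$T_{s_k}T_\sigma=\begin{cases}qT_\sigma&\text{if }\ell(s_k\sigma)=\ell(\sigma)\\ T_{s_k\sigma}&\text{if }\ell(s_k\sigma)=\ell(\sigma)+1\\ qT_{s_k\sigma}+\sum_{r\in\mathbb{F}_q^\times}T_{h_k(r)}T_\sigma&\text{if }\ell(s_k\sigma)=\ell(\sigma)-1\end{cases}$$ $$T_\sigma T_{s_k}=\begin{cases}qT_\sigma&\text{if }\ell(\sigma s_k)=\ell(\sigma)\\ T_{\sigma s_k}&\text{if }\ell(\sigma s_k)=\ell(\sigma)+1\\ qT_{\sigma s_k}+\sum_{r\in\mathbb{F}_q^\times}T_\sigma T_{h^s_k(r)}&\text{if }\ell(\sigma s_k)=\ell(\sigma)-1\end{cases}$$ (3) For each $\sigma\in\mathcal{Q}$,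 $$T_\nu T_\sigma=q^{\ell(\sigma)-\ell(\nu\sigma)}T_{\nu\sigma},\qquad T_\sigma T_\nu=q^{\ell(\sigma)-\ell(\sigma\nu)}T_{\sigma\nu}.$$
   Context: Let $q$ be a power of an odd prime and $n\ge 1$. $M$ is the multiplicative monoid of all $n\times n$ matrices over $\mathbb{F}_q$; $U\subset M$ is the group of upper unitriangular matrices; $T\subset M$ is the group of invertible diagonal matrices. $\mathcal{Q}\subset M$ is the submonoid of matrices with at most one nonzero entry in each row and each column. $W\subset\mathcal{Q}$ is the group of permutation matrices, generated by $s_1,\dots,s_{n-1}$, where $s_k$ is the permutation matrix of the transposition $(k,k+1)$; $\ell$ on $W$ is the usual Coxeter length with respect to these generators. $E_{i,j}$ are the matrix units and $\nu=E_{1,2}+E_{2,3}+\cdots+E_{n-1,n}$ (with $\nu^0=1$). For $\sigma\in\mathcal{Q}$, $\tilde\sigma$ is the $0/1$ matrix obtained by replacing each nonzero entry of $\sigma$ by $1$. For $\sigma\in\mathcal{Q}$ of rank $r$, the length is $\ell(\sigma)=\min\{\ell(u)+\ell(w)\mid u,w\in W,\ u\tilde\sigma w=\nu^{n-r}\}$. $I(\sigma)$ is the set of indices of nonzero rows of $\sigma$; for $i\in I(\sigma)$, $i\sigma$ is the column of the nonzero entry in row $i$. $\hat\sigma$ is the unique permutation of $\{1,\dots,n\}$ with $i\hat\sigma=i\sigma$ for $i\in I(\sigma)$ and which is increasing on the complement of $I(\sigma)$. For $t=\sum_i t_{i,i}E_{i,i}\in T$, put $t^\sigma=\sum_i t_{i,i}E_{i\hat\sigma,i\hat\sigma}$.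 For $k\in\{1,\dots,n-1\}$ and $r\in\mathbb{F}_q^\times$, $h_k(r)=1+(-r^{-1}-1)E_{k,k}+(r-1)E_{k+1,k+1}\in T$ (diagonal with $-r^{-1}$ in position $k$, $r$ in position $k+1$, and $1$ elsewhere), and $h_k^s(r)=s_kh_k(r)s_k$. $\mathbb{Q}[M]$ is the monoid algebra of $M$ (the zero matrix is a basis element, not the zero of the algebra). For $\sigma\in\mathcal{Q}$ of rank $r$, $T_\sigma=q^{\frac{r(1-r)}{2}}\sum_{x\in U\sigma U}x\in\mathbb{Q}[M]$. *)

theory Defs
  imports
    "Jordan_Normal_Form.DL_Rank"
    "HOL-Algebra.Generated_Rings"
    "HOL-Combinatorics.Permutations"
    "HOL-Computational_Algebra.Primes"
    "HOL-Library.Cardinality"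
begin

text \<open>
  Matrices are indexed from 0: the index \<open>i\<close> of the literature is \<open>i - 1\<close> here, and the
  simple reflections \<open>s 1, ..., s (n - 1)\<close> become those with index \<open>k\<close> such that
  \<open>Suc k < n\<close>.  The field with \<open>q\<close> elements is a type \<open>'a\<close> of class
  \<open>{finite, field}\<close> with \<open>q = CARD('a)\<close>.
\<close>

subsection \<open>Monoid algebras over the rationals\<close>

definition monoid_algebra :: "('m, 'b) monoid_scheme \<Rightarrow> ('m \<Rightarrow> rat) ring" where
  "monoid_algebra G = \<lparr>
     carrier = {f. finite {x. f x \<noteq> 0} \<and> {x. f x \<noteq> 0} \<subseteq> carrier G},
     mult = (\<lambda>f g x. \<Sum>(y, z) \<in> {(y, z). f y \<noteq> 0 \<and> g z \<noteq> 0 \<and> y \<otimes>\<^bsub>G\<^esub> z = x}. f y * g z),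
     one = (\<lambda>x. if x = \<one>\<^bsub>G\<^esub> then 1 else 0),
     zero = (\<lambda>x. 0),
     add = (\<lambda>f g x. f x + g x) \<rparr>"

definition scale :: "rat \<Rightarrow> ('m \<Rightarrow> rat) \<Rightarrow> 'm \<Rightarrow> rat" where
  "scale c f = (\<lambda>x. c * f x)"

subsection \<open>Submonoids of the matrix monoid\<close>

definition unitriangulars :: "nat \<Rightarrow> 'a::field mat set" where
  "unitriangulars n =
     {A \<in> carrier_mat n n. upper_triangular A \<and> (\<forall>i<n. A $$ (i, i) = 1)}"

definition torus :: "nat \<Rightarrow> 'a::field mat set" where
  "torus n = {A \<in> carrier_mat n n. diagonal_mat A \<and> invertible_mat A}"

definition rooks :: "nat \<Rightarrow> 'a::field mat set" where
  "rooks n = {A \<in> carrier_mat n n.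
     (\<forall>i<n. card {j. j < n \<and> A $$ (i, j) \<noteq> 0} \<le> 1) \<and>
     (\<forall>j<n. card {i. i < n \<and> A $$ (i, j) \<noteq> 0} \<le> 1)}"

definition perm_mat :: "nat \<Rightarrow> (nat \<Rightarrow> nat) \<Rightarrow> 'a::field mat" where
  "perm_mat n p = mat n n (\<lambda>(i, j). if p i = j then 1 else 0)"

definition perm_mats :: "nat \<Rightarrow> 'a::field mat set" where
  "perm_mats n = {perm_mat n p | p. p permutes {..<n}}"

definition simple_refl :: "nat \<Rightarrow> nat \<Rightarrow> 'a::field mat" where
  "simple_refl n k = perm_mat n (Transposition.transpose k (Suc k))"

definition nu :: "nat \<Rightarrow> 'a::field mat" where
  "nu n = mat n n (\<lambda>(i, j). if j = Suc i then 1 else 0)"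

subsection \<open>Lengths\<close>

definition cox_length :: "nat \<Rightarrow> 'a::field mat \<Rightarrow> nat" where
  "cox_length n w = (LEAST m. \<exists>ks. length ks = m \<and> (\<forall>k \<in> set ks. Suc k < n) \<and>
     w = foldr (\<lambda>k A. simple_refl n k * A) ks (1\<^sub>m n))"

definition tilde :: "'a::field mat \<Rightarrow> 'a mat" where
  "tilde \<sigma> = map_mat (\<lambda>x. if x = 0 then 0 else 1) \<sigma>"

definition rook_length :: "nat \<Rightarrow> 'a::field mat \<Rightarrow> nat" where
  "rook_length n \<sigma> = (LEAST m. \<exists>u \<in> perm_mats n. \<exists>w \<in> perm_mats n.
     m = cox_length n u + cox_length n w \<and>
     u * tilde \<sigma> * w = nu n ^\<^sub>m (n - vec_space.rank n \<sigma>))"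

subsection \<open>The action of rook matrices on the torus\<close>

definition rows_supp :: "'a::field mat \<Rightarrow> nat set" where
  "rows_supp \<sigma> = {i. i < dim_row \<sigma> \<and> (\<exists>j<dim_col \<sigma>. \<sigma> $$ (i, j) \<noteq> 0)}"

definition row_col :: "'a::field mat \<Rightarrow> nat \<Rightarrow> nat" where
  "row_col \<sigma> i = (THE j. j < dim_col \<sigma> \<and> \<sigma> $$ (i, j) \<noteq> 0)"

definition hat :: "nat \<Rightarrow> 'a::field mat \<Rightarrow> nat \<Rightarrow> nat" where
  "hat n \<sigma> = (THE p. p permutes {..<n} \<and> (\<forall>i \<in> rows_supp \<sigma>. p i = row_col \<sigma> i) \<and>
     strict_mono_on ({..<n} - rows_supp \<sigma>) p)"

text \<open>The sum below has a single summand, since \<open>hat n \<sigma>\<close> is a permutation.\<close>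

definition torus_act :: "nat \<Rightarrow> 'a::field mat \<Rightarrow> 'a mat \<Rightarrow> 'a mat" where
  "torus_act n t \<sigma> = mat_diag n (\<lambda>j. \<Sum>i | i < n \<and> hat n \<sigma> i = j. t $$ (i, i))"

definition h_mat :: "nat \<Rightarrow> nat \<Rightarrow> 'a::field \<Rightarrow> 'a mat" where
  "h_mat n k r =
     mat_diag n (\<lambda>i. if i = k then - inverse r else if i = Suc k then r else 1)"

definition hs_mat :: "nat \<Rightarrow> nat \<Rightarrow> 'a::field \<Rightarrow> 'a mat" where
  "hs_mat n k r = simple_refl n k * h_mat n k r * simple_refl n k"

subsection \<open>The ring \<open>H(M, U)\<close>\<close>

definition double_coset :: "nat \<Rightarrow> 'a::field mat \<Rightarrow> 'a mat set" where
  "double_coset n \<sigma> = {u * \<sigma> * v | u v. u \<in> unitriangulars n \<and> v \<in> unitriangulars n}"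

text \<open>The division in the exponent is exact, since \<open>r * (1 - r)\<close> is even.\<close>

definition T_elt :: "nat \<Rightarrow> 'a::{finite, field} mat \<Rightarrow> 'a mat \<Rightarrow> rat" where
  "T_elt n \<sigma> = (let r = int (vec_space.rank n \<sigma>) in
     scale (of_nat CARD('a) powi ((r * (1 - r)) div 2))
       (\<lambda>x. if x \<in> double_coset n \<sigma> then 1 else 0))"

definition int_comb :: "nat \<Rightarrow> ('a::{finite, field} mat \<Rightarrow> int) \<Rightarrow> 'a mat \<Rightarrow> rat" where
  "int_comb n c = (\<lambda>x. \<Sum>\<sigma> \<in> rooks n. of_int (c \<sigma>) * T_elt n \<sigma> x)"

definition mat_algebra :: "nat \<Rightarrow> ('a::{finite, field} mat \<Rightarrow> rat) ring" where
  "mat_algebra n = monoid_algebra (ring_mat TYPE('a) n ())"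

text \<open>The unit of \<open>H(M, U)\<close> is \<open>T_elt n (1\<^sub>m n)\<close>, not the unit of the monoid algebra.\<close>

definition HMU :: "nat \<Rightarrow> ('a::{finite, field} mat \<Rightarrow> rat) ring" where
  "HMU n = (mat_algebra n)\<lparr> carrier := range (int_comb n), one := T_elt n (1\<^sub>m n) \<rparr>"

end

theory Submission
  imports Defs
begin

text \<open>
  Let $e$ be the idempotent of the group $U$ and $[x] = e x e$, the average over the double coset
  $U x U$; thus $[u x v] = [x]$ for $u, v \in U$.  The heart of the matter is the count
  $|U \sigma U| = q^{\ell(\sigma) + r(r-1)/2}$, which gives $T_\sigma = q^{\ell(\sigma)} [\sigma]$.

  Let $x_k(a) = 1 + a E_{k,k+1}$.  Since $s_k$ normalises $\{u \in U \mid u_{k,k+1} = 0\}$, one has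
  $[s_k][\sigma] = q^{-1} \sum_a [s_k x_k(a) \sigma]$.  Call $k$ a descent of $\sigma$ if row $k + 1$
  is nonzero and row $k$ is zero up to the column of its entry.  If $k$ is not a descent, then
  $x_k(a) \sigma \in \sigma U$, every summand is $[s_k \sigma]$, and $|U s_k \sigma U| = q |U \sigma U|$
  unless $s_k \sigma = \sigma$.  If $k$ is a descent of $\sigma$, it is not one of $s_k \sigma$, and
  the rank one Bruhat relation turns the summands with $a \neq 0$ into $[h_k(a) \sigma]$.
  An element without left or right descents is $t \nu^{n-r}$ with $t \in T$, for which the double
  coset is explicit, so the length counts the descent steps that lead to it.  Right multiplication
  is reduced to left multiplication by the anti-automorphism $A \mapsto J A^T J$, $J$ the
  antidiagonal permutation matrix.  Finally $\nu U \subseteq U \nu$ gives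
  $[\nu][\sigma] = [\nu \sigma]$.
\<close>

subsection \<open>Elementary matrices, rook matrices and the torus\<close>

text \<open>Two obstacles shape the argument. The length is a minimum over arbitrary pairs u, w, so
  removing descents only bounds it from above; the bound from below comes from the fact that one
  simple reflection, on either side, divides the size of a double coset by at most q. Once both
  bounds agree, statements about lengths are read off from cardinalities. The factor q^{r(1-r)/2} in
  T_\<sigma> is the inverse of |U \<nu>^{n-r} U|, the size left over when no descent remains.

  The other obstacle is integrality: e has rational coefficients, so it is not visible that the
  T_\<sigma> span a ring over the integers. Undoing a descent step multiplies by T_{s_k} without any
  extra term, hence each T_\<sigma> is a plain product of generators, and it is enough that left
  multiplication by a generator preserves the integral span. For T_\<nu> this requires
  \<ell>(\<nu>\<sigma>) \<le> \<ell>(\<sigma>), which has an induction of its own.\<close>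

declare index_mult_mat(1) [simp del]

text \<open>The simp rule switched off above unfolds entries of a product to scalar products of rows
  and columns. This form, with an explicit sum over \<open>k<n\<close>, is invoked only where such
  an expansion is wanted.\<close>

lemma index_mult_square:
  assumes "A \<in> carrier_mat n n" "B \<in> carrier_mat n n" "i < n" "j < n"
  shows "(A * B) $$ (i, j) = (\<Sum>k<n. A $$ (i, k) * B $$ (k, j))"
  using assms by (auto simp: scalar_prod_def lessThan_atLeast0 index_mult_mat(1))

text \<open>The matrix 1 + a E_{i,j}; \<open>elem_mat n k (Suc k)\<close> parametrises the root
  subgroup x_k.\<close>

definition elem_mat :: "nat \<Rightarrow> nat \<Rightarrow> nat \<Rightarrow> 'a::field \<Rightarrow> 'a mat" where
  "elem_mat n i j a =
     mat n n (\<lambda>(r, s). (if r = s then 1 else 0) + (if r = i \<and> s = j then a else 0))"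

lemma elem_mat_carrier [simp]: "elem_mat n i j a \<in> carrier_mat n n"
  by (simp add: elem_mat_def)

lemma elem_mat_mult_left:
  assumes "A \<in> carrier_mat n n" "j < n" "r < n" "s < n"
  shows "(elem_mat n i j a * A) $$ (r, s) = A $$ (r, s) + (if r = i then a * A $$ (j, s) else 0)"
proof -
  have "(elem_mat n i j a * A) $$ (r, s) =
      (\<Sum>k<n. (if k = r then A $$ (r, s) else 0) + (if k = j then (if r = i then a * A $$ (j, s) else 0) else 0))"
    unfolding index_mult_square[OF elem_mat_carrier assms(1,3,4)]
    by (rule sum.cong) (use assms in \<open>auto simp: elem_mat_def algebra_simps\<close>)
  then show ?thesis using assms by (simp add: sum.distrib)
qed

lemma elem_mat_mult_right:
  assumes "A \<in> carrier_mat n n" "i < n" "r < n" "s < n"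
  shows "(A * elem_mat n i j a) $$ (r, s) = A $$ (r, s) + (if s = j then A $$ (r, i) * a else 0)"
proof -
  have "(A * elem_mat n i j a) $$ (r, s) =
      (\<Sum>k<n. (if k = s then A $$ (r, s) else 0) + (if k = i then (if s = j then A $$ (r, i) * a else 0) else 0))"
    unfolding index_mult_square[OF assms(1) elem_mat_carrier assms(3,4)]
    by (rule sum.cong) (use assms in \<open>auto simp: elem_mat_def algebra_simps\<close>)
  then show ?thesis using assms by (simp add: sum.distrib)
qed

lemma elem_mat_add:
  assumes "i < j" "j < n"
  shows "elem_mat n i j a * elem_mat n i j b = elem_mat n i j (a + b)"
proof (rule eq_matI)
  fix r s assume "r < dim_row (elem_mat n i j (a + b))" "s < dim_col (elem_mat n i j (a + b))"
  then have "r < n" "s < n" by (auto simp: elem_mat_def)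
  then show "(elem_mat n i j a * elem_mat n i j b) $$ (r, s) = elem_mat n i j (a + b) $$ (r, s)"
    using assms by (subst elem_mat_mult_left[OF elem_mat_carrier]) (auto simp: elem_mat_def)
qed (auto simp: elem_mat_def)

lemma elem_mat_0: "elem_mat n i j 0 = 1\<^sub>m n"
  by (rule eq_matI) (auto simp: elem_mat_def)

section \<open>Permutation matrices and simple reflections\<close>

lemma perm_mat_carrier [simp]: "perm_mat n p \<in> carrier_mat n n"
  by (simp add: perm_mat_def)

lemma simple_refl_carrier [simp]: "simple_refl n k \<in> carrier_mat n n"
  by (simp add: simple_refl_def)

lemma dim_simple_refl [simp]: "dim_row (simple_refl n k) = n" "dim_col (simple_refl n k) = n"
  by (simp_all add: simple_refl_def perm_mat_def)

lemma perm_mat_mult_left: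
  assumes "p permutes {..<n}" "A \<in> carrier_mat n n" "i < n" "j < n"
  shows "(perm_mat n p * A) $$ (i, j) = A $$ (p i, j)"
proof -
  have "p i < n" using permutes_in_image[OF assms(1), of i] assms(3) by simp
  moreover have "(perm_mat n p * A) $$ (i, j) = (\<Sum>k<n. (if k = p i then A $$ (p i, j) else 0))"
    unfolding index_mult_square[OF perm_mat_carrier assms(2-4)]
    by (rule sum.cong) (use assms in \<open>auto simp: perm_mat_def\<close>)
  ultimately show ?thesis by simp
qed

lemma perm_mat_mult_right:
  assumes "p permutes {..<n}" "A \<in> carrier_mat n n" "i < n" "j < n"
  shows "(A * perm_mat n p) $$ (i, p j) = A $$ (i, j)"
proof -
  have pj: "p j < n" using permutes_in_image[OF assms(1), of j] assms(4) by simp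
  have "(A * perm_mat n p) $$ (i, p j) = (\<Sum>k<n. (if k = j then A $$ (i, j) else 0))"
    unfolding index_mult_square[OF assms(2) perm_mat_carrier assms(3) pj]
    by (rule sum.cong) (use assms pj permutes_inj[OF assms(1)] in \<open>auto simp: perm_mat_def inj_eq\<close>)
  then show ?thesis using assms by simp
qed

abbreviation swap :: "nat \<Rightarrow> nat \<Rightarrow> nat" where
  "swap k \<equiv> Transposition.transpose k (Suc k)"

lemma swap_permutes: "Suc k < n \<Longrightarrow> swap k permutes {..<n}"
  by (rule permutes_swap_id) auto

lemma swap_less: "Suc k < n \<Longrightarrow> i < n \<Longrightarrow> swap k i < n"
  by (auto simp: Transposition.transpose_def)

lemma simple_refl_mult_left:
  assumes "Suc k < n" "A \<in> carrier_mat n n" "i < n" "j < n"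
  shows "(simple_refl n k * A) $$ (i, j) = A $$ (swap k i, j)"
  unfolding simple_refl_def by (rule perm_mat_mult_left[OF swap_permutes]) (use assms in auto)

lemma simple_refl_mult_right:
  assumes "Suc k < n" "A \<in> carrier_mat n n" "i < n" "j < n"
  shows "(A * simple_refl n k) $$ (i, j) = A $$ (i, swap k j)"
  using perm_mat_mult_right[OF swap_permutes[OF assms(1)] assms(2,3), of "swap k j"] assms
  by (simp add: simple_refl_def swap_less)

lemma perm_mat_id: "perm_mat n id = 1\<^sub>m n"
  by (rule eq_matI) (auto simp: perm_mat_def)

text \<open>Row i of \<open>perm_mat n p\<close> has its 1 in column \<open>p i\<close>, the
  convention of permutations acting on the right; composition of functions therefore appears in
  reversed order.\<close>

lemma perm_mat_mult:
  assumes "p permutes {..<n}"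
  shows "perm_mat n p * perm_mat n p' = perm_mat n (p' \<circ> p)"
proof (rule eq_matI)
  fix i j assume "i < dim_row (perm_mat n (p' \<circ> p) :: 'a mat)" "j < dim_col (perm_mat n (p' \<circ> p) :: 'a mat)"
  then have "i < n" "j < n" by (auto simp: perm_mat_def)
  moreover have "p i < n" using permutes_in_image[OF assms(1), of i] \<open>i < n\<close> by simp
  ultimately show "(perm_mat n p * perm_mat n p') $$ (i, j) = (perm_mat n (p' \<circ> p) :: 'a mat) $$ (i, j)"
    by (simp add: perm_mat_mult_left[OF assms perm_mat_carrier]) (simp add: perm_mat_def)
qed (auto simp: perm_mat_def)

lemma simple_refl_square:
  assumes "Suc k < n"
  shows "simple_refl n k * simple_refl n k = 1\<^sub>m n"
  unfolding simple_refl_def perm_mat_mult[OF swap_permutes[OF assms]] by (simp add: perm_mat_id)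

lemma simple_refl_cancel:
  assumes "Suc k < n" "A \<in> carrier_mat n n"
  shows "simple_refl n k * (simple_refl n k * A) = A"
proof -
  have "simple_refl n k * (simple_refl n k * A) = (simple_refl n k * simple_refl n k) * A"
    by (rule assoc_mult_mat[symmetric, of _ n n _ n _ n]) (use assms in auto)
  then show ?thesis using assms by (simp add: simple_refl_square)
qed

section \<open>The shift matrix and its powers\<close>

lemma nu_carrier [simp]: "nu n \<in> carrier_mat n n"
  by (simp add: nu_def)

lemma dim_nu [simp]: "dim_row (nu n) = n" "dim_col (nu n) = n"
  by (simp_all add: nu_def)

lemma nu_mult_left:
  assumes "A \<in> carrier_mat n n" "i < n" "j < n"
  shows "(nu n * A) $$ (i, j) = (if Suc i < n then A $$ (Suc i, j) else 0)"
proof -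
  have "(nu n * A) $$ (i, j) = (\<Sum>k<n. (if k = Suc i then A $$ (Suc i, j) else 0))"
    unfolding index_mult_square[OF nu_carrier assms]
    by (rule sum.cong) (use assms in \<open>auto simp: nu_def\<close>)
  then show ?thesis by simp
qed

lemma nu_mult_right:
  assumes "A \<in> carrier_mat n n" "i < n" "j < n"
  shows "(A * nu n) $$ (i, j) = (if j = 0 then 0 else A $$ (i, j - 1))"
proof -
  have "(A * nu n) $$ (i, j) = (\<Sum>k<n. (if k = j - 1 then if j = 0 then 0 else A $$ (i, j - 1) else 0))"
    unfolding index_mult_square[OF assms(1) nu_carrier assms(2,3)]
    by (rule sum.cong) (use assms in \<open>auto simp: nu_def\<close>)
  then show ?thesis using assms by simp
qed

lemma nu_pow_index:
  assumes "i < n" "j < n"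
  shows "(nu n ^\<^sub>m d) $$ (i, j) = (if j = i + d then 1 else 0)"
  using assms
proof (induction d arbitrary: j)
  case (Suc d)
  have "nu n ^\<^sub>m d \<in> carrier_mat n n" by simp
  then show ?case using Suc by (cases j) (auto simp: nu_mult_right)
qed (auto simp: nu_def)

lemma nu_pow_carrier [simp]: "nu n ^\<^sub>m d \<in> carrier_mat n n"
  by simp

text \<open>Reflection in the antidiagonal. Plain transposition would turn U into the lower
  triangular group; reversing the order of the indices as well brings it back to U.\<close>

definition flip :: "nat \<Rightarrow> 'a mat \<Rightarrow> 'a mat" where
  "flip n A = mat n n (\<lambda>(i, j). A $$ (n - 1 - j, n - 1 - i))"

lemma flip_carrier [simp]: "flip n A \<in> carrier_mat n n"
  by (simp add: flip_def)

lemma dim_flip [simp]: "dim_row (flip n A) = n" "dim_col (flip n A) = n"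
  by (simp_all add: flip_def)

lemma flip_index: "i < n \<Longrightarrow> j < n \<Longrightarrow> flip n A $$ (i, j) = A $$ (n - 1 - j, n - 1 - i)"
  by (simp add: flip_def)

lemma flip_flip [simp]: "A \<in> carrier_mat n n \<Longrightarrow> flip n (flip n A) = A"
  by (rule eq_matI) (auto simp: flip_def)

lemma flip_mult:
  assumes "A \<in> carrier_mat n n" "B \<in> carrier_mat n n"
  shows "flip n (A * B :: 'a::field mat) = flip n B * flip n A"
proof (rule eq_matI)
  fix i j assume "i < dim_row (flip n B * flip n A)" "j < dim_col (flip n B * flip n A)"
  then have ij: "i < n" "j < n" by (auto simp: flip_def)
  have "flip n (A * B) $$ (i, j) = (\<Sum>k<n. A $$ (n - Suc j, k) * B $$ (k, n - Suc i))"
    using ij by (simp add: flip_index index_mult_square[OF assms])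
  also have "\<dots> = (\<Sum>k<n. A $$ (n - Suc j, n - Suc k) * B $$ (n - Suc k, n - Suc i))"
    by (rule sum.nat_diff_reindex[symmetric])
  also have "\<dots> = (flip n B * flip n A) $$ (i, j)"
    using ij by (simp add: index_mult_square[OF flip_carrier flip_carrier] flip_index mult.commute)
  finally show "flip n (A * B) $$ (i, j) = (flip n B * flip n A) $$ (i, j)" .
qed (auto simp: flip_def)

lemma flip_nu: "flip n (nu n) = nu n"
  by (rule eq_matI) (auto simp: flip_def nu_def)

lemma flip_simple_refl:
  assumes "Suc k < n"
  shows "flip n (simple_refl n k) = simple_refl n (n - 2 - k)"
proof (rule eq_matI)
  fix i j assume "i < dim_row (simple_refl n (n - 2 - k) :: 'a mat)" "j < dim_col (simple_refl n (n - 2 - k) :: 'a mat)"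
  then have ij: "i < n" "j < n" by (auto simp: simple_refl_def perm_mat_def)
  then have "swap k (n - Suc j) = n - Suc i \<longleftrightarrow> swap (n - 2 - k) i = j"
  proof -
    \<comment> \<open>Writing n = k + m + 2 removes the truncated subtraction: the mirror images of
      k and k + 1 are m + 1 and m, so the reflected index is m.\<close>
    obtain m where m: "n = k + m + 2" by (rule that[of "n - 2 - k"]) (use assms in simp)
    have "n - Suc j = k \<longleftrightarrow> j = Suc m" "n - Suc j = Suc k \<longleftrightarrow> j = m" using m ij by auto
    moreover have "n - Suc i = k \<longleftrightarrow> i = Suc m" "n - Suc i = Suc k \<longleftrightarrow> i = m" using m ij by auto
    moreover have "n - Suc j = n - Suc i \<longleftrightarrow> i = j" using ij by auto
    ultimately show ?thesis using m unfolding Transposition.transpose_def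
      by (cases "j = m"; cases "j = Suc m"; cases "i = m"; cases "i = Suc m") simp_all
  qed
  then show "flip n (simple_refl n k) $$ (i, j) = (simple_refl n (n - 2 - k) :: 'a mat) $$ (i, j)"
    using ij assms by (auto simp: flip_index simple_refl_def perm_mat_def)
qed (auto simp: flip_def simple_refl_def perm_mat_def)

lemma hs_mat_eq:
  assumes "Suc k < n"
  shows "hs_mat n k r = mat_diag n (\<lambda>i. if i = k then r else if i = Suc k then - inverse r else 1)"
proof (rule eq_matI)
  let ?D = "mat_diag n (\<lambda>i. if i = k then r else if i = Suc k then - inverse r else 1)"
  fix i j assume "i < dim_row ?D" "j < dim_col ?D"
  then have ij: "i < n" "j < n" by (auto simp: mat_diag_def)
  have [simp]: "h_mat n k r \<in> carrier_mat n n" by (simp add: h_mat_def)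
  have "hs_mat n k r $$ (i, j) = h_mat n k r $$ (swap k i, swap k j)"
    using assms ij by (simp add: hs_mat_def simple_refl_mult_left simple_refl_mult_right swap_less
        mult_carrier_mat[of _ n n])
  then show "hs_mat n k r $$ (i, j) = ?D $$ (i, j)"
    using ij assms by (auto simp: h_mat_def mat_diag_def Transposition.transpose_def)
qed (auto simp: hs_mat_def mat_diag_def simple_refl_def perm_mat_def)

text \<open>Conjugation by s_k exchanges the entries of h_k(r) in positions k and k + 1, and
  reversing the order of the indices exchanges them once more. This is why h_k^s takes the place of
  h_k in the formulas on the right.\<close>

lemma flip_hs_mat:
  assumes "Suc k < n"
  shows "flip n (hs_mat n k r) = h_mat n (n - 2 - k) r"
proof -
  have "n - Suc j = k \<longleftrightarrow> j = n - 1 - k" "n - Suc j = Suc k \<longleftrightarrow> j = n - 2 - k"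
    "n - 1 - k = Suc (n - 2 - k)" if "j < n" for j using that assms by auto
  moreover have "n - Suc j = n - Suc i \<longleftrightarrow> i = j" if "i < n" "j < n" for i j using that by auto
  ultimately show ?thesis unfolding hs_mat_eq[OF assms] h_mat_def
    by (intro eq_matI) (simp_all add: flip_index mat_diag_def)
qed

section \<open>Rook matrices and their closure properties\<close>

lemma rooks_iff:
  "A \<in> rooks n \<longleftrightarrow> A \<in> carrier_mat n n \<and>
     (\<forall>i<n. \<forall>j<n. \<forall>j'<n. A $$ (i, j) \<noteq> 0 \<longrightarrow> A $$ (i, j') \<noteq> 0 \<longrightarrow> j = j') \<and>
     (\<forall>j<n. \<forall>i<n. \<forall>i'<n. A $$ (i, j) \<noteq> 0 \<longrightarrow> A $$ (i', j) \<noteq> 0 \<longrightarrow> i = i')"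
proof -
  have "card {j. j < n \<and> P j} \<le> 1 \<longleftrightarrow> (\<forall>j<n. \<forall>j'<n. P j \<longrightarrow> P j' \<longrightarrow> j = j')" for P
  proof -
    have "finite {j. j < n \<and> P j}" by simp
    from card_le_Suc0_iff_eq[OF this] show ?thesis unfolding One_nat_def by blast
  qed
  then show ?thesis unfolding rooks_def by simp
qed

lemma rooks_carrier: "A \<in> rooks n \<Longrightarrow> A \<in> carrier_mat n n"
  by (simp add: rooks_def)

lemma rook_row_eq:
  assumes "A \<in> rooks n" "A $$ (i, j) \<noteq> 0" "A $$ (i, j') \<noteq> 0" "i < n" "j < n" "j' < n"
  shows "j = j'"
  using assms unfolding rooks_iff by blast

lemma rook_col_eq:
  assumes "A \<in> rooks n" "A $$ (i, j) \<noteq> 0" "A $$ (i', j) \<noteq> 0" "i < n" "i' < n" "j < n"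
  shows "i = i'"
  using assms unfolding rooks_iff by blast

lemma flip_rooks:
  assumes "A \<in> rooks n" shows "flip n A \<in> rooks n"
proof -
  have inj: "a = b" if "n - Suc a = n - Suc b" "a < n" "b < n" for a b using that by arith
  show ?thesis unfolding rooks_iff
  proof (intro conjI allI impI)
    fix i j j' assume "i < n" "j < n" "j' < n" "flip n A $$ (i, j) \<noteq> 0" "flip n A $$ (i, j') \<noteq> 0"
    then show "j = j'" using rook_col_eq[OF assms, of "n - Suc j" "n - Suc i" "n - Suc j'"]
      by - (rule inj, simp_all add: flip_index)
  next
    fix j i i' assume "j < n" "i < n" "i' < n" "flip n A $$ (i, j) \<noteq> 0" "flip n A $$ (i', j) \<noteq> 0"
    then show "i = i'" using rook_row_eq[OF assms, of "n - Suc j" "n - Suc i" "n - Suc i'"]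
      by - (rule inj, simp_all add: flip_index)
  qed simp
qed

lemma perm_mat_mult_rook:
  assumes "p permutes {..<n}" "A \<in> rooks n"
  shows "perm_mat n p * A \<in> rooks n"
proof -
  have [simp]: "p a < n \<longleftrightarrow> a < n" for a using permutes_in_image[OF assms(1), of a] by simp
  have [simp]: "p a = p b \<longleftrightarrow> a = b" for a b using permutes_inj[OF assms(1)] by (auto simp: inj_eq)
  have *: "(perm_mat n p * A) $$ (i, j) = A $$ (p i, j)" if "i < n" "j < n" for i j
    by (rule perm_mat_mult_left[OF assms(1) rooks_carrier[OF assms(2)]]) fact+
  show ?thesis unfolding rooks_iff
  proof (intro conjI allI impI)
    show "perm_mat n p * A \<in> carrier_mat n n"
      using mult_carrier_mat[OF perm_mat_carrier rooks_carrier[OF assms(2)]] .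
  next
    fix i j j' assume "i < n" "j < n" "j' < n"
      "(perm_mat n p * A) $$ (i, j) \<noteq> 0" "(perm_mat n p * A) $$ (i, j') \<noteq> 0"
    then show "j = j'" using rook_row_eq[OF assms(2), of "p i" j j'] by (simp add: *)
  next
    fix i i' j assume "j < n" "i < n" "i' < n"
      "(perm_mat n p * A) $$ (i, j) \<noteq> 0" "(perm_mat n p * A) $$ (i', j) \<noteq> 0"
    then show "i = i'" using rook_col_eq[OF assms(2), of "p i" j "p i'"] by (simp add: *)
  qed
qed

lemma simple_refl_mult_rook:
  assumes "Suc k < n" "A \<in> rooks n"
  shows "simple_refl n k * A \<in> rooks n"
  unfolding simple_refl_def by (rule perm_mat_mult_rook[OF swap_permutes]) (use assms in auto)

lemma mult_simple_refl_rook: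
  assumes "Suc k < n" "A \<in> rooks n"
  shows "A * simple_refl n k \<in> rooks n"
proof -
  have k: "Suc (n - 2 - k) < n" "n - 2 - (n - 2 - k) = k" using assms by auto
  have "A * simple_refl n k = flip n (simple_refl n (n - 2 - k) * flip n A)"
    using k rooks_carrier[OF assms(2)] by (simp add: flip_mult flip_simple_refl)
  then show ?thesis using simple_refl_mult_rook[OF k(1) flip_rooks[OF assms(2)]] flip_rooks by metis
qed

lemma nu_mult_rook:
  assumes "A \<in> rooks n" shows "nu n * A \<in> rooks n"
proof -
  have *: "(nu n * A) $$ (i, j) = (if Suc i < n then A $$ (Suc i, j) else 0)" if "i < n" "j < n" for i j
    by (rule nu_mult_left[OF rooks_carrier[OF assms]]) fact+
  show ?thesis unfolding rooks_iff
  proof (intro conjI allI impI)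
    show "nu n * A \<in> carrier_mat n n"
      using mult_carrier_mat[OF nu_carrier rooks_carrier[OF assms]] .
  next
    fix i j j' assume "i < n" "j < n" "j' < n" "(nu n * A) $$ (i, j) \<noteq> 0" "(nu n * A) $$ (i, j') \<noteq> 0"
    then show "j = j'" using rook_row_eq[OF assms, of "Suc i" j j'] by (simp add: * split: if_splits)
  next
    fix i i' j assume "j < n" "i < n" "i' < n" "(nu n * A) $$ (i, j) \<noteq> 0" "(nu n * A) $$ (i', j) \<noteq> 0"
    then show "i = i'" using rook_col_eq[OF assms, of "Suc i" j "Suc i'"] by (simp add: * split: if_splits)
  qed
qed

lemma mult_nu_rook:
  assumes "A \<in> rooks n" shows "A * nu n \<in> rooks n"
proof -
  have "A * nu n = flip n (nu n * flip n A)"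
    using rooks_carrier[OF assms] by (simp add: flip_mult flip_nu)
  then show ?thesis using nu_mult_rook[OF flip_rooks[OF assms]] flip_rooks by metis
qed

lemma one_rook: "1\<^sub>m n \<in> rooks n"
  by (auto simp: rooks_iff)

lemma nu_pow_rook: "nu n ^\<^sub>m d \<in> rooks n"
  by (induction d) (auto intro: mult_nu_rook simp: one_rook)

lemma nu_rook: "nu n \<in> rooks n"
  using nu_mult_rook[OF one_rook, of n] by simp

lemma mat_diag_eq_one: "(\<And>i. i < n \<Longrightarrow> f i = 1) \<Longrightarrow> mat_diag n f = 1\<^sub>m n"
  by (rule eq_matI) (auto simp: mat_diag_def)

section \<open>The torus\<close>

lemma torus_iff:
  "t \<in> torus n \<longleftrightarrow> (\<exists>d. t = mat_diag n d \<and> (\<forall>i<n. d i \<noteq> 0))"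
proof
  assume t: "t \<in> torus n"
  then have c: "t \<in> carrier_mat n n" and d: "diagonal_mat t" and "invertible_mat t" by (auto simp: torus_def)
  then obtain B where B: "t * B = 1\<^sub>m n" "B * t = 1\<^sub>m (dim_row B)"
    by (auto simp: invertible_mat_def inverts_mat_def)
  \<comment> \<open>\<open>inverts_mat\<close> does not fix the dimensions of \<open>B\<close>; they
    are read from the two products.\<close>
  have "B \<in> carrier_mat n n" using B c
    by (metis carrier_matI carrier_matD(2) index_mult_mat(3) index_one_mat(3))
  have t_eq: "t = mat_diag n (\<lambda>i. t $$ (i, i))"
    by (rule eq_matI) (use c d in \<open>auto simp: mat_diag_def diagonal_mat_def\<close>)
  have "t $$ (i, i) \<noteq> 0" if "i < n" for i
  proof -
    have "(t * B) $$ (i, i) = t $$ (i, i) * B $$ (i, i)"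
      using that \<open>B \<in> carrier_mat n n\<close> by (subst t_eq) (simp add: mat_diag_mult_left)
    then show ?thesis using B that by auto
  qed
  then show "\<exists>d. t = mat_diag n d \<and> (\<forall>i<n. d i \<noteq> 0)" using t_eq by blast
next
  assume "\<exists>d. t = mat_diag n d \<and> (\<forall>i<n. d i \<noteq> 0)"
  then obtain d where d: "t = mat_diag n d" "\<forall>i<n. d i \<noteq> 0" by blast
  have "mat_diag n d * mat_diag n (\<lambda>i. inverse (d i)) = 1\<^sub>m n"
    "mat_diag n (\<lambda>i. inverse (d i)) * mat_diag n d = 1\<^sub>m n"
    using d(2) by (simp_all add: mat_diag_eq_one)
  then have "invertible_mat t" unfolding d(1) invertible_mat_def inverts_mat_def
    by (auto simp: mat_diag_def simp del: mat_diag_diag intro!: exI[of _ "mat_diag n (\<lambda>i. inverse (d i))"])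
  then show "t \<in> torus n" by (auto simp: torus_def diagonal_mat_def d(1) mat_diag_def)
qed

lemma mat_diag_torus: "(\<And>i. i < n \<Longrightarrow> d i \<noteq> 0) \<Longrightarrow> mat_diag n d \<in> torus n"
  unfolding torus_iff by blast

lemma torus_carrier: "t \<in> torus n \<Longrightarrow> t \<in> carrier_mat n n"
  by (simp add: torus_def)

lemma h_mat_torus: "r \<noteq> 0 \<Longrightarrow> h_mat n k r \<in> torus n"
  unfolding h_mat_def by (rule mat_diag_torus) auto

lemma hs_mat_torus: "Suc k < n \<Longrightarrow> r \<noteq> 0 \<Longrightarrow> hs_mat n k r \<in> torus n"
  unfolding hs_mat_eq by (rule mat_diag_torus) auto

lemma one_torus: "1\<^sub>m n \<in> torus n"
  unfolding torus_iff by (rule exI[of _ "\<lambda>_. 1"]) simp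

lemma torus_commute: "t \<in> torus n \<Longrightarrow> t' \<in> torus n \<Longrightarrow> t * t' = t' * t"
  unfolding torus_iff by (auto simp: mult.commute)

lemma torus_inverse:
  assumes "t \<in> torus n"
  obtains t' where "t' \<in> torus n" "t * t' = 1\<^sub>m n" "t' * t = 1\<^sub>m n"
proof -
  obtain d where d: "t = mat_diag n d" "\<forall>i<n. d i \<noteq> 0" using assms torus_iff by blast
  have "mat_diag n d * mat_diag n (\<lambda>i. inverse (d i)) = 1\<^sub>m n"
    "mat_diag n (\<lambda>i. inverse (d i)) * mat_diag n d = 1\<^sub>m n"
    using d(2) by (simp_all add: mat_diag_eq_one)
  moreover have "mat_diag n (\<lambda>i. inverse (d i)) \<in> torus n"
    unfolding torus_iff using d(2) by (intro exI[of _ "\<lambda>i. inverse (d i)"]) auto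
  ultimately show ?thesis using that d(1) by blast
qed

lemma torus_mult_rook:
  assumes "t \<in> torus n" "A \<in> rooks n" shows "t * A \<in> rooks n"
proof -
  obtain d where d: "t = mat_diag n d" "\<forall>i<n. d i \<noteq> 0" using assms torus_iff by blast
  show ?thesis using assms(2) d unfolding rooks_iff by (auto simp: mat_diag_mult_left)
qed

lemma mult_torus_rook:
  assumes "t \<in> torus n" "A \<in> rooks n" shows "A * t \<in> rooks n"
proof -
  obtain d where d: "t = mat_diag n d" "\<forall>i<n. d i \<noteq> 0" using assms torus_iff by blast
  show ?thesis using assms(2) d unfolding rooks_iff by (auto simp: mat_diag_mult_right)
qed

lemma torus_rook: "t \<in> torus n \<Longrightarrow> t \<in> rooks n"
  using torus_mult_rook[OF _ one_rook] torus_carrier by fastforce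

lemma simple_refl_rook: "Suc k < n \<Longrightarrow> simple_refl n k \<in> rooks n"
  using simple_refl_mult_rook[OF _ one_rook] by fastforce

lemma flip_torus:
  assumes "t \<in> torus n" shows "flip n t \<in> torus n"
proof -
  obtain d where d: "t = mat_diag n d" "\<forall>i<n. d i \<noteq> 0" using assms torus_iff by blast
  have "flip n t = mat_diag n (\<lambda>i. d (n - Suc i))"
    unfolding d(1) by (rule eq_matI) (auto simp: flip_def mat_diag_def)
  then show ?thesis unfolding torus_iff using d(2) by (intro exI[of _ "\<lambda>i. d (n - Suc i)"]) auto
qed

subsection \<open>Unitriangular matrices and double cosets\<close>

lemma unitriangulars_iff:
  "A \<in> unitriangulars n \<longleftrightarrow> A \<in> carrier_mat n n \<and>
     (\<forall>i<n. \<forall>j<i. A $$ (i, j) = 0) \<and> (\<forall>i<n. A $$ (i, i) = 1)"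
  unfolding unitriangulars_def upper_triangular_def by auto

lemma unitriangulars_carrier: "A \<in> unitriangulars n \<Longrightarrow> A \<in> carrier_mat n n"
  by (simp add: unitriangulars_iff)

lemma unitriangular_below: "A \<in> unitriangulars n \<Longrightarrow> i < n \<Longrightarrow> j < i \<Longrightarrow> A $$ (i, j) = 0"
  by (simp add: unitriangulars_iff)

lemma unitriangular_diag: "A \<in> unitriangulars n \<Longrightarrow> i < n \<Longrightarrow> A $$ (i, i) = 1"
  by (simp add: unitriangulars_iff)

lemma one_unitriangular [simp]: "1\<^sub>m n \<in> unitriangulars n"
  by (simp add: unitriangulars_iff)

lemma elem_mat_unitriangular: "i < j \<Longrightarrow> elem_mat n i j a \<in> unitriangulars n"
  by (auto simp: unitriangulars_iff elem_mat_def)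

lemma unitriangular_mult:
  assumes A: "A \<in> unitriangulars n" and B: "B \<in> unitriangulars n"
  shows "A * B \<in> unitriangulars n"
  unfolding unitriangulars_iff
proof (intro conjI allI impI)
  note c = unitriangulars_carrier[OF A] unitriangulars_carrier[OF B]
  show "A * B \<in> carrier_mat n n" using c by (rule mult_carrier_mat)
  fix i assume i: "i < n"
  have "(A * B) $$ (i, i) = (\<Sum>k<n. if k = i then 1 else 0)"
    unfolding index_mult_square[OF c i i]
  proof (rule sum.cong[OF refl])
    fix k assume "k \<in> {..<n}"
    then show "A $$ (i, k) * B $$ (k, i) = (if k = i then 1 else 0)"
      using A B i unfolding unitriangulars_iff by (cases k i rule: linorder_cases) auto
  qed
  then show "(A * B) $$ (i, i) = 1" using i by simp
  fix j assume j: "j < i"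
  show "(A * B) $$ (i, j) = 0"
    unfolding index_mult_square[OF c i less_trans[OF j i]]
  proof (rule sum.neutral, rule ballI)
    fix k assume "k \<in> {..<n}"
    then show "A $$ (i, k) * B $$ (k, j) = 0"
      using A B i j unfolding unitriangulars_iff by (cases "k < i") auto
  qed
qed

text \<open>The entries in \<open>S\<close> are free and the others are fixed by \<open>b\<close>.
  With \<open>S\<close> the full square this gives finiteness of the matrix space; with
  \<open>S\<close> the region above a superdiagonal it gives the size of the double coset of a power
  of \<open>nu\<close>.\<close>

lemma
  fixes b :: "nat \<Rightarrow> nat \<Rightarrow> 'a::finite"
  assumes S: "S \<subseteq> {..<n} \<times> {..<n}"
  shows finite_mat_prescribed:
      "finite {A \<in> carrier_mat n n. \<forall>i<n. \<forall>j<n. (i, j) \<notin> S \<longrightarrow> A $$ (i, j) = b i j}" (is "finite ?M")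
    and card_mat_prescribed:
      "card {A \<in> carrier_mat n n. \<forall>i<n. \<forall>j<n. (i, j) \<notin> S \<longrightarrow> A $$ (i, j) = b i j} = CARD('a) ^ card S"
proof -
  have finS: "finite S" using S by (rule finite_subset) simp
  let ?F = "\<lambda>f. mat n n (\<lambda>(i, j). if (i, j) \<in> S then f (i, j) else b i j)"
  have bij: "bij_betw ?F (S \<rightarrow>\<^sub>E UNIV) ?M"
  proof (rule bij_betw_byWitness[where f' = "\<lambda>A. restrict (\<lambda>(i, j). A $$ (i, j)) S"])
    show "\<forall>f\<in>S \<rightarrow>\<^sub>E UNIV. restrict (\<lambda>(i, j). ?F f $$ (i, j)) S = f"
    proof (intro ballI ext)
      fix f :: "nat \<times> nat \<Rightarrow> 'a" and x assume "f \<in> S \<rightarrow>\<^sub>E UNIV"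
      then show "restrict (\<lambda>(i, j). ?F f $$ (i, j)) S x = f x"
        using S by (cases x; cases "x \<in> S") (auto simp: PiE_def extensional_def)
    qed
    show "\<forall>A\<in>?M. ?F (restrict (\<lambda>(i, j). A $$ (i, j)) S) = A"
      by (auto intro!: eq_matI)
  qed auto
  have "finite (S \<rightarrow>\<^sub>E (UNIV :: 'a set))" using finS by (intro finite_PiE) auto
  then show "finite ?M" using bij_betw_finite[OF bij] by simp
  show "card ?M = CARD('a) ^ card S"
    using bij_betw_same_card[OF bij] finS by (simp add: card_PiE)
qed

lemma finite_carrier_mat: "finite (carrier_mat n n :: 'a::finite mat set)"
proof -
  have "{A \<in> carrier_mat n n. \<forall>i<n. \<forall>j<n. (i, j) \<notin> {..<n} \<times> {..<n} \<longrightarrow> A $$ (i, j) = undefined} =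
      (carrier_mat n n :: 'a mat set)" by auto
  then show ?thesis using finite_mat_prescribed[of "{..<n} \<times> {..<n}" n "\<lambda>_ _. undefined :: 'a"] by auto
qed

lemma finite_unitriangulars: "finite (unitriangulars n :: 'a::{finite, field} mat set)"
  by (rule finite_subset[OF _ finite_carrier_mat]) (auto simp: unitriangulars_iff)

lemma card_unitriangulars_pos: "card (unitriangulars n :: 'a::{finite, field} mat set) > 0"
  using finite_unitriangulars one_unitriangular[of n] by (metis card_gt_0_iff empty_iff)

text \<open>The determinant 1 provides an inverse among all matrices. That it is unitriangular comes
  from finiteness: left multiplication by \<open>A\<close> is injective on the finite set U, hence
  onto, so 1 is reached by some \<open>B'\<close> in U, and one-sided inverses agree.\<close>

lemma unitriangular_inverse:
  fixes A :: "'a::{finite, field} mat"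
  assumes A: "A \<in> unitriangulars n"
  obtains B where "B \<in> unitriangulars n" "A * B = 1\<^sub>m n" "B * A = 1\<^sub>m n"
proof -
  note c = unitriangulars_carrier[OF A]
  have "diag_mat A = map (\<lambda>_. 1) [0..<n]" using A by (auto simp: diag_mat_def unitriangulars_iff)
  moreover have "prod_list (map (\<lambda>_. 1) xs) = (1 :: 'a)" for xs :: "nat list" by (induction xs) auto
  ultimately have "det A \<noteq> 0" using det_upper_triangular[OF _ c] A by (simp add: unitriangulars_def)
  then have "A \<in> Units (ring_mat TYPE('a) n ())" by (rule det_non_zero_imp_unit[OF c])
  then obtain B where B: "B \<in> carrier_mat n n" "A * B = 1\<^sub>m n" "B * A = 1\<^sub>m n"
    by (auto simp: Units_def ring_mat_def)
  have "inj_on ((*) A) (unitriangulars n)"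
  proof (rule inj_onI)
    fix X Y assume X: "X \<in> unitriangulars n" and Y: "Y \<in> unitriangulars n" and "A * X = A * Y"
    then have "B * A * X = B * A * Y"
      using assoc_mult_mat[OF B(1) c unitriangulars_carrier[OF X]]
        assoc_mult_mat[OF B(1) c unitriangulars_carrier[OF Y]] by simp
    then show "X = Y" using B unitriangulars_carrier[OF X] unitriangulars_carrier[OF Y] by simp
  qed
  moreover have "(*) A ` unitriangulars n \<subseteq> unitriangulars n"
    using A unitriangular_mult by auto
  ultimately have "(*) A ` unitriangulars n = unitriangulars n"
    by (intro endo_inj_surj finite_unitriangulars)
  then obtain B' where B': "B' \<in> unitriangulars n" "A * B' = 1\<^sub>m n"
    using one_unitriangular[of n] by (metis imageE)
  have "B' = B * A * B'" using B unitriangulars_carrier[OF B'(1)] by simp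
  also have "\<dots> = B"
    using assoc_mult_mat[OF B(1) c unitriangulars_carrier[OF B'(1)]] B' B by simp
  finally show ?thesis using that B B' by simp
qed

lemma flip_unitriangular:
  assumes "A \<in> unitriangulars n" shows "flip n A \<in> unitriangulars n"
  unfolding unitriangulars_iff
proof (intro conjI allI impI)
  fix i j assume "i < n" "j < i"
  then show "flip n A $$ (i, j) = 0"
    using unitriangular_below[OF assms, of "n - Suc j" "n - Suc i"] by (simp add: flip_index)
next
  fix i assume "i < n"
  then show "flip n A $$ (i, i) = 1"
    using unitriangular_diag[OF assms, of "n - Suc i"] by (simp add: flip_index)
qed simp

section \<open>Double cosets of U\<close>

lemma double_cosetI:
  "u \<in> unitriangulars n \<Longrightarrow> v \<in> unitriangulars n \<Longrightarrow> u * x * v \<in> double_coset n x"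
  unfolding double_coset_def by blast

lemma double_cosetE:
  assumes "y \<in> double_coset n x"
  obtains u v where "u \<in> unitriangulars n" "v \<in> unitriangulars n" "y = u * x * v"
  using assms unfolding double_coset_def by blast

lemma double_coset_self: "x \<in> carrier_mat n n \<Longrightarrow> x \<in> double_coset n x"
  using double_cosetI[OF one_unitriangular one_unitriangular, of n x] by simp

lemma double_coset_carrier:
  assumes "x \<in> carrier_mat n n" shows "double_coset n x \<subseteq> carrier_mat n n"
  using assms unfolding double_coset_def by (auto intro!: mult_carrier_mat dest: unitriangulars_carrier)

lemma finite_double_coset:
  "x \<in> carrier_mat n n \<Longrightarrow> finite (double_coset n (x :: 'a::{finite, field} mat))"
  using double_coset_carrier finite_carrier_mat by (rule finite_subset)

lemma assoc_square:
  "A \<in> carrier_mat n n \<Longrightarrow> B \<in> carrier_mat n n \<Longrightarrow> C \<in> carrier_mat n n \<Longrightarrow> A * (B * C) = A * B * C"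
  by (rule assoc_mult_mat[symmetric])

lemma mult_square: "A \<in> carrier_mat n n \<Longrightarrow> B \<in> carrier_mat n n \<Longrightarrow> A * B \<in> carrier_mat n n"
  by (rule mult_carrier_mat)

lemmas square_mat_simps = assoc_square mult_square unitriangulars_carrier

lemma double_coset_mult_left:
  assumes "u \<in> unitriangulars n" "y \<in> double_coset n x" "x \<in> carrier_mat n n"
  shows "u * y \<in> double_coset n x"
proof -
  obtain a b where ab: "a \<in> unitriangulars n" "b \<in> unitriangulars n" "y = a * x * b"
    using assms(2) by (rule double_cosetE)
  then have "u * y = (u * a) * x * b" using assms by (simp add: square_mat_simps[where n = n])
  then show ?thesis using ab assms by (auto intro: double_cosetI unitriangular_mult)
qed

lemma double_coset_mult_right:
  assumes "v \<in> unitriangulars n" "y \<in> double_coset n x" "x \<in> carrier_mat n n"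
  shows "y * v \<in> double_coset n x"
proof -
  obtain a b where ab: "a \<in> unitriangulars n" "b \<in> unitriangulars n" "y = a * x * b"
    using assms(2) by (rule double_cosetE)
  have "a * x * b * v = a * x * (b * v)" using ab assms by (simp add: square_mat_simps[where n = n])
  then show ?thesis using ab assms by (auto intro: double_cosetI unitriangular_mult)
qed

lemma double_coset_eq:
  fixes x :: "'a::{finite, field} mat"
  assumes "y \<in> double_coset n x" "x \<in> carrier_mat n n"
  shows "double_coset n y = double_coset n x"
proof
  show "double_coset n y \<subseteq> double_coset n x"
  proof
    fix z assume "z \<in> double_coset n y"
    then obtain a b where ab: "a \<in> unitriangulars n" "b \<in> unitriangulars n" "z = a * y * b"
      by (rule double_cosetE)
    then show "z \<in> double_coset n x"
      using double_coset_mult_right[OF ab(2) double_coset_mult_left[OF ab(1) assms] assms(2)] by simp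
  qed
  have y: "y \<in> carrier_mat n n" using double_coset_carrier assms by blast
  obtain u v where uv: "u \<in> unitriangulars n" "v \<in> unitriangulars n" "y = u * x * v"
    using assms(1) by (rule double_cosetE)
  obtain u' where u': "u' \<in> unitriangulars n" "u' * u = 1\<^sub>m n" using uv(1) unitriangular_inverse by blast
  obtain v' where v': "v' \<in> unitriangulars n" "v * v' = 1\<^sub>m n" using uv(2) unitriangular_inverse by blast
  have "u' * y * v' = (u' * u) * x * (v * v')"
  proof -
    have "u' * y * v' = (u' * u) * x * v * v'"
      using uv u' v' assms(2) by (simp add: square_mat_simps[where n = n])
    also have "\<dots> = (u' * u) * x * (v * v')"
      using uv u'(1) v'(1) assms(2) by (simp add: square_mat_simps[where n = n])
    finally show ?thesis .
  qed
  then have x: "x = u' * y * v'" using u' v' assms(2) by simp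
  show "double_coset n x \<subseteq> double_coset n y"
  proof
    fix z assume "z \<in> double_coset n x"
    then obtain a b where ab: "a \<in> unitriangulars n" "b \<in> unitriangulars n" "z = a * x * b"
      by (rule double_cosetE)
    have "x \<in> double_coset n y" unfolding x by (rule double_cosetI[OF u'(1) v'(1)])
    then show "z \<in> double_coset n y"
      using double_coset_mult_right[OF ab(2) double_coset_mult_left[OF ab(1) _ y] y] ab(3) by simp
  qed
qed

text \<open>The anti-automorphism exchanges the two factors from U. One inclusion, proved for all
  matrices, suffices: the other is the same inclusion for \<open>flip n x\<close>, reflected
  back.\<close>

lemma flip_double_coset:
  fixes x :: "'a::{finite, field} mat"
  assumes "x \<in> carrier_mat n n"
  shows "double_coset n (flip n x) = flip n ` double_coset n x"
proof -
  have sub: "flip n ` double_coset n x \<subseteq> double_coset n (flip n x)" if x: "x \<in> carrier_mat n n" for x :: "'a mat"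
  proof safe
    fix y assume "y \<in> double_coset n x"
    then obtain a b where ab: "a \<in> unitriangulars n" "b \<in> unitriangulars n" "y = a * x * b"
      by (rule double_cosetE)
    note c = unitriangulars_carrier[OF ab(1)] unitriangulars_carrier[OF ab(2)]
    have "flip n y = flip n b * flip n x * flip n a"
      unfolding ab(3) flip_mult[OF mult_square[OF c(1) x] c(2)] flip_mult[OF c(1) x]
      by (rule assoc_square[OF flip_carrier flip_carrier flip_carrier])
    then show "flip n y \<in> double_coset n (flip n x)"
      using ab by (simp add: double_cosetI flip_unitriangular)
  qed
  show ?thesis
  proof
    show "flip n ` double_coset n x \<subseteq> double_coset n (flip n x)" using sub[OF assms] .
    show "double_coset n (flip n x) \<subseteq> flip n ` double_coset n x"
    proof
      fix y assume y: "y \<in> double_coset n (flip n x)"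
      then have "y \<in> carrier_mat n n" using double_coset_carrier[OF flip_carrier] by (rule rev_subsetD)
      then have "y = flip n (flip n y)" by simp
      moreover have "flip n y \<in> double_coset n x"
        using sub[OF flip_carrier, of x] imageI[OF y, of "flip n"] assms by auto
      ultimately show "y \<in> flip n ` double_coset n x" by (rule image_eqI)
    qed
  qed
qed

text \<open>If $u \sigma = \tau v$ then, in a fixed row, the nonzero entry of $\tau$ is weakly to the
  left of that of $\sigma$, and it lies in the column of a nonzero entry of $\sigma$ weakly below.
  Downward induction on the row makes both weak inequalities equalities.\<close>

lemma rook_in_double_coset:
  fixes \<sigma> :: "'a::{finite, field} mat"
  assumes \<sigma>: "\<sigma> \<in> rooks n" and \<tau>: "\<tau> \<in> rooks n" and mem: "\<tau> \<in> double_coset n \<sigma>"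
  shows "\<tau> = \<sigma>"
proof -
  note c = rooks_carrier[OF \<sigma>] rooks_carrier[OF \<tau>]
  obtain u w where u: "u \<in> unitriangulars n" and w: "w \<in> unitriangulars n" and eq: "\<tau> = u * \<sigma> * w"
    using mem by (rule double_cosetE)
  obtain v where v: "v \<in> unitriangulars n" "w * v = 1\<^sub>m n" using w unitriangular_inverse by blast
  have "u * \<sigma> * w * v = u * \<sigma> * (w * v)"
    using u w v(1) c by (simp add: square_mat_simps[where n = n])
  then have e: "u * \<sigma> = \<tau> * v"
    using eq u v c by (simp add: mult_square[OF unitriangulars_carrier[OF u] c(1)])
  note cu = unitriangulars_carrier[OF u] and cv = unitriangulars_carrier[OF v(1)]
  have E: "(\<Sum>k<n. u $$ (i, k) * \<sigma> $$ (k, j)) = (\<Sum>k<n. \<tau> $$ (i, k) * v $$ (k, j))" if "i < n" "j < n" for i j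
    using e index_mult_square[OF cu c(1) that] index_mult_square[OF c(2) cv that] by simp
  \<comment> \<open>A column of \<sigma>, and for \<open>B\<close> a row of \<tau>, has a single
    nonzero entry, so each side of \<open>E\<close> shrinks to one term.\<close>
  have A: "(\<Sum>k<n. u $$ (a, k) * \<sigma> $$ (k, j)) = u $$ (a, i) * \<sigma> $$ (i, j)"
    if ij: "\<sigma> $$ (i, j) \<noteq> 0" "i < n" "j < n" for a i j
  proof -
    define m where "m = u $$ (a, i) * \<sigma> $$ (i, j)"
    have "u $$ (a, k) * \<sigma> $$ (k, j) = (if k = i then m else 0)" if "k < n" for k
      using rook_col_eq[OF \<sigma> ij(1) _ ij(2) that ij(3)] by (cases "\<sigma> $$ (k, j) = 0") (auto simp: m_def)
    then have "(\<Sum>k<n. u $$ (a, k) * \<sigma> $$ (k, j)) = m" using ij by simp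
    then show ?thesis unfolding m_def .
  qed
  have B: "(\<Sum>k<n. \<tau> $$ (i, k) * v $$ (k, b)) = \<tau> $$ (i, j) * v $$ (j, b)"
    if ij: "\<tau> $$ (i, j) \<noteq> 0" "i < n" "j < n" for b i j
  proof -
    define m where "m = \<tau> $$ (i, j) * v $$ (j, b)"
    have "\<tau> $$ (i, k) * v $$ (k, b) = (if k = j then m else 0)" if "k < n" for k
      using rook_row_eq[OF \<tau> ij(1) _ ij(2,3) that] by (cases "\<tau> $$ (i, k) = 0") (auto simp: m_def)
    then have "(\<Sum>k<n. \<tau> $$ (i, k) * v $$ (k, b)) = m" using ij by simp
    then show ?thesis unfolding m_def .
  qed
  have step1: "\<exists>j'\<le>j. \<tau> $$ (i, j') \<noteq> 0" if ij: "\<sigma> $$ (i, j) \<noteq> 0" "i < n" "j < n" for i j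
  proof -
    have "(\<Sum>k<n. \<tau> $$ (i, k) * v $$ (k, j)) \<noteq> 0"
      using E[of i j] A[OF ij, of i] ij unitriangular_diag[OF u, of i] by simp
    then obtain k where k: "k \<in> {..<n}" "\<tau> $$ (i, k) * v $$ (k, j) \<noteq> 0"
      by (rule sum.not_neutral_contains_not_neutral)
    then show ?thesis using unitriangular_below[OF v(1), of k j] by (intro exI[of _ k]) (auto simp: not_less[symmetric])
  qed
  have step2: "\<exists>i'\<ge>i. i' < n \<and> \<sigma> $$ (i', j) \<noteq> 0" if ij: "\<tau> $$ (i, j) \<noteq> 0" "i < n" "j < n" for i j
  proof -
    have "(\<Sum>k<n. u $$ (i, k) * \<sigma> $$ (k, j)) \<noteq> 0"
      using E[of i j] B[OF ij, of j] ij unitriangular_diag[OF v(1), of j] by simp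
    then obtain k where k: "k \<in> {..<n}" "u $$ (i, k) * \<sigma> $$ (k, j) \<noteq> 0"
      by (rule sum.not_neutral_contains_not_neutral)
    then show ?thesis using unitriangular_below[OF u, of i k] ij by (intro exI[of _ k]) (auto simp: not_less[symmetric])
  qed
  have row: "\<forall>j<n. \<tau> $$ (i, j) = \<sigma> $$ (i, j)" if "i < n" for i
    using that
  proof (induction i rule: measure_induct_rule[of "\<lambda>i. n - i"])
    case (less i)
    have tau: "\<tau> $$ (i, j) = \<sigma> $$ (i, j)" if ij: "\<tau> $$ (i, j) \<noteq> 0" "j < n" for j
    proof -
      obtain i' where i': "i' \<ge> i" "i' < n" "\<sigma> $$ (i', j) \<noteq> 0" using step2[OF ij(1) less.prems ij(2)] by blast
      \<comment> \<open>A strictly lower row i' of \<tau> agrees with that of \<sigma> by induction,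
        so \<tau> would have two entries in column j.\<close>
      have "i' = i"
      proof (rule ccontr)
        assume "i' \<noteq> i"
        then have "\<tau> $$ (i', j) = \<sigma> $$ (i', j)" using less.IH[of i'] i' less.prems ij by auto
        then show False using rook_col_eq[OF \<tau>, of i j i'] i' ij less.prems \<open>i' \<noteq> i\<close> by auto
      qed
      then have "\<sigma> $$ (i, j) \<noteq> 0" using i' by simp
      then show ?thesis
        using E[of i j] A[of i j i] B[OF ij(1) less.prems ij(2), of j] less.prems ij
          unitriangular_diag[OF u, of i] unitriangular_diag[OF v(1), of j] by simp
    qed
    show ?case
    proof (intro allI impI)
      fix j assume j: "j < n"
      show "\<tau> $$ (i, j) = \<sigma> $$ (i, j)"
      proof (cases "\<sigma> $$ (i, j) = 0")
        case False
        then obtain j' where j': "j' \<le> j" "\<tau> $$ (i, j') \<noteq> 0" using step1[OF False less.prems j] by blast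
        then have "\<sigma> $$ (i, j') \<noteq> 0" using tau[of j'] j by simp
        then have "j' = j" using rook_row_eq[OF \<sigma>, of i j' j] False less.prems j j' by simp
        then show ?thesis using tau j' j by simp
      qed (use tau[OF _ j] in auto)
    qed
  qed
  show ?thesis by (rule eq_matI) (use row c in auto)
qed

text \<open>The uniqueness half of the Bruhat-Renner decomposition. A common point makes the two
  double cosets equal, so one rook matrix lies in the double coset of the other.\<close>

lemma rook_double_cosets_disjoint:
  fixes \<sigma> :: "'a::{finite, field} mat"
  assumes "\<sigma> \<in> rooks n" "\<tau> \<in> rooks n" "x \<in> double_coset n \<sigma>" "x \<in> double_coset n \<tau>"
  shows "\<sigma> = \<tau>"
proof -
  have "double_coset n \<sigma> = double_coset n \<tau>"
    using assms double_coset_eq rooks_carrier by metis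
  then show ?thesis
    using assms double_coset_self[OF rooks_carrier[OF assms(1)]] rook_in_double_coset by metis
qed

subsection \<open>Descents\<close>

text \<open>Every u in U is an element with entry 0 at (k, k + 1) times x_k(b), where b = u_{k,k+1},
  and s_k normalises the elements with entry 0 there. That \<open>u'\<close> again has entry 0 is
  what the injectivity in the size count relies on.\<close>

lemma unitriangular_refl_factor:
  fixes u :: "'a::{finite, field} mat"
  assumes u: "u \<in> unitriangulars n" and k: "Suc k < n"
  obtains u' where "u' \<in> unitriangulars n" "u' $$ (k, Suc k) = 0"
    "simple_refl n k * u = u' * simple_refl n k * elem_mat n k (Suc k) (u $$ (k, Suc k))"
proof -
  define b where "b = u $$ (k, Suc k)"
  define y where "y = u * elem_mat n k (Suc k) (- b)"
  have e: "elem_mat n k (Suc k) c \<in> unitriangulars n" for c :: 'a by (rule elem_mat_unitriangular) simp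
  note cu = unitriangulars_carrier[OF u]
  have y: "y \<in> unitriangulars n" unfolding y_def by (rule unitriangular_mult[OF u e])
  note cy = unitriangulars_carrier[OF y]
  have y0: "y $$ (k, Suc k) = 0"
    unfolding y_def using k by (simp add: elem_mat_mult_right[OF cu] unitriangular_diag[OF u] b_def)
  have "y * elem_mat n k (Suc k) b = u * (elem_mat n k (Suc k) (- b) * elem_mat n k (Suc k) b)"
    unfolding y_def by (rule assoc_mult_mat[OF cu elem_mat_carrier elem_mat_carrier])
  then have ub: "y * elem_mat n k (Suc k) b = u"
    using k cu by (simp add: elem_mat_add elem_mat_0)
  define u' where "u' = simple_refl n k * y * simple_refl n k"
  have cs: "simple_refl n k * y \<in> carrier_mat n n" using cy by (intro mult_square) auto
  have ind: "u' $$ (i, j) = y $$ (swap k i, swap k j)" if "i < n" "j < n" for i j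
    unfolding u'_def using that k cs cy
    by (simp add: simple_refl_mult_right simple_refl_mult_left swap_less)
  have "u' \<in> carrier_mat n n" unfolding u'_def by (rule mult_square[OF cs simple_refl_carrier])
  moreover have "u' $$ (i, j) = 0" if "i < n" "j < i" for i j
  proof -
    \<comment> \<open>Under conjugation by s_k a position below the diagonal receives an entry from
      below the diagonal, except that (k + 1, k) receives the entry (k, k + 1) of \<open>y\<close>,
      which was made zero.\<close>
    have "swap k j < swap k i \<or> (swap k i = k \<and> swap k j = Suc k)"
      using that by (auto simp: Transposition.transpose_def)
    moreover have "swap k i < n" using that k by (simp add: swap_less)
    ultimately show ?thesis using that ind[of i j] y0 unitriangular_below[OF y, of "swap k i" "swap k j"]
      by (metis less_trans)
  qed
  moreover have "u' $$ (i, i) = 1" if "i < n" for i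
    using that k by (simp add: ind unitriangular_diag[OF y] swap_less)
  ultimately have "u' \<in> unitriangulars n" by (simp add: unitriangulars_iff)
  moreover have "u' $$ (k, Suc k) = 0"
    using k unitriangular_below[OF y, of "Suc k" k] by (simp add: ind)
  moreover have "simple_refl n k * u = u' * simple_refl n k * elem_mat n k (Suc k) b"
  proof -
    have "u' * simple_refl n k = simple_refl n k * y * (simple_refl n k * simple_refl n k)"
      unfolding u'_def by (rule assoc_mult_mat[OF cs]) auto
    also have "\<dots> = simple_refl n k * y"
      unfolding simple_refl_square[OF k] by (rule right_mult_one_mat[OF cs])
    finally show ?thesis
      using assoc_mult_mat[OF simple_refl_carrier cy elem_mat_carrier, of k k "Suc k" b] ub by simp
  qed
  ultimately show ?thesis using that unfolding b_def by blast
qed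

text \<open>Read a zero row as having its entry in column \<infinity>. For a rook matrix k is then a
  descent exactly if the entry of row k + 1 lies in a smaller column than that of row k; for
  permutation matrices this is the usual notion.\<close>

definition desc :: "nat \<Rightarrow> nat \<Rightarrow> 'a::field mat \<Rightarrow> bool" where
  "desc n k \<sigma> \<longleftrightarrow> (\<exists>j<n. \<sigma> $$ (Suc k, j) \<noteq> 0 \<and> (\<forall>j'<j. \<sigma> $$ (k, j') = 0))"

text \<open>Left multiplication by x_k(a) adds a multiple of row k + 1 to row k. The new entry lies
  to the right of the entry that row k already has, so a column operation from left to right, which
  is right multiplication by an element of U, has the same effect. If row k + 1 is zero, nothing
  changes.\<close>

lemma not_desc_elem_mat:
  fixes \<sigma> :: "'a::field mat"
  assumes \<sigma>: "\<sigma> \<in> rooks n" and k: "Suc k < n" and nd: "\<not> desc n k \<sigma>"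
  obtains v where "v \<in> unitriangulars n" "elem_mat n k (Suc k) a * \<sigma> = \<sigma> * v"
proof (cases "\<exists>j<n. \<sigma> $$ (Suc k, j) \<noteq> 0")
  case False
  note c = rooks_carrier[OF \<sigma>]
  have "elem_mat n k (Suc k) a * \<sigma> = \<sigma> * 1\<^sub>m n"
    unfolding right_mult_one_mat[OF c]
    by (rule eq_matI) (use False k c in \<open>auto simp: elem_mat_mult_left[OF c] elem_mat_carrier[THEN carrier_matD(1)]\<close>)
  then show ?thesis using that one_unitriangular by blast
next
  case True
  note c = rooks_carrier[OF \<sigma>]
  obtain j where j: "j < n" "\<sigma> $$ (Suc k, j) \<noteq> 0" using True by blast
  then obtain j' where j': "j' < j" "\<sigma> $$ (k, j') \<noteq> 0" using nd unfolding desc_def by blast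
  \<comment> \<open>Adding b times column j' to column j must produce a \<sigma>_{k+1,j} at (k,
    j).\<close>
  define b where "b = a * \<sigma> $$ (Suc k, j) / \<sigma> $$ (k, j')"
  have "elem_mat n k (Suc k) a * \<sigma> = \<sigma> * elem_mat n j' j b"
  proof (rule eq_matI)
    fix r s assume "r < dim_row (\<sigma> * elem_mat n j' j b)" "s < dim_col (\<sigma> * elem_mat n j' j b)"
    then have rs: "r < n" "s < n" using c by (auto simp: elem_mat_def)
    have "s \<noteq> j \<Longrightarrow> \<sigma> $$ (Suc k, s) = 0" using rook_row_eq[OF \<sigma>, of "Suc k" j s] j rs k by auto
    moreover have "r \<noteq> k \<Longrightarrow> \<sigma> $$ (r, j') = 0" using rook_col_eq[OF \<sigma>, of k j' r] j j' rs k by auto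
    ultimately show "(elem_mat n k (Suc k) a * \<sigma>) $$ (r, s) = (\<sigma> * elem_mat n j' j b) $$ (r, s)"
      using rs k j j' by (auto simp: elem_mat_mult_left[OF c] elem_mat_mult_right[OF c] b_def)
  qed (use c in \<open>auto simp: elem_mat_def\<close>)
  then show ?thesis using that elem_mat_unitriangular[OF j'(1)] by blast
qed

text \<open>With zero rows read as entries at infinity, s_k exchanges the two column positions, and
  a strict inequality cannot hold both ways.\<close>

lemma not_desc_simple_refl:
  assumes \<sigma>: "\<sigma> \<in> rooks n" and k: "Suc k < n" and "desc n k \<sigma>"
  shows "\<not> desc n k (simple_refl n k * \<sigma>)"
proof
  note c = rooks_carrier[OF \<sigma>]
  obtain j where j: "j < n" "\<sigma> $$ (Suc k, j) \<noteq> 0" "\<forall>j'<j. \<sigma> $$ (k, j') = 0"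
    using assms(3) unfolding desc_def by blast
  assume "desc n k (simple_refl n k * \<sigma>)"
  then obtain i where i: "i < n" "\<sigma> $$ (k, i) \<noteq> 0" "\<forall>j'<i. \<sigma> $$ (Suc k, j') = 0"
    using k c unfolding desc_def by (auto simp: simple_refl_mult_left)
  have "i = j" using i j by (metis linorder_neqE_nat)
  then show False using rook_col_eq[OF \<sigma>, of k j "Suc k"] i j k by simp
qed

text \<open>The rank one Bruhat relation $s_k x_k(a) s_k = x_k(1/a) h_k(a) s_k x_k(1/a)$, acting on the
  rows of a matrix.\<close>

lemma simple_refl_elem_mat:
  fixes A :: "'a::field mat"
  assumes A: "A \<in> carrier_mat n n" and k: "Suc k < n" and a: "a \<noteq> 0"
  shows "simple_refl n k * (elem_mat n k (Suc k) a * A) =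
    elem_mat n k (Suc k) (1 / a) * (h_mat n k a * (simple_refl n k *
      (elem_mat n k (Suc k) (1 / a) * (simple_refl n k * A))))" (is "?L = ?R")
proof (rule eq_matI)
  let ?s = "simple_refl n k" and ?x = "elem_mat n k (Suc k)"
  have h: "h_mat n k a \<in> carrier_mat n n" by (simp add: h_mat_def)
  have c1: "?s * A \<in> carrier_mat n n" by (rule mult_square) (use A in auto)
  have c2: "?x b * (?s * A) \<in> carrier_mat n n" for b by (rule mult_square) (use c1 in auto)
  have c3: "?s * (?x b * (?s * A)) \<in> carrier_mat n n" for b by (rule mult_square) (use c2 in auto)
  have c4: "h_mat n k a * (?s * (?x b * (?s * A))) \<in> carrier_mat n n" for b
    by (rule mult_square) (use c3 h in auto)
  have c5: "?x a * A \<in> carrier_mat n n" by (rule mult_square) (use A in auto)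
  fix i j assume "i < dim_row ?R" "j < dim_col ?R"
  then have ij: "i < n" "j < n" using A by (auto simp: elem_mat_def)
  have sw: "swap k i < n" "k < n" using ij k by (auto simp: swap_less)
  have hm: "(h_mat n k a * B) $$ (i, j) =
      (if i = k then - inverse a else if i = Suc k then a else 1) * B $$ (i, j)"
    if "B \<in> carrier_mat n n" "i < n" for B i
    using that ij unfolding h_mat_def by (simp add: mat_diag_mult_left[OF that(1)])
  show "?L $$ (i, j) = ?R $$ (i, j)"
    using ij k sw A c1 c2 c3 c4 c5 a
    by (cases "i = k"; cases "i = Suc k")
      (simp_all add: elem_mat_mult_left simple_refl_mult_left hm field_simps)
qed (use A in \<open>auto simp: elem_mat_def\<close>)

lemma h_mat_carrier [simp]: "h_mat n k a \<in> carrier_mat n n"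
  by (simp add: h_mat_def)

text \<open>In the rank one relation the inner factor x_k(1/a) meets s_k \<sigma>, for which k is no
  descent, so it passes to the right into U. The two reflections then cancel, and only h_k(a)
  \<sigma> remains between factors from U.\<close>

lemma desc_elem_mat:
  fixes \<sigma> :: "'a::field mat"
  assumes \<sigma>: "\<sigma> \<in> rooks n" and k: "Suc k < n" and d: "desc n k \<sigma>" and a: "a \<noteq> 0"
  obtains u v where "u \<in> unitriangulars n" "v \<in> unitriangulars n"
    "simple_refl n k * (elem_mat n k (Suc k) a * \<sigma>) = u * (h_mat n k a * \<sigma>) * v"
proof -
  let ?s = "simple_refl n k :: 'a mat" and ?x = "elem_mat n k (Suc k) (1 / a)"
  note c = rooks_carrier[OF \<sigma>]
  have cs: "?s * \<sigma> \<in> carrier_mat n n" using c by (intro mult_square) auto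
  obtain v where v: "v \<in> unitriangulars n" "?x * (?s * \<sigma>) = ?s * \<sigma> * v"
    using not_desc_elem_mat[OF simple_refl_mult_rook[OF k \<sigma>] k not_desc_simple_refl[OF \<sigma> k d]] by metis
  note cv = unitriangulars_carrier[OF v(1)]
  have "?s * (?s * \<sigma> * v) = ?s * (?s * \<sigma>) * v"
    by (rule assoc_square) (use cs cv in auto)
  also have "\<dots> = \<sigma> * v" using k c by (simp add: simple_refl_cancel)
  finally have *: "?s * (?x * (?s * \<sigma>)) = \<sigma> * v" using v(2) by simp
  have ch: "h_mat n k a * \<sigma> \<in> carrier_mat n n" using c by (intro mult_square) auto
  have "?s * (elem_mat n k (Suc k) a * \<sigma>) = ?x * (h_mat n k a * (\<sigma> * v))"
    unfolding simple_refl_elem_mat[OF c k a] * ..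
  also have "\<dots> = ?x * (h_mat n k a * \<sigma>) * v"
    unfolding assoc_square[OF h_mat_carrier c cv] assoc_square[OF elem_mat_carrier ch cv] ..
  finally show ?thesis using that[of ?x v] v(1) elem_mat_unitriangular[of k "Suc k" n "1 / a"] by simp
qed

text \<open>Invariance makes rows k and k + 1 equal, and two equal nonzero rows would put two
  entries into one column.\<close>

lemma simple_refl_mult_eq_iff:
  assumes \<sigma>: "\<sigma> \<in> rooks n" and k: "Suc k < n"
  shows "simple_refl n k * \<sigma> = \<sigma> \<longleftrightarrow> (\<forall>j<n. \<sigma> $$ (k, j) = 0 \<and> \<sigma> $$ (Suc k, j) = 0)"
proof
  note c = rooks_carrier[OF \<sigma>]
  assume eq: "simple_refl n k * \<sigma> = \<sigma>"
  show "\<forall>j<n. \<sigma> $$ (k, j) = 0 \<and> \<sigma> $$ (Suc k, j) = 0"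
  proof (intro allI impI)
    fix j assume j: "j < n"
    have "\<sigma> $$ (k, j) = \<sigma> $$ (Suc k, j)"
      using arg_cong[OF eq, of "\<lambda>A. A $$ (k, j)"] simple_refl_mult_left[OF k c, of k j] k j by simp
    then show "\<sigma> $$ (k, j) = 0 \<and> \<sigma> $$ (Suc k, j) = 0"
      using rook_col_eq[OF \<sigma>, of k j "Suc k"] k j by auto
  qed
next
  note c = rooks_carrier[OF \<sigma>]
  assume z: "\<forall>j<n. \<sigma> $$ (k, j) = 0 \<and> \<sigma> $$ (Suc k, j) = 0"
  show "simple_refl n k * \<sigma> = \<sigma>"
  proof (rule eq_matI)
    fix i j assume "i < dim_row \<sigma>" "j < dim_col \<sigma>"
    then have "i < n" "j < n" using c by auto
    then show "(simple_refl n k * \<sigma>) $$ (i, j) = \<sigma> $$ (i, j)"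
      using z k by (cases "i = k"; cases "i = Suc k") (simp_all add: simple_refl_mult_left[OF k c])
  qed (use c in auto)
qed

lemma desc_simple_refl_neq:
  assumes \<sigma>: "\<sigma> \<in> rooks n" and k: "Suc k < n" and "desc n k \<sigma>"
  shows "simple_refl n k * \<sigma> \<noteq> \<sigma>"
  using assms simple_refl_mult_eq_iff[OF \<sigma> k] unfolding desc_def by auto

text \<open>For y = a \<sigma> b, split a: the factor x_k moves through \<sigma> to the right
  because k is no descent, and s_k conjugates the rest into \<open>u\<close>, which keeps entry 0 at
  (k, k + 1).\<close>

lemma not_desc_mult_double_coset:
  fixes \<sigma> :: "'a::{finite, field} mat"
  assumes \<sigma>: "\<sigma> \<in> rooks n" and k: "Suc k < n" and nd: "\<not> desc n k \<sigma>" and y: "y \<in> double_coset n \<sigma>"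
  obtains u v where "u \<in> unitriangulars n" "u $$ (k, Suc k) = 0" "v \<in> unitriangulars n"
    "simple_refl n k * y = u * (simple_refl n k * \<sigma>) * v"
proof -
  let ?s = "simple_refl n k :: 'a mat"
  note c = rooks_carrier[OF \<sigma>]
  obtain a b where ab: "a \<in> unitriangulars n" "b \<in> unitriangulars n" "y = a * \<sigma> * b"
    using y by (rule double_cosetE)
  note ca = unitriangulars_carrier[OF ab(1)] and cb = unitriangulars_carrier[OF ab(2)]
  define x where "x = elem_mat n k (Suc k) (a $$ (k, Suc k))"
  have cx: "x \<in> carrier_mat n n" by (simp add: x_def)
  obtain u where u: "u \<in> unitriangulars n" "u $$ (k, Suc k) = 0" "?s * a = u * ?s * x"
    using unitriangular_refl_factor[OF ab(1) k] unfolding x_def by blast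
  note cu = unitriangulars_carrier[OF u(1)]
  obtain v where v: "v \<in> unitriangulars n" "x * \<sigma> = \<sigma> * v"
    using not_desc_elem_mat[OF \<sigma> k nd] unfolding x_def by metis
  note cv = unitriangulars_carrier[OF v(1)]
  have "?s * y = ?s * a * \<sigma> * b"
    unfolding ab(3) using ca cb c by (simp only: assoc_square[where n = n] mult_square[where n = n] simple_refl_carrier
        elem_mat_carrier h_mat_carrier)
  also have "\<dots> = u * ?s * (x * \<sigma>) * b"
    unfolding u(3) using cu cx c by (simp only: assoc_square[where n = n] mult_square[where n = n] simple_refl_carrier
        elem_mat_carrier h_mat_carrier)
  also have "\<dots> = u * (?s * \<sigma>) * (v * b)"
    unfolding v(2) using cu cv cb c by (simp only: assoc_square[where n = n] mult_square[where n = n] simple_refl_carrier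
        elem_mat_carrier h_mat_carrier)
  finally show ?thesis using that[OF u(1,2) unitriangular_mult[OF v(1) ab(2)]] by blast
qed

text \<open>Sending (a, y) to x_k(a) s_k y is a bijection from the product of the field and
  U\<sigma>U onto U s_k \<sigma> U. Injectivity rests on the disjointness of double cosets;
  surjectivity splits x_k(a) off the left factor.\<close>

lemma card_double_coset_simple_refl:
  fixes \<sigma> :: "'a::{finite, field} mat"
  assumes \<sigma>: "\<sigma> \<in> rooks n" and k: "Suc k < n" and nd: "\<not> desc n k \<sigma>"
    and neq: "simple_refl n k * \<sigma> \<noteq> \<sigma>"
  shows "card (double_coset n (simple_refl n k * \<sigma>)) = CARD('a) * card (double_coset n \<sigma>)"
proof -
  let ?s = "simple_refl n k :: 'a mat" and ?x = "elem_mat n k (Suc k) :: 'a \<Rightarrow> 'a mat"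
  let ?D = "double_coset n \<sigma>" and ?D' = "double_coset n (?s * \<sigma>)"
  note c = rooks_carrier[OF \<sigma>]
  have cs: "?s * \<sigma> \<in> carrier_mat n n" using c by (intro mult_square) auto
  have xU: "?x a \<in> unitriangulars n" for a by (rule elem_mat_unitriangular) simp
  have cD: "y \<in> carrier_mat n n" if "y \<in> ?D" for y using double_coset_carrier[OF c] that by blast
  have csD: "?s * y \<in> carrier_mat n n" if "y \<in> ?D" for y using cD[OF that] by (intro mult_square) auto
  \<comment> \<open>Without a descent at k in \<sigma> or in s_k \<sigma>, either both rows k and k
    + 1 vanish, which \<open>neq\<close> excludes, or each entry would lie strictly to the left of
    the other.\<close>
  have dsc: "desc n k (?s * \<sigma>)"
  proof (rule ccontr)
    assume nd': "\<not> desc n k (?s * \<sigma>)"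
    have z: "\<sigma> $$ (Suc k, j) = 0" if "\<forall>j'<n. \<sigma> $$ (k, j') = 0" "j < n" for j
      using nd that unfolding desc_def by auto
    have z': "\<sigma> $$ (k, j) = 0" if "\<forall>j'<n. \<sigma> $$ (Suc k, j') = 0" "j < n" for j
      using nd' that k unfolding desc_def by (auto simp: simple_refl_mult_left[OF k c])
    obtain i j where i: "i < n" "\<sigma> $$ (k, i) \<noteq> 0" and j: "j < n" "\<sigma> $$ (Suc k, j) \<noteq> 0"
      using neq simple_refl_mult_eq_iff[OF \<sigma> k] z z' by metis
    obtain i' where i': "i' < j" "\<sigma> $$ (k, i') \<noteq> 0" using nd j unfolding desc_def by blast
    obtain j' where j': "j' < i" "\<sigma> $$ (Suc k, j') \<noteq> 0" using nd' i k
      unfolding desc_def by (auto simp: simple_refl_mult_left[OF k c])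
    have "i' = i" using rook_row_eq[OF \<sigma>, of k i' i] i i' j k by simp
    moreover have "j' = j" using rook_row_eq[OF \<sigma>, of "Suc k" j' j] i j' j k by simp
    ultimately show False using i' j' by simp
  qed
  have ss: "?s * (?s * \<sigma>) = \<sigma>" using k c by (simp add: simple_refl_cancel)
  have same: "c1 = c2 \<and> y1 = y2"
    if y1: "y1 \<in> ?D" and y2: "y2 \<in> ?D" and eq: "?x c1 * (?s * y1) = ?x c2 * (?s * y2)" for c1 c2 y1 y2
  proof -
    define d where "d = c1 - c2"
    have "?x (- c2) * (?x c1 * (?s * y1)) = ?x (- c2) * (?x c2 * (?s * y2))" using eq by simp
    then have "?x d * (?s * y1) = ?s * y2"
      using k csD[OF y1] csD[OF y2]
      by (simp add: assoc_square[where n = n] elem_mat_add elem_mat_0 d_def)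
    then have y2_eq: "y2 = ?s * (?x d * (?s * y1))"
      using simple_refl_cancel[OF k cD[OF y2]] by simp
    \<comment> \<open>If d were nonzero, the rank one relation for s_k \<sigma>, which has the
      descent k, would put \<open>y2\<close> into the double coset of h_k(d) s_k \<sigma>.
      Disjointness gives h_k(d) s_k \<sigma> = \<sigma>, so rows k and k + 1 are proportional, hence
      zero, against \<open>neq\<close>.\<close>
    have "d = 0"
    proof (rule ccontr)
      assume d: "d \<noteq> 0"
      obtain u v where uv: "u \<in> unitriangulars n" "u $$ (k, Suc k) = 0" "v \<in> unitriangulars n"
        "?s * y1 = u * (?s * \<sigma>) * v"
        using not_desc_mult_double_coset[OF \<sigma> k nd y1] by blast
      note cu = unitriangulars_carrier[OF uv(1)] and cv = unitriangulars_carrier[OF uv(3)]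
      have xu: "?x d * u \<in> unitriangulars n" by (rule unitriangular_mult[OF xU uv(1)])
      have "(?x d * u) $$ (k, Suc k) = d"
        using k uv(2) unitriangular_diag[OF uv(1)] by (simp add: elem_mat_mult_left[OF cu])
      then obtain w where w: "w \<in> unitriangulars n" "?s * (?x d * u) = w * ?s * ?x d"
        using unitriangular_refl_factor[OF xu k] by metis
      note cw = unitriangulars_carrier[OF w(1)]
      obtain u2 v2 where uv2: "u2 \<in> unitriangulars n" "v2 \<in> unitriangulars n"
        "?s * (?x d * (?s * \<sigma>)) = u2 * (h_mat n k d * (?s * \<sigma>)) * v2"
        using desc_elem_mat[OF simple_refl_mult_rook[OF k \<sigma>] k dsc d] by blast
      note cu2 = unitriangulars_carrier[OF uv2(1)] and cv2 = unitriangulars_carrier[OF uv2(2)]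
      have "y2 = ?s * (?x d * u) * (?s * \<sigma>) * v"
        unfolding y2_eq uv(4) using cu cv cs c by (simp only: assoc_square[where n = n] mult_square[where n = n] simple_refl_carrier
        elem_mat_carrier h_mat_carrier)
      also have "\<dots> = w * (?s * (?x d * (?s * \<sigma>))) * v"
        unfolding w(2) using cw cv cs c by (simp only: assoc_square[where n = n] mult_square[where n = n] simple_refl_carrier
        elem_mat_carrier h_mat_carrier)
      finally have y2': "y2 = w * (u2 * (h_mat n k d * (?s * \<sigma>)) * v2) * v" unfolding uv2(3) .
      have hr: "h_mat n k d * (?s * \<sigma>) \<in> rooks n"
        by (rule torus_mult_rook[OF h_mat_torus[OF d] simple_refl_mult_rook[OF k \<sigma>]])
      have "y2 \<in> double_coset n (h_mat n k d * (?s * \<sigma>))"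
        unfolding y2' using uv2 w(1) uv(3) rooks_carrier[OF hr]
        by (intro double_coset_mult_right double_coset_mult_left double_cosetI)
      then have eq: "h_mat n k d * (?s * \<sigma>) = \<sigma>"
        using rook_double_cosets_disjoint[OF hr \<sigma>] y2 by blast
      have "\<forall>j<n. \<sigma> $$ (k, j) = 0 \<and> \<sigma> $$ (Suc k, j) = 0"
      proof (intro allI impI)
        fix j assume j: "j < n"
        have "\<sigma> $$ (k, j) = - inverse d * \<sigma> $$ (Suc k, j)"
          using arg_cong[OF eq, of "\<lambda>A. A $$ (k, j)"] k j cs
          unfolding h_mat_def mat_diag_mult_left[OF cs] by (simp add: simple_refl_mult_left[OF k c])
        then show "\<sigma> $$ (k, j) = 0 \<and> \<sigma> $$ (Suc k, j) = 0"
          using rook_col_eq[OF \<sigma>, of k j "Suc k"] k j d by auto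
      qed
      then show False using neq simple_refl_mult_eq_iff[OF \<sigma> k] by blast
    qed
    then show ?thesis using y2_eq k cD[OF y1] csD[OF y1]
      by (simp add: elem_mat_0 simple_refl_cancel d_def)
  qed
  define F where "F = (\<lambda>(a, y). ?x a * (?s * y))"
  have "inj_on F (UNIV \<times> ?D)"
    unfolding F_def by (rule inj_onI) (use same in auto)
  moreover have "F ` (UNIV \<times> ?D) = ?D'"
  proof
    show "F ` (UNIV \<times> ?D) \<subseteq> ?D'"
    proof
      fix z assume "z \<in> F ` (UNIV \<times> ?D)"
      then obtain a y where y: "y \<in> ?D" "z = ?x a * (?s * y)" unfolding F_def by auto
      obtain u v where uv: "u \<in> unitriangulars n" "v \<in> unitriangulars n" "?s * y = u * (?s * \<sigma>) * v"
        using not_desc_mult_double_coset[OF \<sigma> k nd y(1)] by blast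
      show "z \<in> ?D'" unfolding y(2) uv(3)
        using uv(1,2) by (intro double_coset_mult_left[OF xU _ cs] double_cosetI)
    qed
    show "?D' \<subseteq> F ` (UNIV \<times> ?D)"
    proof
      fix z assume "z \<in> ?D'"
      then obtain u v where uv: "u \<in> unitriangulars n" "v \<in> unitriangulars n" "z = u * (?s * \<sigma>) * v"
        by (rule double_cosetE)
      note cu = unitriangulars_carrier[OF uv(1)] and cv = unitriangulars_carrier[OF uv(2)]
      define a where "a = u $$ (k, Suc k)"
      \<comment> \<open>Removing x_k(a) leaves entry 0 at (k, k + 1), so s_k conjugates
        \<open>u1\<close> into an element \<open>w\<close> of U.\<close>
      define u1 where "u1 = ?x (- a) * u"
      have u1: "u1 \<in> unitriangulars n" unfolding u1_def by (rule unitriangular_mult[OF xU uv(1)])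
      note cu1 = unitriangulars_carrier[OF u1]
      have "u1 $$ (k, Suc k) = 0" unfolding u1_def using k unitriangular_diag[OF uv(1)]
        by (simp add: elem_mat_mult_left[OF cu] a_def)
      then obtain w where w: "w \<in> unitriangulars n" "?s * u1 = w * ?s * ?x 0"
        using unitriangular_refl_factor[OF u1 k] by metis
      note cw = unitriangulars_carrier[OF w(1)]
      have sw: "?s * u1 = w * ?s" using w(2) cw by (simp add: elem_mat_0 mult_square[where n = n])
      have u_eq: "u = ?x a * u1"
        unfolding u1_def using k cu by (simp add: assoc_square[where n = n] elem_mat_add elem_mat_0)
      have u1_eq: "u1 = ?s * (w * ?s)" using sw simple_refl_cancel[OF k cu1] by simp
      have "?s * (w * \<sigma> * v) = ?s * w * (?s * (?s * \<sigma>)) * v"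
        unfolding ss using cw cv c by (simp only: assoc_square[where n = n] mult_square[where n = n] simple_refl_carrier
        elem_mat_carrier h_mat_carrier)
      also have "\<dots> = u1 * (?s * \<sigma>) * v"
        unfolding u1_eq using cw cv c by (simp only: assoc_square[where n = n] mult_square[where n = n] simple_refl_carrier
        elem_mat_carrier h_mat_carrier)
      finally have "?x a * (?s * (w * \<sigma> * v)) = ?x a * (u1 * (?s * \<sigma>) * v)" by simp
      also have "\<dots> = z" unfolding uv(3) u_eq
        using cu1 cv cs c by (simp only: assoc_square[where n = n] mult_square[where n = n] simple_refl_carrier
        elem_mat_carrier h_mat_carrier)
      finally have "z = F (a, w * \<sigma> * v)" by (simp add: F_def)
      moreover have "w * \<sigma> * v \<in> ?D" by (rule double_cosetI[OF w(1) uv(2)])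
      ultimately show "z \<in> F ` (UNIV \<times> ?D)" by blast
    qed
  qed
  ultimately have "card ?D' = card ((UNIV :: 'a set) \<times> ?D)" using card_image by metis
  then show ?thesis by (simp add: card_cartesian_product)
qed

lemma card_double_coset_desc:
  fixes \<sigma> :: "'a::{finite, field} mat"
  assumes \<sigma>: "\<sigma> \<in> rooks n" and k: "Suc k < n" and d: "desc n k \<sigma>"
  shows "card (double_coset n \<sigma>) = CARD('a) * card (double_coset n (simple_refl n k * \<sigma>))"
proof -
  have ss: "simple_refl n k * (simple_refl n k * \<sigma>) = \<sigma>"
    using k rooks_carrier[OF \<sigma>] by (simp add: simple_refl_cancel)
  have neq: "simple_refl n k * (simple_refl n k * \<sigma>) \<noteq> simple_refl n k * \<sigma>"
    unfolding ss using desc_simple_refl_neq[OF assms] by auto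
  show ?thesis
    using card_double_coset_simple_refl[OF simple_refl_mult_rook[OF k \<sigma>] k not_desc_simple_refl[OF assms] neq]
    unfolding ss .
qed

lemma card_double_coset_flip:
  fixes x :: "'a::{finite, field} mat"
  assumes "x \<in> carrier_mat n n"
  shows "card (double_coset n (flip n x)) = card (double_coset n x)"
  unfolding flip_double_coset[OF assms]
proof (rule card_image, rule inj_onI)
  fix y z assume "y \<in> double_coset n x" "z \<in> double_coset n x" "flip n y = flip n z"
  then show "y = z" using flip_flip double_coset_carrier[OF assms] by (metis subsetD)
qed

lemma card_double_coset_pos:
  fixes x :: "'a::{finite, field} mat"
  assumes "x \<in> carrier_mat n n"
  shows "card (double_coset n x) > 0"
  using finite_double_coset[OF assms] double_coset_self[OF assms] by (auto simp: card_gt_0_iff)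

section \<open>Moving torus elements and the shift past U\<close>

lemma torus_unitriangular:
  assumes "t \<in> torus n" "u \<in> unitriangulars n"
  obtains u' where "u' \<in> unitriangulars n" "t * u = u' * t"
proof -
  obtain d where d: "t = mat_diag n d" "\<forall>i<n. d i \<noteq> 0" using assms(1) torus_iff by blast
  note cu = unitriangulars_carrier[OF assms(2)]
  define u' where "u' = mat n n (\<lambda>(i, j). d i * u $$ (i, j) / d j)"
  have cu': "u' \<in> carrier_mat n n" by (simp add: u'_def)
  have "u' \<in> unitriangulars n" using assms(2) d(2) by (simp add: unitriangulars_iff u'_def)
  moreover have "t * u = u' * t"
    unfolding d(1) mat_diag_mult_left[OF cu] mat_diag_mult_right[OF cu']
    by (rule eq_matI) (use d(2) in \<open>auto simp: u'_def\<close>)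
  ultimately show ?thesis using that by blast
qed

lemma unitriangular_torus:
  assumes "t \<in> torus n" "u \<in> unitriangulars n"
  obtains u' where "u' \<in> unitriangulars n" "u * t = t * u'"
proof -
  obtain d where d: "t = mat_diag n d" "\<forall>i<n. d i \<noteq> 0" using assms(1) torus_iff by blast
  note cu = unitriangulars_carrier[OF assms(2)]
  define u' where "u' = mat n n (\<lambda>(i, j). u $$ (i, j) * d j / d i)"
  have cu': "u' \<in> carrier_mat n n" by (simp add: u'_def)
  have "u' \<in> unitriangulars n" using assms(2) d(2) by (simp add: unitriangulars_iff u'_def)
  moreover have "u * t = t * u'"
    unfolding d(1) mat_diag_mult_left[OF cu'] mat_diag_mult_right[OF cu]
    by (rule eq_matI) (use d(2) in \<open>auto simp: u'_def\<close>)
  ultimately show ?thesis using that by blast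
qed

text \<open>\<open>u'\<close> is u without its first row and column, bordered by the last row and
  column of the identity. The border is harmless because right multiplication by \<nu> discards the
  last column of \<open>u'\<close>, and the first column of \<nu> u vanishes since u is zero below
  the diagonal.\<close>

lemma nu_unitriangular:
  assumes "u \<in> unitriangulars n"
  obtains u' where "u' \<in> unitriangulars n" "nu n * u = u' * nu n"
proof -
  note cu = unitriangulars_carrier[OF assms]
  define u' where "u' = mat n n (\<lambda>(i, j). if Suc j < n then if Suc i < n then u $$ (Suc i, Suc j) else 0
    else if Suc i = n then 1 else 0)"
  have cu': "u' \<in> carrier_mat n n" by (simp add: u'_def)
  have ind: "u' $$ (i, j) = (if Suc j < n then if Suc i < n then u $$ (Suc i, Suc j) else 0
    else if Suc i = n then 1 else 0)" if "i < n" "j < n" for i j using that by (simp add: u'_def)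
  have "u' \<in> unitriangulars n" using assms by (auto simp: unitriangulars_iff u'_def)
  moreover have "nu n * u = u' * nu n"
  proof (rule eq_matI)
    fix i j assume "i < dim_row (u' * nu n)" "j < dim_col (u' * nu n)"
    then have "i < n" "j < n" by (auto simp: u'_def)
    then show "(nu n * u) $$ (i, j) = (u' * nu n) $$ (i, j)"
      using unitriangular_below[OF assms, of "Suc i" 0]
      by (auto simp: nu_mult_left[OF cu] nu_mult_right[OF cu'] ind)
  qed (use cu in \<open>auto simp: u'_def\<close>)
  ultimately show ?thesis using that by blast
qed

text \<open>The torus normalises U, so U t x U = t U x U, and multiplication by t is
  injective.\<close>

lemma card_double_coset_torus:
  fixes x :: "'a::{finite, field} mat"
  assumes t: "t \<in> torus n" and x: "x \<in> carrier_mat n n"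
  shows "card (double_coset n (t * x)) = card (double_coset n x)"
proof -
  note ct = torus_carrier[OF t]
  have "double_coset n (t * x) = (*) t ` double_coset n x"
  proof safe
    fix y assume "y \<in> double_coset n (t * x)"
    then obtain u v where uv: "u \<in> unitriangulars n" "v \<in> unitriangulars n" "y = u * (t * x) * v"
      by (rule double_cosetE)
    obtain u' where u': "u' \<in> unitriangulars n" "u * t = t * u'" using unitriangular_torus[OF t uv(1)] by blast
    note c = ct x unitriangulars_carrier[OF uv(1)] unitriangulars_carrier[OF uv(2)] unitriangulars_carrier[OF u'(1)]
    have "y = u * t * x * v" unfolding uv(3) using c by (simp only: assoc_square[where n = n] mult_square[where n = n] simple_refl_carrier
        elem_mat_carrier h_mat_carrier)
    also have "\<dots> = t * (u' * x * v)" unfolding u'(2) using c by (simp only: assoc_square[where n = n] mult_square[where n = n] simple_refl_carrier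
        elem_mat_carrier h_mat_carrier)
    finally show "y \<in> (*) t ` double_coset n x" using double_cosetI[OF u'(1) uv(2)] by blast
  next
    fix y assume "y \<in> double_coset n x"
    then obtain u v where uv: "u \<in> unitriangulars n" "v \<in> unitriangulars n" "y = u * x * v"
      by (rule double_cosetE)
    obtain u' where u': "u' \<in> unitriangulars n" "t * u = u' * t" using torus_unitriangular[OF t uv(1)] by blast
    note c = ct x unitriangulars_carrier[OF uv(1)] unitriangulars_carrier[OF uv(2)] unitriangulars_carrier[OF u'(1)]
    have "t * y = t * u * x * v" unfolding uv(3) using c by (simp only: assoc_square[where n = n] mult_square[where n = n] simple_refl_carrier
        elem_mat_carrier h_mat_carrier)
    also have "\<dots> = u' * (t * x) * v" unfolding u'(2) using c by (simp only: assoc_square[where n = n] mult_square[where n = n] simple_refl_carrier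
        elem_mat_carrier h_mat_carrier)
    finally show "t * y \<in> double_coset n (t * x)" using double_cosetI[OF u'(1) uv(2)] by simp
  qed
  moreover have "inj_on ((*) t) (double_coset n x)"
  proof (rule inj_onI)
    fix y z assume yz: "y \<in> double_coset n x" "z \<in> double_coset n x" "t * y = t * z"
    obtain t' where t': "t' \<in> torus n" "t' * t = 1\<^sub>m n" using torus_inverse[OF t] by blast
    have "t' * (t * y) = t' * (t * z)" using yz by simp
    moreover have "y \<in> carrier_mat n n" "z \<in> carrier_mat n n"
      using yz(1,2) double_coset_carrier[OF x] by auto
    ultimately show "y = z" using t'(2) ct torus_carrier[OF t'(1)]
      by (simp add: assoc_square[where n = n])
  qed
  ultimately show ?thesis by (simp add: card_image)
qed

subsection \<open>Rank and rooks without descents\<close>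

text \<open>The nonzero columns are independent, since each has its entry in a row where the others
  vanish, and a larger set of columns would contain the zero vector.\<close>

lemma rank_rook:
  fixes \<sigma> :: "'a::field mat"
  assumes \<sigma>: "\<sigma> \<in> rooks n"
  shows "vec_space.rank n \<sigma> = card {j. j < n \<and> (\<exists>i<n. \<sigma> $$ (i, j) \<noteq> 0)}"
proof -
  interpret vec_space "TYPE('a)" n .
  note c = rooks_carrier[OF \<sigma>]
  let ?J = "{j. j < n \<and> (\<exists>i<n. \<sigma> $$ (i, j) \<noteq> 0)}"
  define S where "S = col \<sigma> ` ?J"
  have cols: "set (cols \<sigma>) = col \<sigma> ` {..<n}" using c by (auto simp: cols_def)
  have index: "col \<sigma> j $ i = \<sigma> $$ (i, j)" if "i < n" "j < n" for i j using that c by simp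
  have S: "S \<subseteq> carrier_vec n" using c by (auto simp: S_def)
  have "inj_on (col \<sigma>) ?J"
  proof (rule inj_onI)
    fix j j' assume j: "j \<in> ?J" and j': "j' \<in> ?J" and eq: "col \<sigma> j = col \<sigma> j'"
    from j obtain i where i: "i < n" "\<sigma> $$ (i, j) \<noteq> 0" by blast
    then have "\<sigma> $$ (i, j') \<noteq> 0" using eq index[of i j] index[of i j'] j j' by simp
    then show "j = j'" using rook_row_eq[OF \<sigma>, of i j j'] i j j' by simp
  qed
  then have card: "card S = card ?J" unfolding S_def by (rule card_image)
  \<comment> \<open>The rank is the size of any maximal independent subset of the set of
    columns.\<close>
  have "maximal S (\<lambda>T. T \<subseteq> set (cols \<sigma>) \<and> lin_indpt T)"
    unfolding maximal_def
  proof (intro conjI allI impI)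
    show "S \<subseteq> set (cols \<sigma>)" unfolding S_def cols by blast
    have coeff: "a v = 0" if z: "lincomb a S = 0\<^sub>v n" and v: "v \<in> S" for a v
    proof -
      obtain j i where j: "j < n" "v = col \<sigma> j" and i: "i < n" "\<sigma> $$ (i, j) \<noteq> 0"
        using v unfolding S_def by blast
      have "a x * x $ i = 0" if x: "x \<in> S" "x \<noteq> v" for x
      proof -
        obtain j' where j': "j' < n" "x = col \<sigma> j'" using x(1) unfolding S_def by blast
        then have "\<sigma> $$ (i, j') = 0" using rook_row_eq[OF \<sigma>, of i j j'] i j x(2) by auto
        then show ?thesis using index i j' by simp
      qed
      then have "(\<Sum>x\<in>S - {v}. a x * x $ i) = 0" by (intro sum.neutral) auto
      moreover have "finite S" by (simp add: S_def)
      ultimately have "(\<Sum>x\<in>S. a x * x $ i) = a v * v $ i"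
        using sum.remove[OF _ v, of "\<lambda>x. a x * x $ i"] by simp
      moreover have "(\<Sum>x\<in>S. a x * x $ i) = 0"
        using lincomb_index[OF i(1) S, of a] z i(1) by simp
      ultimately show "a v = 0" using i j index[of i j] by simp
    qed
    have "finite S" by (simp add: S_def)
    then show "lin_indpt S" using S coeff by (intro finite_lin_indpt2) auto
  next
    fix T assume T: "S \<subseteq> T \<and> T \<subseteq> set (cols \<sigma>) \<and> lin_indpt T"
    have "T \<subseteq> carrier V" using T c unfolding cols by auto
    moreover have "(UNIV :: 'a set) \<noteq> {0}" using zero_neq_one[where 'a = 'a] by (metis UNIV_I singletonD)
    ultimately have "0\<^sub>v n \<notin> T" using zero_nin_lin_indpt[of T] T by auto
    have "T \<subseteq> S"
    proof
      fix x assume x: "x \<in> T"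
      then obtain j where j: "j < n" "x = col \<sigma> j" using T cols by auto
      have "x \<noteq> 0\<^sub>v n" using x \<open>0\<^sub>v n \<notin> T\<close> by auto
      then obtain i where "i < n" "\<sigma> $$ (i, j) \<noteq> 0"
        using j c by (metis carrier_matD(1) dim_col eq_vecI index index_zero_vec)
      then show "x \<in> S" using j unfolding S_def by blast
    qed
    then show "T = S" using T by blast
  qed
  from rank_card_indpt[OF c this] card show ?thesis by simp
qed

text \<open>Matching each nonzero row with the column of its entry turns the count by columns into a
  count by rows; \<open>rank_flip\<close> compares the two, as reflection exchanges rows and
  columns.\<close>

lemma rank_rook_rows:
  fixes \<sigma> :: "'a::field mat"
  assumes \<sigma>: "\<sigma> \<in> rooks n"
  shows "vec_space.rank n \<sigma> = card {i. i < n \<and> (\<exists>j<n. \<sigma> $$ (i, j) \<noteq> 0)}"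
proof -
  let ?I = "{i. i < n \<and> (\<exists>j<n. \<sigma> $$ (i, j) \<noteq> 0)}" and ?J = "{j. j < n \<and> (\<exists>i<n. \<sigma> $$ (i, j) \<noteq> 0)}"
  have "\<forall>i\<in>?I. \<exists>j. j < n \<and> \<sigma> $$ (i, j) \<noteq> 0" by blast
  then obtain f where f: "\<forall>i\<in>?I. f i < n \<and> \<sigma> $$ (i, f i) \<noteq> 0" by (rule bchoice[THEN exE])
  have "inj_on f ?I"
  proof (rule inj_onI)
    fix i i' assume "i \<in> ?I" "i' \<in> ?I" "f i = f i'"
    moreover from this have "f i < n" "\<sigma> $$ (i, f i) \<noteq> 0" "\<sigma> $$ (i', f i) \<noteq> 0"
      using f[rule_format, of i] f[rule_format, of i'] by auto
    ultimately show "i = i'" using rook_col_eq[OF \<sigma>, of i "f i" i'] by auto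
  qed
  moreover have "f ` ?I = ?J"
  proof
    show "f ` ?I \<subseteq> ?J" using f by blast
    show "?J \<subseteq> f ` ?I"
    proof
      fix j assume "j \<in> ?J"
      then obtain i where i: "i < n" "\<sigma> $$ (i, j) \<noteq> 0" "j < n" by blast
      then have iI: "i \<in> ?I" by blast
      have "f i < n" "\<sigma> $$ (i, f i) \<noteq> 0" using f[rule_format, OF iI] by auto
      then have "f i = j" using rook_row_eq[OF \<sigma> _ i(2) i(1) _ i(3)] by simp
      then show "j \<in> f ` ?I" by (rule image_eqI[OF sym iI])
    qed
  qed
  ultimately have "card ?I = card ?J" using card_image[of f ?I] by (simp only:)
  then show ?thesis using rank_rook[OF \<sigma>] by (simp only:)
qed

lemma rank_simple_refl_mult:
  fixes \<sigma> :: "'a::field mat"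
  assumes \<sigma>: "\<sigma> \<in> rooks n" and k: "Suc k < n"
  shows "vec_space.rank n (simple_refl n k * \<sigma>) = vec_space.rank n \<sigma>"
proof -
  have "(\<exists>i<n. (simple_refl n k * \<sigma>) $$ (i, j) \<noteq> 0) \<longleftrightarrow> (\<exists>i<n. \<sigma> $$ (i, j) \<noteq> 0)" if j: "j < n" for j
  proof -
    have "(\<exists>i<n. \<sigma> $$ (swap k i, j) \<noteq> 0) \<longleftrightarrow> (\<exists>i<n. \<sigma> $$ (i, j) \<noteq> 0)"
      using swap_less[OF k] by (metis transpose_involutory)
    then show ?thesis using simple_refl_mult_left[OF k rooks_carrier[OF \<sigma>] _ j] by auto
  qed
  then show ?thesis unfolding rank_rook[OF simple_refl_mult_rook[OF k \<sigma>]] rank_rook[OF \<sigma>]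
    by (metis (no_types, lifting) Collect_cong)
qed

lemma rank_torus_mult:
  fixes \<sigma> :: "'a::field mat"
  assumes \<sigma>: "\<sigma> \<in> rooks n" and t: "t \<in> torus n"
  shows "vec_space.rank n (t * \<sigma>) = vec_space.rank n \<sigma>"
proof -
  obtain d where d: "t = mat_diag n d" "\<forall>i<n. d i \<noteq> 0" using t torus_iff by blast
  have "{j. j < n \<and> (\<exists>i<n. (t * \<sigma>) $$ (i, j) \<noteq> 0)} = {j. j < n \<and> (\<exists>i<n. \<sigma> $$ (i, j) \<noteq> 0)}"
    unfolding d(1) mat_diag_mult_left[OF rooks_carrier[OF \<sigma>]] using d(2) by auto
  then show ?thesis unfolding rank_rook[OF torus_mult_rook[OF t \<sigma>]] rank_rook[OF \<sigma>] by simp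
qed

lemma rank_flip:
  fixes \<sigma> :: "'a::field mat"
  assumes \<sigma>: "\<sigma> \<in> rooks n"
  shows "vec_space.rank n (flip n \<sigma>) = vec_space.rank n \<sigma>"
proof -
  let ?f = "\<lambda>i. n - 1 - i"
  have "bij_betw ?f {j. j < n \<and> (\<exists>i<n. flip n \<sigma> $$ (i, j) \<noteq> 0)} {i. i < n \<and> (\<exists>j<n. \<sigma> $$ (i, j) \<noteq> 0)}"
  proof (rule bij_betw_byWitness[where f' = ?f])
    show "?f ` {j. j < n \<and> (\<exists>i<n. flip n \<sigma> $$ (i, j) \<noteq> 0)} \<subseteq> {i. i < n \<and> (\<exists>j<n. \<sigma> $$ (i, j) \<noteq> 0)}"
    proof safe
      fix i j assume "j < n" "i < n" "flip n \<sigma> $$ (i, j) \<noteq> 0"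
      then show "\<exists>ja<n. \<sigma> $$ (n - 1 - j, ja) \<noteq> 0" "n - 1 - j < n"
        by (auto simp: flip_index intro!: exI[of _ "n - 1 - i"])
    qed
    show "?f ` {i. i < n \<and> (\<exists>j<n. \<sigma> $$ (i, j) \<noteq> 0)} \<subseteq> {j. j < n \<and> (\<exists>i<n. flip n \<sigma> $$ (i, j) \<noteq> 0)}"
    proof safe
      fix i j assume "i < n" "j < n" "\<sigma> $$ (i, j) \<noteq> 0"
      then show "\<exists>ia<n. flip n \<sigma> $$ (ia, n - 1 - i) \<noteq> 0" "n - 1 - i < n"
        by (auto simp: flip_index intro!: exI[of _ "n - 1 - j"])
    qed
  qed auto
  then show ?thesis
    unfolding rank_rook[OF flip_rooks[OF \<sigma>]] rank_rook_rows[OF \<sigma>] by (rule bij_betw_same_card)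
qed

lemma rank_nu_pow: "vec_space.rank n (nu n ^\<^sub>m d :: 'a::field mat) = n - d"
proof -
  have "{j. j < n \<and> (\<exists>i<n. (nu n ^\<^sub>m d :: 'a mat) $$ (i, j) \<noteq> 0)} = {d..<n}"
  proof safe
    fix i j assume "j < n" "i < n" "(nu n ^\<^sub>m d :: 'a mat) $$ (i, j) \<noteq> 0"
    then show "j \<in> {d..<n}" by (simp add: nu_pow_index split: if_splits)
  next
    fix j assume "j \<in> {d..<n}"
    then show "j < n" "\<exists>i<n. (nu n ^\<^sub>m d :: 'a mat) $$ (i, j) \<noteq> 0"
      by (auto simp: nu_pow_index intro!: exI[of _ "j - d"])
  qed
  then show ?thesis by (simp add: rank_rook[OF nu_pow_rook])
qed

text \<open>The double coset consists of the matrices that have 1 on superdiagonal d and 0 to the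
  left of it; the entries in \<open>S\<close>, to the right of it, are free. With r = n - d there
  are (r - 1) + ... + 1 + 0 of them, the origin of the exponent r(r - 1)/2.\<close>

lemma card_double_coset_nu_pow:
  "card (double_coset n (nu n ^\<^sub>m d :: 'a::{finite, field} mat)) = CARD('a) ^ ((n - d) * (n - d - 1) div 2)"
proof -
  define S where "S = {(i, j). i + d < j \<and> j < n}"
  define b where "b = (\<lambda>i j. if j = i + d then 1 else 0 :: 'a)"
  have S: "S \<subseteq> {..<n} \<times> {..<n}" by (auto simp: S_def)
  let ?N = "nu n ^\<^sub>m d :: 'a mat"
  have left: "(u * ?N) $$ (i, j) = (if d \<le> j then u $$ (i, j - d) else 0)"
    if "u \<in> carrier_mat n n" "i < n" "j < n" for u i j
  proof -
    have "(u * ?N) $$ (i, j) = (\<Sum>k<n. if k = j - d then if d \<le> j then u $$ (i, j - d) else 0 else 0)"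
      unfolding index_mult_square[OF that(1) nu_pow_carrier that(2,3)]
      by (rule sum.cong) (use that in \<open>auto simp: nu_pow_index\<close>)
    then show ?thesis using that by auto
  qed
  have "double_coset n ?N = {A \<in> carrier_mat n n. \<forall>i<n. \<forall>j<n. (i, j) \<notin> S \<longrightarrow> A $$ (i, j) = b i j}"
  proof safe
    fix A assume A: "A \<in> double_coset n ?N"
    then show "A \<in> carrier_mat n n" using double_coset_carrier[OF nu_pow_carrier] by blast
    fix i j assume ij: "i < n" "j < n" "(i, j) \<notin> S"
    obtain u v where uv: "u \<in> unitriangulars n" "v \<in> unitriangulars n" "A = u * ?N * v"
      using A by (rule double_cosetE)
    note cu = unitriangulars_carrier[OF uv(1)]
    have cuN: "u * ?N \<in> carrier_mat n n" by (rule mult_square[OF cu nu_pow_carrier])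
    have "A $$ (i, j) = (\<Sum>k<n. (if d \<le> k then u $$ (i, k - d) else 0) * v $$ (k, j))"
      unfolding uv(3) index_mult_square[OF cuN unitriangulars_carrier[OF uv(2)] ij(1,2)]
      by (rule sum.cong) (use ij in \<open>auto simp: left[OF cu]\<close>)
    \<comment> \<open>A nonzero term needs i + d \<le> k for u and k \<le> j for v. Outside
      \<open>S\<close> one has j \<le> i + d, so only k = j = i + d survives.\<close>
    also have "\<dots> = (\<Sum>k<n. if k = j then b i j else 0)"
    proof (rule sum.cong[OF refl])
      fix k assume "k \<in> {..<n}"
      then show "(if d \<le> k then u $$ (i, k - d) else 0) * v $$ (k, j) = (if k = j then b i j else 0)"
        using ij unitriangular_below[OF uv(1), of i "k - d"] unitriangular_below[OF uv(2), of k j]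
          unitriangular_diag[OF uv(1), of i] unitriangular_diag[OF uv(2), of j]
        by (cases k j rule: linorder_cases; cases "k - d" i rule: linorder_cases) (auto simp: S_def b_def)
    qed
    also have "\<dots> = b i j" using ij by simp
    finally show "A $$ (i, j) = b i j" .
  next
    fix A :: "'a mat" assume A: "A \<in> carrier_mat n n" "\<forall>i<n. \<forall>j<n. (i, j) \<notin> S \<longrightarrow> A $$ (i, j) = b i j"
    \<comment> \<open>Right multiplication by \<nu>^d moves column k to column k + d. The last d
      columns of \<open>u\<close> leave the square, so they may be taken from the identity; left
      factors alone thus reach every such matrix.\<close>
    define u where "u = mat n n (\<lambda>(i, k). if k + d < n then A $$ (i, k + d) else if i = k then 1 else 0)"
    have ind: "u $$ (i, k) = (if k + d < n then A $$ (i, k + d) else if i = k then 1 else 0)"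
      if "i < n" "k < n" for i k using that by (simp add: u_def)
    have u: "u \<in> unitriangulars n"
      unfolding unitriangulars_iff using A(2) by (auto simp: u_def S_def b_def)
    have cuN: "u * ?N \<in> carrier_mat n n" by (rule mult_square[OF unitriangulars_carrier[OF u] nu_pow_carrier])
    have "u * ?N * 1\<^sub>m n = A" unfolding right_mult_one_mat[OF cuN]
    proof (rule eq_matI)
      fix i j assume "i < dim_row A" "j < dim_col A"
      then have ij: "i < n" "j < n" using A by auto
      then show "(u * ?N) $$ (i, j) = A $$ (i, j)"
        using A(2) by (auto simp: left[OF unitriangulars_carrier[OF u]] ind S_def b_def)
    qed (use A cuN in auto)
    then show "A \<in> double_coset n ?N" using double_cosetI[OF u one_unitriangular] by metis
  qed
  then have "card (double_coset n ?N) = CARD('a) ^ card S" using card_mat_prescribed[OF S] by simp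
  moreover have "card S = (n - d) * (n - d - 1) div 2"
  proof -
    have "S = Sigma {..<n - d} (\<lambda>i. {i + d<..<n})" by (auto simp: S_def)
    then have "card S = (\<Sum>i<n - d. n - d - Suc i)" by (simp add: card_SigmaI algebra_simps)
    also have "\<dots> = (\<Sum>i<n - d. i)" by (rule sum.nat_diff_reindex)
    also have "\<dots> = (n - d) * (n - d - 1) div 2" by (simp add: Sum_Ico_nat lessThan_atLeast0)
    finally show ?thesis .
  qed
  ultimately show ?thesis by simp
qed

text \<open>Row k of the reflection is column n - 1 - k of \<sigma> read from the bottom up, so
  further left in a row of the reflection means lower in a column of \<sigma>, and row k + 1
  corresponds to the preceding column.\<close>

lemma not_desc_flip_iff:
  fixes \<sigma> :: "'a::field mat"
  shows "(\<forall>k. Suc k < n \<longrightarrow> \<not> desc n k (flip n \<sigma>)) \<longleftrightarrow>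
    (\<forall>i j. i < n \<longrightarrow> Suc j < n \<longrightarrow> \<sigma> $$ (i, j) \<noteq> 0 \<longrightarrow> (\<exists>i'. i < i' \<and> i' < n \<and> \<sigma> $$ (i', Suc j) \<noteq> 0))"
proof safe
  fix i j assume *: "\<forall>k. Suc k < n \<longrightarrow> \<not> desc n k (flip n \<sigma>)"
    and ij: "i < n" "Suc j < n" "\<sigma> $$ (i, j) \<noteq> 0"
  define k where "k = n - 2 - j"
  have k: "Suc k < n" "n - Suc k = Suc j" "n - Suc (Suc k) = j" using ij by (auto simp: k_def)
  have "flip n \<sigma> $$ (Suc k, n - Suc i) \<noteq> 0" using ij k by (simp add: flip_index)
  then obtain j' where "j' < n - Suc i" "flip n \<sigma> $$ (k, j') \<noteq> 0"
    using *[rule_format, OF k(1)] diff_Suc_less[of n i] ij(1) unfolding desc_def by (metis gr_implies_not0 gr0I)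
  then show "\<exists>i'. i < i' \<and> i' < n \<and> \<sigma> $$ (i', Suc j) \<noteq> 0"
    using k by (intro exI[of _ "n - Suc j'"]) (auto simp: flip_index)
next
  fix k assume *: "\<forall>i j. i < n \<longrightarrow> Suc j < n \<longrightarrow> \<sigma> $$ (i, j) \<noteq> 0 \<longrightarrow> (\<exists>i'. i < i' \<and> i' < n \<and> \<sigma> $$ (i', Suc j) \<noteq> 0)"
    and k: "Suc k < n" and "desc n k (flip n \<sigma>)"
  then obtain j where j: "j < n" "flip n \<sigma> $$ (Suc k, j) \<noteq> 0" "\<forall>j'<j. flip n \<sigma> $$ (k, j') = 0"
    unfolding desc_def by blast
  have k': "n - Suc k = Suc (n - Suc (Suc k))" using k by simp
  have "\<sigma> $$ (n - Suc j, n - Suc (Suc k)) \<noteq> 0" using j k by (simp add: flip_index)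
  then obtain i' where i': "n - Suc j < i'" "i' < n" "\<sigma> $$ (i', n - Suc k) \<noteq> 0"
    using *[rule_format, of "n - Suc j" "n - Suc (Suc k)"] j k k'[symmetric] by auto
  then have "flip n \<sigma> $$ (k, n - Suc i') \<noteq> 0" using k by (simp add: flip_index)
  moreover have "n - Suc i' < j" using i' j(1) by simp
  ultimately show False using j(3) by blast
qed

lemma not_desc_iff:
  fixes \<sigma> :: "'a::field mat"
  shows "\<not> desc n k \<sigma> \<longleftrightarrow> (\<forall>j<n. \<sigma> $$ (Suc k, j) \<noteq> 0 \<longrightarrow> (\<exists>j'<j. \<sigma> $$ (k, j') \<noteq> 0))"
  unfolding desc_def by blast

text \<open>Without descents, the support is closed under diagonal shifts inside the square, hence it
  is a full superdiagonal.\<close>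

lemma no_desc_rook:
  fixes \<sigma> :: "'a::field mat"
  assumes \<sigma>: "\<sigma> \<in> rooks n"
    and left: "\<And>k. Suc k < n \<Longrightarrow> \<not> desc n k \<sigma>"
    and right: "\<And>k. Suc k < n \<Longrightarrow> \<not> desc n k (flip n \<sigma>)"
  obtains t where "t \<in> torus n" "\<sigma> = t * nu n ^\<^sub>m (n - vec_space.rank n \<sigma>)"
proof -
  note c = rooks_carrier[OF \<sigma>]
  have L: "\<exists>j'<j. \<sigma> $$ (i, j') \<noteq> 0" if "\<sigma> $$ (Suc i, j) \<noteq> 0" "Suc i < n" "j < n" for i j
    using left[of i] that unfolding not_desc_iff by blast
  have R: "\<exists>i'. i < i' \<and> i' < n \<and> \<sigma> $$ (i', Suc j) \<noteq> 0" if "\<sigma> $$ (i, j) \<noteq> 0" "i < n" "Suc j < n" for i j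
    using right that not_desc_flip_iff[of n \<sigma>] by blast
  \<comment> \<open>Each step up moves the entry at least one column to the left.\<close>
  have D: "\<exists>j'. j' + m \<le> j \<and> \<sigma> $$ (i, j') \<noteq> 0" if "\<sigma> $$ (i + m, j) \<noteq> 0" "i + m < n" "j < n" for i m j
    using that
  proof (induction m arbitrary: j)
    case (Suc m)
    then obtain j' where j': "j' < j" "\<sigma> $$ (i + m, j') \<noteq> 0" using L[of "i + m" j] by auto
    then obtain j'' where "j'' + m \<le> j'" "\<sigma> $$ (i, j'') \<noteq> 0" using Suc.IH[of j'] Suc.prems by auto
    then show ?case using j' by (intro exI[of _ j'']) auto
  qed auto
  \<comment> \<open>\<open>R\<close> gives an entry of column j + 1 in some lower row i'. Going back
    up to row i costs at least i' - i columns by \<open>D\<close> and must end at the only entry of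
    row i, in column j; hence i' = i + 1.\<close>
  have E: "Suc i < n \<and> \<sigma> $$ (Suc i, Suc j) \<noteq> 0" if ij: "\<sigma> $$ (i, j) \<noteq> 0" "i < n" "Suc j < n" for i j
  proof -
    obtain i' where i': "i < i'" "i' < n" "\<sigma> $$ (i', Suc j) \<noteq> 0" using R[OF ij] by blast
    then obtain j' where j': "j' + (i' - i) \<le> Suc j" "\<sigma> $$ (i, j') \<noteq> 0"
      using D[of i "i' - i" "Suc j"] ij by auto
    then have "j' = j" using rook_row_eq[OF \<sigma>, of i j' j] ij i' by auto
    then have "i' = Suc i" using i' j' by simp
    then show ?thesis using i' by simp
  qed
  have F: "j > 0 \<and> \<sigma> $$ (i, j - 1) \<noteq> 0" if ij: "\<sigma> $$ (Suc i, j) \<noteq> 0" "Suc i < n" "j < n" for i j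
  proof -
    obtain j' where j': "j' < j" "\<sigma> $$ (i, j') \<noteq> 0" using L[OF ij] by blast
    then have "\<sigma> $$ (Suc i, Suc j') \<noteq> 0" using E[of i j'] ij by auto
    then have "Suc j' = j" using rook_row_eq[OF \<sigma>, of "Suc i" "Suc j'" j] ij j' by auto
    then show ?thesis using j' by auto
  qed
  have G: "i \<le> j \<and> \<sigma> $$ (0, j - i) \<noteq> 0" if "\<sigma> $$ (i, j) \<noteq> 0" "i < n" "j < n" for i j
    using that
  proof (induction i arbitrary: j)
    case (Suc i)
    have *: "j > 0" "\<sigma> $$ (i, j - 1) \<noteq> 0" using F[of i j] Suc.prems by auto
    then have "i \<le> j - 1" "\<sigma> $$ (0, j - 1 - i) \<noteq> 0" using Suc.IH[of "j - 1"] Suc.prems by auto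
    then show ?case using *(1) by auto
  qed simp
  have H: "\<sigma> $$ (i, i + d) \<noteq> 0" if "\<sigma> $$ (0, d) \<noteq> 0" "i + d < n" for i d
    using that
  proof (induction i)
    case (Suc i)
    then show ?case using E[of i "i + d"] by auto
  qed simp
  \<comment> \<open>The offset is the column of the entry in row 0, to which every entry can be
    traced back. If row 0 is zero, so is \<sigma>, and the offset n describes it.\<close>
  obtain d where d: "d \<le> n" "\<And>i j. i < n \<Longrightarrow> j < n \<Longrightarrow> \<sigma> $$ (i, j) \<noteq> 0 \<longleftrightarrow> j = i + d"
  proof (cases "\<exists>d<n. \<sigma> $$ (0, d) \<noteq> 0")
    case True
    then obtain d where d: "d < n" "\<sigma> $$ (0, d) \<noteq> 0" by blast
    have j_eq: "j = i + d" if ij: "i < n" "j < n" "\<sigma> $$ (i, j) \<noteq> 0" for i j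
    proof -
      have "i \<le> j" "\<sigma> $$ (0, j - i) \<noteq> 0" using G[OF ij(3,1,2)] by auto
      moreover have "j - i = d" using rook_row_eq[OF \<sigma> calculation(2) d(2)] ij d by simp
      ultimately show ?thesis by simp
    qed
    show ?thesis
    proof (rule that[of d])
      fix i j assume "i < n" "j < n"
      then show "\<sigma> $$ (i, j) \<noteq> 0 \<longleftrightarrow> j = i + d" using j_eq[of i j] H[OF d(2), of i] by blast
    qed (use d in simp)
  next
    case False
    have z: "\<sigma> $$ (i, j) = 0" if "i < n" "j < n" for i j
      using False G[OF _ that] that(2) less_imp_diff_less by blast
    show ?thesis by (rule that[of n]) (use z in auto)
  qed
  \<comment> \<open>Rows whose entry would fall outside the square get the value 1, which keeps
    \<open>t\<close> invertible.\<close>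
  define t where "t = mat_diag n (\<lambda>i. if i + d < n then \<sigma> $$ (i, i + d) else 1)"
  have t: "t \<in> torus n" unfolding t_def by (rule mat_diag_torus) (use d in auto)
  have eq: "\<sigma> = t * nu n ^\<^sub>m d"
    unfolding t_def mat_diag_mult_left[OF nu_pow_carrier]
  proof (rule eq_matI)
    let ?R = "mat n n (\<lambda>(i, j). (if i + d < n then \<sigma> $$ (i, i + d) else 1) * (nu n ^\<^sub>m d) $$ (i, j))"
    fix i j assume "i < dim_row ?R" "j < dim_col ?R"
    then have "i < n" "j < n" by auto
    then show "\<sigma> $$ (i, j) = ?R $$ (i, j)" using d(2)[of i j] by (auto simp: nu_pow_index)
  qed (use c in auto)
  have "vec_space.rank n \<sigma> = vec_space.rank n (t * nu n ^\<^sub>m d)" using eq by simp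
  also have "\<dots> = n - d" using rank_torus_mult[OF nu_pow_rook t] rank_nu_pow by simp
  finally have "n - vec_space.rank n \<sigma> = d" using d(1) by simp
  then show ?thesis using that[OF t] eq by simp
qed

subsection \<open>Length and the size of double cosets\<close>

lemma card_field_ge_2: "CARD('a::{finite, field}) \<ge> 2"
proof -
  have "card {0, 1 :: 'a} \<le> CARD('a)" by (rule card_mono) auto
  then show ?thesis by simp
qed

lemma flip_mult_simple_refl:
  assumes "A \<in> carrier_mat n n" "Suc k < n"
  shows "flip n (A * simple_refl n k) = simple_refl n (n - 2 - k) * flip n A"
  unfolding flip_mult[OF assms(1) simple_refl_carrier] flip_simple_refl[OF assms(2)] ..

lemma rank_mult_simple_refl:
  fixes \<sigma> :: "'a::field mat"
  assumes \<sigma>: "\<sigma> \<in> rooks n" and k: "Suc k < n"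
  shows "vec_space.rank n (\<sigma> * simple_refl n k) = vec_space.rank n \<sigma>"
proof -
  have "vec_space.rank n (\<sigma> * simple_refl n k) = vec_space.rank n (flip n (\<sigma> * simple_refl n k))"
    using rank_flip[OF mult_simple_refl_rook[OF k \<sigma>]] by simp
  also have "\<dots> = vec_space.rank n (flip n \<sigma>)"
    unfolding flip_mult_simple_refl[OF rooks_carrier[OF \<sigma>] k]
    by (rule rank_simple_refl_mult[OF flip_rooks[OF \<sigma>]]) (use k in simp)
  finally show ?thesis using rank_flip[OF \<sigma>] by simp
qed

lemma card_double_coset_mult_simple_refl_desc:
  fixes \<sigma> :: "'a::{finite, field} mat"
  assumes \<sigma>: "\<sigma> \<in> rooks n" and k: "Suc k < n" and d: "desc n (n - 2 - k) (flip n \<sigma>)"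
  shows "card (double_coset n \<sigma>) = CARD('a) * card (double_coset n (\<sigma> * simple_refl n k))"
proof -
  have "card (double_coset n \<sigma>) = card (double_coset n (flip n \<sigma>))"
    using card_double_coset_flip[OF rooks_carrier[OF \<sigma>]] by simp
  also have "\<dots> = CARD('a) * card (double_coset n (simple_refl n (n - 2 - k) * flip n \<sigma>))"
    by (rule card_double_coset_desc[OF flip_rooks[OF \<sigma>] _ d]) (use k in simp)
  also have "\<dots> = CARD('a) * card (double_coset n (\<sigma> * simple_refl n k))"
    unfolding flip_mult_simple_refl[OF rooks_carrier[OF \<sigma>] k, symmetric]
    using card_double_coset_flip[OF rooks_carrier[OF mult_simple_refl_rook[OF k \<sigma>]]] by simp
  finally show ?thesis .
qed

text \<open>The induction runs on |U\<sigma>U|, which is divided by q \<ge> 2 whenever a descent is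
  removed. The length cannot serve as the measure here, since its behaviour at descents is derived
  from this induction.\<close>

lemma rook_desc_induct [consumes 1, case_names reduced left right]:
  fixes \<sigma> :: "'a::{finite, field} mat"
  assumes "\<sigma> \<in> rooks n"
    and reduced: "\<And>\<sigma>. \<sigma> \<in> rooks n \<Longrightarrow> (\<And>k. Suc k < n \<Longrightarrow> \<not> desc n k \<sigma>) \<Longrightarrow>
      (\<And>k. Suc k < n \<Longrightarrow> \<not> desc n k (flip n \<sigma>)) \<Longrightarrow> P \<sigma>"
    and left: "\<And>\<sigma> k. \<sigma> \<in> rooks n \<Longrightarrow> Suc k < n \<Longrightarrow> desc n k \<sigma> \<Longrightarrow> P (simple_refl n k * \<sigma>) \<Longrightarrow> P \<sigma>"
    and right: "\<And>\<sigma> k. \<sigma> \<in> rooks n \<Longrightarrow> Suc k < n \<Longrightarrow> desc n (n - 2 - k) (flip n \<sigma>) \<Longrightarrow>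
      P (\<sigma> * simple_refl n k) \<Longrightarrow> P \<sigma>"
  shows "P \<sigma>"
  using assms(1)
proof (induction "card (double_coset n \<sigma>)" arbitrary: \<sigma> rule: less_induct)
  case less
  note \<sigma> = less.prems
  have small: "m < CARD('a) * m" if "m > 0" for m
    using card_field_ge_2[where 'a = 'a] that by simp
  show ?case
  proof (cases "\<exists>k. Suc k < n \<and> desc n k \<sigma>")
    case True
    then obtain k where k: "Suc k < n" "desc n k \<sigma>" by blast
    have s\<sigma>: "simple_refl n k * \<sigma> \<in> rooks n" by (rule simple_refl_mult_rook[OF k(1) \<sigma>])
    have "card (double_coset n (simple_refl n k * \<sigma>)) < card (double_coset n \<sigma>)"
      unfolding card_double_coset_desc[OF \<sigma> k] by (intro small card_double_coset_pos rooks_carrier[OF s\<sigma>])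
    then show ?thesis using left[OF \<sigma> k] less.hyps[OF _ s\<sigma>] by simp
  next
    case no_left: False
    show ?thesis
    proof (cases "\<exists>k. Suc k < n \<and> desc n k (flip n \<sigma>)")
      case True
      then obtain k' where k': "Suc k' < n" "desc n k' (flip n \<sigma>)" by blast
      define k where "k = n - 2 - k'"
      have "n - 2 - k = k'" using k'(1) by (simp add: k_def)
      then have k: "Suc k < n" "desc n (n - 2 - k) (flip n \<sigma>)" using k' by (auto simp: k_def)
      have s\<sigma>: "\<sigma> * simple_refl n k \<in> rooks n" by (rule mult_simple_refl_rook[OF k(1) \<sigma>])
      have "card (double_coset n (\<sigma> * simple_refl n k)) < card (double_coset n \<sigma>)"
        unfolding card_double_coset_mult_simple_refl_desc[OF \<sigma> k]
        by (intro small card_double_coset_pos rooks_carrier[OF s\<sigma>])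
      then show ?thesis using right[OF \<sigma> k] less.hyps[OF _ s\<sigma>] by simp
    qed (use no_left reduced[OF \<sigma>] in blast)
  qed
qed

section \<open>Words in the simple reflections, and the 0/1 pattern of a rook matrix\<close>

definition word_mat :: "nat \<Rightarrow> nat list \<Rightarrow> 'a::field mat" where
  "word_mat n ks = foldr (\<lambda>k A. simple_refl n k * A) ks (1\<^sub>m n)"

lemma word_mat_Nil [simp]: "word_mat n [] = 1\<^sub>m n"
  by (simp add: word_mat_def)

lemma word_mat_Cons [simp]: "word_mat n (k # ks) = simple_refl n k * word_mat n ks"
  by (simp add: word_mat_def)

lemma word_mat_carrier [simp]: "word_mat n ks \<in> carrier_mat n n"
  by (induction ks) (auto intro: mult_square)

lemma word_mat_append: "word_mat n (ks @ ls) = word_mat n ks * word_mat n ls"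
  by (induction ks) (simp_all add: assoc_square[where n = n] left_mult_one_mat[OF word_mat_carrier])

lemma word_mat_rev_mult:
  assumes "\<forall>k\<in>set ks. Suc k < n" "A \<in> carrier_mat n n"
  shows "word_mat n (rev ks) * (word_mat n ks * A) = A"
  using assms
proof (induction ks arbitrary: A)
  case (Cons k ks)
  have c: "word_mat n ks * A \<in> carrier_mat n n" using Cons.prems by (intro mult_square) auto
  have "word_mat n (rev (k # ks)) * (word_mat n (k # ks) * A) =
      word_mat n (rev ks) * (simple_refl n k * (simple_refl n k * (word_mat n ks * A)))"
    using Cons.prems c
    by (simp add: word_mat_append assoc_square[where n = n] mult_square[where n = n])
  also have "\<dots> = A" using Cons c by (simp add: simple_refl_cancel)
  finally show ?case .
qed simp

lemma mult_word_mat_rev: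
  fixes A :: "'a::field mat"
  assumes "\<forall>k\<in>set ks. Suc k < n" "A \<in> carrier_mat n n"
  shows "A * word_mat n ks * word_mat n (rev ks) = A"
proof -
  have "word_mat n (rev (rev ks)) * (word_mat n (rev ks) * 1\<^sub>m n) = (1\<^sub>m n :: 'a mat)"
    by (rule word_mat_rev_mult) (use assms in auto)
  then have "word_mat n ks * word_mat n (rev ks) = (1\<^sub>m n :: 'a mat)"
    by (simp add: right_mult_one_mat[OF word_mat_carrier])
  then show ?thesis
    unfolding assoc_mult_mat[OF assms(2) word_mat_carrier word_mat_carrier] using assms(2) by simp
qed

lemma word_mat_perm_mats:
  assumes "\<forall>k\<in>set ks. Suc k < n" shows "(word_mat n ks :: 'a::field mat) \<in> perm_mats n"
  using assms
proof (induction ks)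
  case Nil
  show ?case unfolding perm_mats_def word_mat_Nil perm_mat_id[symmetric] using permutes_id by blast
next
  case (Cons k ks)
  then obtain p where p: "p permutes {..<n}" "word_mat n ks = (perm_mat n p :: 'a mat)"
    by (auto simp: perm_mats_def)
  have k: "swap k permutes {..<n}" using Cons.prems by (intro swap_permutes) auto
  have "word_mat n (k # ks) = (perm_mat n (p \<circ> swap k) :: 'a mat)"
    using p(2) by (simp add: simple_refl_def perm_mat_mult[OF k])
  then show ?case unfolding perm_mats_def using permutes_compose[OF k p(1)] by blast
qed

lemma cox_length_word_mat:
  assumes "\<forall>k\<in>set ks. Suc k < n" shows "cox_length n (word_mat n ks) \<le> length ks"
  unfolding cox_length_def by (rule Least_le) (use assms in \<open>auto simp: word_mat_def\<close>)

lemma rook_word_mat_mult: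
  assumes "\<forall>k\<in>set ks. Suc k < n" "\<sigma> \<in> rooks n" shows "word_mat n ks * \<sigma> \<in> rooks n"
  using assms
proof (induction ks)
  case Nil
  then show ?case using rooks_carrier by fastforce
next
  case (Cons k ks)
  have "word_mat n (k # ks) * \<sigma> = simple_refl n k * (word_mat n ks * \<sigma>)"
    using rooks_carrier[OF Cons.prems(2)] by (simp add: assoc_square[where n = n])
  then show ?case using Cons simple_refl_mult_rook[of k n "word_mat n ks * \<sigma>"] by simp
qed

lemma tilde_index: "A \<in> carrier_mat n n \<Longrightarrow> i < n \<Longrightarrow> j < n \<Longrightarrow> tilde A $$ (i, j) = (if A $$ (i, j) = 0 then 0 else 1)"
  by (simp add: tilde_def)

lemma tilde_carrier: "A \<in> carrier_mat n n \<Longrightarrow> tilde A \<in> carrier_mat n n"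
  by (simp add: tilde_def)

lemma tilde_simple_refl_mult:
  fixes A :: "'a::field mat"
  assumes "Suc k < n" "A \<in> carrier_mat n n"
  shows "tilde (simple_refl n k * A) = simple_refl n k * tilde A"
proof (rule eq_matI)
  fix i j assume "i < dim_row (simple_refl n k * tilde A)" "j < dim_col (simple_refl n k * tilde A)"
  then have "i < n" "j < n" using assms by (auto simp: tilde_def)
  moreover have "simple_refl n k * A \<in> carrier_mat n n" by (rule mult_square[OF simple_refl_carrier assms(2)])
  ultimately show "tilde (simple_refl n k * A) $$ (i, j) = (simple_refl n k * tilde A) $$ (i, j)"
    using assms by (simp add: tilde_index[where n = n] simple_refl_mult_left[OF assms(1)] tilde_carrier swap_less)
qed (use assms in \<open>auto simp: tilde_def\<close>)

lemma tilde_mult_simple_refl: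
  fixes A :: "'a::field mat"
  assumes "Suc k < n" "A \<in> carrier_mat n n"
  shows "tilde (A * simple_refl n k) = tilde A * simple_refl n k"
proof (rule eq_matI)
  fix i j assume "i < dim_row (tilde A * simple_refl n k)" "j < dim_col (tilde A * simple_refl n k)"
  then have "i < n" "j < n" using assms by (auto simp: tilde_def)
  moreover have "A * simple_refl n k \<in> carrier_mat n n" by (rule mult_square[OF assms(2) simple_refl_carrier])
  ultimately show "tilde (A * simple_refl n k) $$ (i, j) = (tilde A * simple_refl n k) $$ (i, j)"
    using assms by (simp add: tilde_index[where n = n] simple_refl_mult_right[OF assms(1)] tilde_carrier swap_less)
qed (use assms in \<open>auto simp: tilde_def\<close>)

lemma tilde_word_mat_mult:
  fixes A :: "'a::field mat"
  assumes "\<forall>k\<in>set ks. Suc k < n" "A \<in> carrier_mat n n"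
  shows "tilde (word_mat n ks * A) = word_mat n ks * tilde A"
  using assms
proof (induction ks)
  case Nil
  then show ?case using tilde_carrier[OF Nil(2)] by simp
next
  case (Cons k ks)
  have c: "word_mat n ks * A \<in> carrier_mat n n" by (rule mult_square[OF word_mat_carrier Cons.prems(2)])
  have "tilde (word_mat n (k # ks) * A) = tilde (simple_refl n k * (word_mat n ks * A))"
    using Cons.prems by (simp add: assoc_square[where n = n])
  also have "\<dots> = simple_refl n k * tilde (word_mat n ks * A)"
    by (rule tilde_simple_refl_mult[OF _ c]) (use Cons.prems in simp)
  also have "\<dots> = word_mat n (k # ks) * tilde A"
    using Cons tilde_carrier[OF Cons.prems(2)] by (simp add: assoc_square[where n = n])
  finally show ?case .
qed

lemma tilde_mult_word_mat:
  fixes A :: "'a::field mat"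
  assumes "\<forall>k\<in>set ks. Suc k < n" "A \<in> carrier_mat n n"
  shows "tilde (A * word_mat n ks) = tilde A * word_mat n ks"
  using assms
proof (induction ks arbitrary: A)
  case Nil
  then show ?case using tilde_carrier[OF Nil(2)] by simp
next
  case (Cons k ks)
  have k: "Suc k < n" using Cons.prems by simp
  have c: "A * simple_refl n k \<in> carrier_mat n n" by (rule mult_square[OF Cons.prems(2) simple_refl_carrier])
  have "tilde (A * word_mat n (k # ks)) = tilde (A * simple_refl n k * word_mat n ks)"
    using Cons.prems by (simp add: assoc_square[where n = n])
  also have "\<dots> = tilde (A * simple_refl n k) * word_mat n ks"
    by (rule Cons.IH[OF _ c]) (use Cons.prems in simp)
  also have "\<dots> = tilde A * word_mat n (k # ks)"
    unfolding tilde_mult_simple_refl[OF k Cons.prems(2)]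
    using tilde_carrier[OF Cons.prems(2)] by (simp add: assoc_square[where n = n])
  finally show ?case .
qed

lemma tilde_torus_mult:
  fixes A :: "'a::field mat"
  assumes "t \<in> torus n" "A \<in> carrier_mat n n"
  shows "tilde (t * A) = tilde A"
proof -
  obtain d where d: "t = mat_diag n d" "\<forall>i<n. d i \<noteq> 0" using assms torus_iff by blast
  show ?thesis unfolding d(1) mat_diag_mult_left[OF assms(2)]
    by (rule eq_matI) (use assms d(2) in \<open>auto simp: tilde_def\<close>)
qed

lemma tilde_nu_pow: "tilde (nu n ^\<^sub>m d) = (nu n ^\<^sub>m d :: 'a::field mat)"
proof (rule eq_matI)
  fix i j assume "i < dim_row (nu n ^\<^sub>m d :: 'a mat)" "j < dim_col (nu n ^\<^sub>m d :: 'a mat)"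
  then have "i < n" "j < n" using nu_pow_carrier[of n d, where 'a = 'a] by (auto simp del: nu_pow_carrier split: if_splits)
  then show "tilde (nu n ^\<^sub>m d) $$ (i, j) = (nu n ^\<^sub>m d :: 'a mat) $$ (i, j)"
    by (simp add: tilde_index[OF nu_pow_carrier] nu_pow_index)
qed (simp_all add: tilde_def)

lemma rook_eq_torus_mult_tilde:
  fixes \<sigma> :: "'a::field mat"
  assumes \<sigma>: "\<sigma> \<in> rooks n"
  obtains t where "t \<in> torus n" "\<sigma> = t * tilde \<sigma>"
proof -
  note c = rooks_carrier[OF \<sigma>]
  \<comment> \<open>The entry of row i, or 1 on a zero row so that the diagonal matrix is
    invertible.\<close>
  define d where "d = (\<lambda>i. if \<exists>j<n. \<sigma> $$ (i, j) \<noteq> 0 then \<sigma> $$ (i, SOME j. j < n \<and> \<sigma> $$ (i, j) \<noteq> 0) else 1)"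
  have dj: "d i = \<sigma> $$ (i, j)" if "i < n" "j < n" "\<sigma> $$ (i, j) \<noteq> 0" for i j
  proof -
    have "(SOME j. j < n \<and> \<sigma> $$ (i, j) \<noteq> 0) = j"
      by (rule some_equality) (use that rook_row_eq[OF \<sigma>, of i] in auto)
    then show ?thesis using that by (auto simp: d_def)
  qed
  have "d i \<noteq> 0" if "i < n" for i
    using dj[OF that] by (cases "\<exists>j<n. \<sigma> $$ (i, j) \<noteq> 0") (auto simp: d_def)
  then have "mat_diag n d \<in> torus n" by (rule mat_diag_torus)
  moreover have "\<sigma> = mat_diag n d * tilde \<sigma>"
    unfolding mat_diag_mult_left[OF tilde_carrier[OF c]]
    by (rule eq_matI) (use c dj in \<open>auto simp: tilde_index[OF c]\<close>)
  ultimately show ?thesis using that by blast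
qed

lemma tilde_rook:
  fixes \<sigma> :: "'a::field mat"
  assumes \<sigma>: "\<sigma> \<in> rooks n" shows "tilde \<sigma> \<in> rooks n"
proof -
  note c = rooks_carrier[OF \<sigma>]
  show ?thesis unfolding rooks_iff
    using tilde_carrier[OF c] \<sigma>[unfolded rooks_iff] by (simp add: tilde_index[OF c])
qed

text \<open>Each removed descent contributes one letter to \<open>ks\<close> or \<open>ls\<close>
  and one factor q to the size; the last factor is the size of the double coset of \<nu>^{n-r}. A
  new letter enters next to \<sigma>: at the end of \<open>ks\<close> or in front of
  \<open>ls\<close>.\<close>

lemma rook_word_normal_form:
  fixes \<sigma> :: "'a::{finite, field} mat"
  assumes "\<sigma> \<in> rooks n"
  shows "\<exists>ks ls t. (\<forall>k\<in>set ks. Suc k < n) \<and> (\<forall>k\<in>set ls. Suc k < n) \<and> t \<in> torus n \<and>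
    word_mat n ks * \<sigma> * word_mat n ls = t * nu n ^\<^sub>m (n - vec_space.rank n \<sigma>) \<and>
    card (double_coset n \<sigma>) = CARD('a) ^ (length ks + length ls) *
      CARD('a) ^ (vec_space.rank n \<sigma> * (vec_space.rank n \<sigma> - 1) div 2)"
  using assms
proof (induction rule: rook_desc_induct)
  case (reduced \<sigma>)
  note c = rooks_carrier[OF reduced(1)]
  obtain t where t: "t \<in> torus n" "\<sigma> = t * nu n ^\<^sub>m (n - vec_space.rank n \<sigma>)"
    using no_desc_rook[OF reduced] by blast
  have "card (double_coset n \<sigma>) = card (double_coset n (nu n ^\<^sub>m (n - vec_space.rank n \<sigma>) :: 'a mat))"
    using card_double_coset_torus[OF t(1) nu_pow_carrier, of "n - vec_space.rank n \<sigma>"] t(2) by simp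
  moreover have "n - (n - vec_space.rank n \<sigma>) = vec_space.rank n \<sigma>"
    using vec_space.rank_le_nc[OF c] by simp
  ultimately have "card (double_coset n \<sigma>) =
      CARD('a) ^ (vec_space.rank n \<sigma> * (vec_space.rank n \<sigma> - 1) div 2)"
    by (simp only: card_double_coset_nu_pow)
  then show ?case using t c by (intro exI[of _ "[]"] exI[of _ t]) simp
next
  case (left \<sigma> k)
  note c = rooks_carrier[OF left(1)]
  obtain ks ls t where IH: "\<forall>k\<in>set ks. Suc k < n" "\<forall>k\<in>set ls. Suc k < n" "t \<in> torus n"
    "word_mat n ks * (simple_refl n k * \<sigma>) * word_mat n ls = t * nu n ^\<^sub>m (n - vec_space.rank n \<sigma>)"
    "card (double_coset n (simple_refl n k * \<sigma>)) = CARD('a) ^ (length ks + length ls) *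
      CARD('a) ^ (vec_space.rank n \<sigma> * (vec_space.rank n \<sigma> - 1) div 2)"
    using left(4) unfolding rank_simple_refl_mult[OF left(1,2)] by blast
  have "word_mat n (ks @ [k]) * \<sigma> = word_mat n ks * (simple_refl n k * \<sigma>)"
    using c by (simp add: word_mat_append assoc_square[where n = n])
  then show ?case using IH left(2) card_double_coset_desc[OF left(1-3)]
    by (intro exI[of _ "ks @ [k]"] exI[of _ ls] exI[of _ t]) simp
next
  case (right \<sigma> k)
  note c = rooks_carrier[OF right(1)]
  obtain ks ls t where IH: "\<forall>k\<in>set ks. Suc k < n" "\<forall>k\<in>set ls. Suc k < n" "t \<in> torus n"
    "word_mat n ks * (\<sigma> * simple_refl n k) * word_mat n ls = t * nu n ^\<^sub>m (n - vec_space.rank n \<sigma>)"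
    "card (double_coset n (\<sigma> * simple_refl n k)) = CARD('a) ^ (length ks + length ls) *
      CARD('a) ^ (vec_space.rank n \<sigma> * (vec_space.rank n \<sigma> - 1) div 2)"
    using right(4) unfolding rank_mult_simple_refl[OF right(1,2)] by blast
  have "word_mat n ks * \<sigma> * word_mat n (k # ls) = word_mat n ks * (\<sigma> * simple_refl n k) * word_mat n ls"
    using c by (simp add: assoc_square[where n = n] mult_square[where n = n])
  then show ?case using IH right(2) card_double_coset_mult_simple_refl_desc[OF right(1-3)]
    by (intro exI[of _ ks] exI[of _ "k # ls"] exI[of _ t]) simp
qed

text \<open>That the simple reflections generate W comes out of the normal form: a permutation
  matrix has rank n, so the target is t \<nu>^0 = t, and \<open>tilde\<close> turns t into 1 while
  it fixes u and passes through the words. Solving for u yields a word.\<close>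

lemma perm_mats_word:
  fixes u :: "'a::{finite, field} mat"
  assumes "u \<in> perm_mats n"
  obtains ks where "\<forall>k\<in>set ks. Suc k < n" "u = word_mat n ks"
proof -
  obtain p where p: "p permutes {..<n}" "u = perm_mat n p" using assms by (auto simp: perm_mats_def)
  have "perm_mat n p * 1\<^sub>m n \<in> rooks n" by (rule perm_mat_mult_rook[OF p(1) one_rook])
  then have u: "u \<in> rooks n" using p(2) by (simp add: right_mult_one_mat[OF perm_mat_carrier])
  note c = rooks_carrier[OF u]
  have "{i. i < n \<and> (\<exists>j<n. u $$ (i, j) \<noteq> 0)} = {..<n}"
  proof safe
    fix i assume "i < n"
    then have "u $$ (i, p i) = 1" "p i < n"
      using permutes_in_image[OF p(1), of i] by (auto simp: p(2) perm_mat_def)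
    then show "\<exists>j<n. u $$ (i, j) \<noteq> 0" using zero_neq_one by metis
  qed
  then have rank: "vec_space.rank n u = n" using rank_rook_rows[OF u] by simp
  obtain ks ls t where w: "\<forall>k\<in>set ks. Suc k < n" "\<forall>k\<in>set ls. Suc k < n" "t \<in> torus n"
    "word_mat n ks * u * word_mat n ls = t * nu n ^\<^sub>m 0"
    using rook_word_normal_form[OF u] unfolding rank by auto
  have cw: "word_mat n ks * u \<in> carrier_mat n n" by (rule mult_square[OF word_mat_carrier c])
  have "tilde u = u" by (rule eq_matI) (auto simp: tilde_def p(2) perm_mat_def)
  then have "word_mat n ks * u * word_mat n ls = tilde (word_mat n ks * u * word_mat n ls)"
    using tilde_mult_word_mat[OF w(2) cw] tilde_word_mat_mult[OF w(1) c] by simp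
  also have "\<dots> = nu n ^\<^sub>m 0" unfolding w(4) tilde_torus_mult[OF w(3) nu_pow_carrier] by (rule tilde_nu_pow)
  finally have one: "word_mat n ks * u * word_mat n ls = 1\<^sub>m n" by simp
  have "word_mat n ks * u = word_mat n ks * u * word_mat n ls * word_mat n (rev ls)"
    using mult_word_mat_rev[OF w(2) cw] by simp
  also have "\<dots> = word_mat n (rev ls)" using one by (simp add: left_mult_one_mat[OF word_mat_carrier])
  finally have "word_mat n (rev ks) * (word_mat n ks * u) = word_mat n (rev ks @ rev ls)"
    by (simp add: word_mat_append)
  then have "u = word_mat n (rev ks @ rev ls)" using word_mat_rev_mult[OF w(1) c] by simp
  moreover have "\<forall>k\<in>set (rev ks @ rev ls). Suc k < n" using w(1,2) by auto
  ultimately show ?thesis using that by blast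
qed

text \<open>Since some word for u exists, the \<open>LEAST\<close> in \<open>cox_length\<close> is
  attained.\<close>

lemma cox_length_word:
  fixes u :: "'a::{finite, field} mat"
  assumes "u \<in> perm_mats n"
  obtains ks where "\<forall>k\<in>set ks. Suc k < n" "u = word_mat n ks" "length ks = cox_length n u"
proof -
  let ?P = "\<lambda>m. \<exists>ks. length ks = m \<and> (\<forall>k \<in> set ks. Suc k < n) \<and> u = foldr (\<lambda>k A. simple_refl n k * A) ks (1\<^sub>m n)"
  obtain ks where ks: "\<forall>k\<in>set ks. Suc k < n" "u = word_mat n ks" using perm_mats_word[OF assms] by blast
  then have "?P (length ks)" unfolding word_mat_def by blast
  then have "?P (LEAST m. ?P m)" by (rule LeastI)
  then show ?thesis using that unfolding cox_length_def word_mat_def by blast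
qed

text \<open>Up and fixed cases do not shrink the double coset, and a descent shrinks it by exactly
  q. Iterated along words on both sides, this bounds the length from below.\<close>

lemma card_double_coset_le_simple_refl:
  fixes \<sigma> :: "'a::{finite, field} mat"
  assumes \<sigma>: "\<sigma> \<in> rooks n" and k: "Suc k < n"
  shows "card (double_coset n \<sigma>) \<le> CARD('a) * card (double_coset n (simple_refl n k * \<sigma>))"
proof (cases "desc n k \<sigma>")
  case True
  then show ?thesis using card_double_coset_desc[OF assms] by simp
next
  case False
  have q: "CARD('a) \<ge> 1" using card_field_ge_2[where 'a = 'a] by simp
  show ?thesis
  proof (cases "simple_refl n k * \<sigma> = \<sigma>")
    case False
    then have "card (double_coset n (simple_refl n k * \<sigma>)) = CARD('a) * card (double_coset n \<sigma>)"
      using card_double_coset_simple_refl[OF \<sigma> k \<open>\<not> desc n k \<sigma>\<close>] by simp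
    then show ?thesis using q by simp
  qed (use q in simp)
qed

lemma card_double_coset_le_mult_simple_refl:
  fixes \<sigma> :: "'a::{finite, field} mat"
  assumes \<sigma>: "\<sigma> \<in> rooks n" and k: "Suc k < n"
  shows "card (double_coset n \<sigma>) \<le> CARD('a) * card (double_coset n (\<sigma> * simple_refl n k))"
proof -
  have "card (double_coset n (flip n \<sigma>)) \<le> CARD('a) * card (double_coset n (simple_refl n (n - 2 - k) * flip n \<sigma>))"
    by (rule card_double_coset_le_simple_refl[OF flip_rooks[OF \<sigma>]]) (use k in simp)
  then show ?thesis
    unfolding flip_mult_simple_refl[OF rooks_carrier[OF \<sigma>] k, symmetric]
      card_double_coset_flip[OF rooks_carrier[OF \<sigma>]]
      card_double_coset_flip[OF rooks_carrier[OF mult_simple_refl_rook[OF k \<sigma>]]] .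
qed

lemma card_double_coset_le_word_mat_mult:
  fixes \<sigma> :: "'a::{finite, field} mat"
  assumes "\<forall>k\<in>set ks. Suc k < n" and \<sigma>: "\<sigma> \<in> rooks n"
  shows "card (double_coset n \<sigma>) \<le> CARD('a) ^ length ks * card (double_coset n (word_mat n ks * \<sigma>))"
  using assms(1)
proof (induction ks)
  case Nil
  then show ?case using rooks_carrier[OF \<sigma>] by simp
next
  case (Cons k ks)
  have "word_mat n (k # ks) * \<sigma> = simple_refl n k * (word_mat n ks * \<sigma>)"
    using rooks_carrier[OF \<sigma>] by (simp add: assoc_square[where n = n])
  moreover have "card (double_coset n (word_mat n ks * \<sigma>)) \<le>
      CARD('a) * card (double_coset n (simple_refl n k * (word_mat n ks * \<sigma>)))"
    by (rule card_double_coset_le_simple_refl[OF rook_word_mat_mult[OF _ \<sigma>]]) (use Cons.prems in auto)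
  ultimately have "CARD('a) ^ length ks * card (double_coset n (word_mat n ks * \<sigma>)) \<le>
      CARD('a) ^ length ks * (CARD('a) * card (double_coset n (word_mat n (k # ks) * \<sigma>)))"
    by (simp only: mult_le_mono2)
  moreover have "card (double_coset n \<sigma>) \<le> CARD('a) ^ length ks * card (double_coset n (word_mat n ks * \<sigma>))"
    using Cons by simp
  ultimately show ?case by (simp only: length_Cons power_Suc mult_ac)
qed

lemma card_double_coset_le_mult_word_mat:
  fixes \<sigma> :: "'a::{finite, field} mat"
  assumes "\<forall>k\<in>set ks. Suc k < n" and \<sigma>: "\<sigma> \<in> rooks n"
  shows "card (double_coset n \<sigma>) \<le> CARD('a) ^ length ks * card (double_coset n (\<sigma> * word_mat n ks))"
  using assms
proof (induction ks arbitrary: \<sigma>)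
  case Nil
  then show ?case using rooks_carrier[OF Nil(2)] by simp
next
  case (Cons k ks)
  have k: "Suc k < n" using Cons.prems by simp
  have "\<sigma> * word_mat n (k # ks) = \<sigma> * simple_refl n k * word_mat n ks"
    using rooks_carrier[OF Cons.prems(2)] by (simp add: assoc_square[where n = n])
  moreover have "card (double_coset n (\<sigma> * simple_refl n k)) \<le>
      CARD('a) ^ length ks * card (double_coset n (\<sigma> * simple_refl n k * word_mat n ks))"
    by (rule Cons.IH[OF _ mult_simple_refl_rook[OF k Cons.prems(2)]]) (use Cons.prems in auto)
  ultimately have "CARD('a) * card (double_coset n (\<sigma> * simple_refl n k)) \<le>
      CARD('a) * (CARD('a) ^ length ks * card (double_coset n (\<sigma> * word_mat n (k # ks))))"
    by (simp only: mult_le_mono2)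
  then show ?case
    using card_double_coset_le_mult_simple_refl[OF Cons.prems(2) k] by (simp only: length_Cons power_Suc mult_ac)
qed

lemma card_double_coset_rook:
  fixes \<sigma> :: "'a::{finite, field} mat"
  assumes \<sigma>: "\<sigma> \<in> rooks n"
  shows "card (double_coset n \<sigma>) =
    CARD('a) ^ (rook_length n \<sigma> + vec_space.rank n \<sigma> * (vec_space.rank n \<sigma> - 1) div 2)"
proof -
  note c = rooks_carrier[OF \<sigma>]
  let ?q = "CARD('a)" and ?r = "vec_space.rank n \<sigma>"
  let ?N = "?r * (?r - 1) div 2"
  let ?P = "\<lambda>m. \<exists>u \<in> perm_mats n. \<exists>w \<in> perm_mats n.
     m = cox_length n u + cox_length n w \<and> u * tilde \<sigma> * w = nu n ^\<^sub>m (n - ?r)"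
  obtain ks ls t where w: "\<forall>k\<in>set ks. Suc k < n" "\<forall>k\<in>set ls. Suc k < n" "t \<in> torus n"
    "word_mat n ks * \<sigma> * word_mat n ls = t * nu n ^\<^sub>m (n - ?r)"
    "card (double_coset n \<sigma>) = ?q ^ (length ks + length ls) * ?q ^ ?N"
    using rook_word_normal_form[OF \<sigma>] by blast
  have cw: "word_mat n ks * \<sigma> \<in> carrier_mat n n" by (rule mult_square[OF word_mat_carrier c])
  have "word_mat n ks * tilde \<sigma> * word_mat n ls = tilde (word_mat n ks * \<sigma> * word_mat n ls)"
    using tilde_mult_word_mat[OF w(2) cw] tilde_word_mat_mult[OF w(1) c] by simp
  also have "\<dots> = nu n ^\<^sub>m (n - ?r)"
    unfolding w(4) tilde_torus_mult[OF w(3) nu_pow_carrier] by (rule tilde_nu_pow)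
  finally have P: "?P (cox_length n (word_mat n ks :: 'a mat) + cox_length n (word_mat n ls :: 'a mat))"
    using word_mat_perm_mats[OF w(1)] word_mat_perm_mats[OF w(2)] by blast
  have le: "rook_length n \<sigma> \<le> length ks + length ls"
  proof -
    have "rook_length n \<sigma> \<le> cox_length n (word_mat n ks :: 'a mat) + cox_length n (word_mat n ls :: 'a mat)"
      unfolding rook_length_def by (rule Least_le[of ?P]) (rule P)
    also have "\<dots> \<le> length ks + length ls"
      by (intro add_mono cox_length_word_mat w)
    finally show ?thesis .
  qed
  have "?P (rook_length n \<sigma>)" unfolding rook_length_def by (rule LeastI[of ?P]) (rule P)
  then obtain u v where uv: "u \<in> perm_mats n" "v \<in> perm_mats n"
    "rook_length n \<sigma> = cox_length n u + cox_length n v" "u * tilde \<sigma> * v = nu n ^\<^sub>m (n - ?r)"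
    by blast
  obtain us where us: "\<forall>k\<in>set us. Suc k < n" "u = word_mat n us" "length us = cox_length n u"
    using cox_length_word[OF uv(1)] by blast
  obtain vs where vs: "\<forall>k\<in>set vs. Suc k < n" "v = word_mat n vs" "length vs = cox_length n v"
    using cox_length_word[OF uv(2)] by blast
  obtain t' where t': "t' \<in> torus n" "\<sigma> = t' * tilde \<sigma>" using rook_eq_torus_mult_tilde[OF \<sigma>] by blast
  \<comment> \<open>The length is defined through \<open>tilde \<sigma>\<close>, so the torus factor
    is dropped before the letters are applied.\<close>
  have "card (double_coset n \<sigma>) = card (double_coset n (tilde \<sigma>))"
    using card_double_coset_torus[OF t'(1) tilde_carrier[OF c]] t'(2) by simp
  also have "\<dots> \<le> ?q ^ length us * card (double_coset n (u * tilde \<sigma>))"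
    unfolding us(2) by (rule card_double_coset_le_word_mat_mult[OF us(1) tilde_rook[OF \<sigma>]])
  also have "\<dots> \<le> ?q ^ length us * (?q ^ length vs * card (double_coset n (u * tilde \<sigma> * v)))"
    unfolding us(2) vs(2)
    by (intro mult_le_mono2 card_double_coset_le_mult_word_mat[OF vs(1)] rook_word_mat_mult[OF us(1) tilde_rook[OF \<sigma>]])
  also have "\<dots> = ?q ^ rook_length n \<sigma> * ?q ^ ?N"
    using vec_space.rank_le_nc[OF c] us(3) vs(3) uv(3)
    by (simp add: uv(4) card_double_coset_nu_pow power_add)
  finally have "?q ^ (length ks + length ls + ?N) \<le> ?q ^ (rook_length n \<sigma> + ?N)"
    unfolding w(5) by (simp only: power_add)
  then have "length ks + length ls \<le> rook_length n \<sigma>"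
    using card_field_ge_2[where 'a = 'a] by (simp add: power_le_imp_le_exp)
  then have "rook_length n \<sigma> = length ks + length ls" using le by simp
  then show ?thesis unfolding w(5) by (simp only: power_add)
qed

text \<open>For equal ranks the factors q^{r(r-1)/2} agree, and q \<ge> 2 allows exponents to be
  compared. All later length formulas come from ratios of sizes in this way.\<close>

lemma rook_length_eqI:
  fixes \<sigma> \<tau> :: "'a::{finite, field} mat"
  assumes "\<sigma> \<in> rooks n" "\<tau> \<in> rooks n" "vec_space.rank n \<tau> = vec_space.rank n \<sigma>"
    and "card (double_coset n \<tau>) = CARD('a) ^ m * card (double_coset n \<sigma>)"
  shows "rook_length n \<tau> = m + rook_length n \<sigma>"
proof -
  have "CARD('a) ^ (rook_length n \<tau> + vec_space.rank n \<sigma> * (vec_space.rank n \<sigma> - 1) div 2) =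
      CARD('a) ^ (m + (rook_length n \<sigma> + vec_space.rank n \<sigma> * (vec_space.rank n \<sigma> - 1) div 2))"
    using assms(4) unfolding card_double_coset_rook[OF assms(1)] card_double_coset_rook[OF assms(2)] assms(3)
    by (simp only: power_add)
  then show ?thesis using card_field_ge_2[where 'a = 'a] by (simp add: power_inject_exp)
qed

section \<open>Length at descents, under torus factors and under reflection\<close>

lemma rook_length_desc:
  fixes \<sigma> :: "'a::{finite, field} mat"
  assumes "\<sigma> \<in> rooks n" "Suc k < n" "desc n k \<sigma>"
  shows "rook_length n \<sigma> = Suc (rook_length n (simple_refl n k * \<sigma>))"
  using rook_length_eqI[OF simple_refl_mult_rook[OF assms(2,1)] assms(1), of 1]
    rank_simple_refl_mult[OF assms(1,2)] card_double_coset_desc[OF assms] by simp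

lemma rook_length_not_desc:
  fixes \<sigma> :: "'a::{finite, field} mat"
  assumes "\<sigma> \<in> rooks n" "Suc k < n" "\<not> desc n k \<sigma>" "simple_refl n k * \<sigma> \<noteq> \<sigma>"
  shows "rook_length n (simple_refl n k * \<sigma>) = Suc (rook_length n \<sigma>)"
  using rook_length_eqI[OF assms(1) simple_refl_mult_rook[OF assms(2,1)], of 1]
    rank_simple_refl_mult[OF assms(1,2)] card_double_coset_simple_refl[OF assms] by simp

lemma rook_length_torus_mult:
  fixes \<sigma> :: "'a::{finite, field} mat"
  assumes "\<sigma> \<in> rooks n" "t \<in> torus n"
  shows "rook_length n (t * \<sigma>) = rook_length n \<sigma>"
  using rook_length_eqI[OF assms(1) torus_mult_rook[OF assms(2,1)], of 0]
    rank_torus_mult[OF assms] card_double_coset_torus[OF assms(2) rooks_carrier[OF assms(1)]] by simp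

lemma rook_length_flip:
  fixes \<sigma> :: "'a::{finite, field} mat"
  assumes "\<sigma> \<in> rooks n"
  shows "rook_length n (flip n \<sigma>) = rook_length n \<sigma>"
  using rook_length_eqI[OF assms flip_rooks[OF assms], of 0]
    rank_flip[OF assms] card_double_coset_flip[OF rooks_carrier[OF assms]] by simp

lemma rook_length_nu_pow: "rook_length n (nu n ^\<^sub>m d :: 'a::{finite, field} mat) = 0"
proof -
  have "CARD('a) ^ (rook_length n (nu n ^\<^sub>m d :: 'a mat) + (n - d) * (n - d - 1) div 2) =
      CARD('a) ^ (0 + (n - d) * (n - d - 1) div 2)"
    using card_double_coset_rook[OF nu_pow_rook[of n d, where 'a = 'a]]
    by (simp only: rank_nu_pow card_double_coset_nu_pow add_0)
  then show ?thesis using card_field_ge_2[where 'a = 'a] by (simp add: power_inject_exp)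
qed

lemma rook_length_reduced:
  fixes \<sigma> :: "'a::{finite, field} mat"
  assumes \<sigma>: "\<sigma> \<in> rooks n"
    and left: "\<And>k. Suc k < n \<Longrightarrow> \<not> desc n k \<sigma>"
    and right: "\<And>k. Suc k < n \<Longrightarrow> \<not> desc n k (flip n \<sigma>)"
  shows "rook_length n \<sigma> = 0"
proof -
  obtain t where "t \<in> torus n" "\<sigma> = t * nu n ^\<^sub>m (n - vec_space.rank n \<sigma>)"
    using no_desc_rook[OF assms] by blast
  then show ?thesis using rook_length_torus_mult[OF nu_pow_rook, of t n "n - vec_space.rank n \<sigma>"]
    by (simp add: rook_length_nu_pow)
qed

subsection \<open>Convolution\<close>

text \<open>The matrix type contains all dimensions. Under this condition the index set of the
  product, which depends on the supports, can be replaced by all pairs from the finite set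
  \<open>carrier_mat n n\<close>.\<close>

definition supported :: "nat \<Rightarrow> ('a mat \<Rightarrow> rat) \<Rightarrow> bool" where
  "supported n f \<longleftrightarrow> (\<forall>x. x \<notin> carrier_mat n n \<longrightarrow> f x = 0)"

text \<open>The product of the monoid algebra, freed from the record and from n.\<close>

definition conv :: "('a::{finite, field} mat \<Rightarrow> rat) \<Rightarrow> ('a mat \<Rightarrow> rat) \<Rightarrow> 'a mat \<Rightarrow> rat" where
  "conv f g = (\<lambda>x. \<Sum>(y, z) \<in> {(y, z). f y \<noteq> 0 \<and> g z \<noteq> 0 \<and> y * z = x}. f y * g z)"

lemma mult_HMU: "mult (HMU n) = conv"
  by (simp add: HMU_def mat_algebra_def monoid_algebra_def conv_def[abs_def] ring_mat_def)

lemma conv_eq: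
  fixes f g :: "'a::{finite, field} mat \<Rightarrow> rat"
  assumes "supported n f" "supported n g"
  shows "conv f g x = (\<Sum>y\<in>carrier_mat n n. \<Sum>z\<in>carrier_mat n n. if y * z = x then f y * g z else 0)"
proof -
  let ?C = "carrier_mat n n :: 'a mat set"
  have "conv f g x = (\<Sum>(y, z) \<in> ?C \<times> ?C. if y * z = x then f y * g z else 0)"
    unfolding conv_def
  proof (rule sum.mono_neutral_cong_left)
    show "finite (?C \<times> ?C)" by (intro finite_cartesian_product finite_carrier_mat)
    show "{(y, z). f y \<noteq> 0 \<and> g z \<noteq> 0 \<and> y * z = x} \<subseteq> ?C \<times> ?C"
      using assms unfolding supported_def by blast
  qed (auto split: if_splits)
  then show ?thesis by (simp add: sum.cartesian_product)
qed

lemma supported_conv: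
  fixes f g :: "'a::{finite, field} mat \<Rightarrow> rat"
  assumes "supported n f" "supported n g"
  shows "supported n (conv f g)"
  unfolding supported_def
proof (intro allI impI)
  fix x :: "'a mat" assume x: "x \<notin> carrier_mat n n"
  have "(if y * z = x then f y * g z else 0) = 0" if "y \<in> carrier_mat n n" "z \<in> carrier_mat n n" for y z
    using x mult_square[OF that] by auto
  then show "conv f g x = 0" unfolding conv_eq[OF assms] by (intro sum.neutral ballI)
qed

text \<open>Pairing with a test function \<open>F\<close> turns a convolution into a double sum
  without the side condition y z = x, so associativity of \<open>conv\<close> comes down to that of
  matrices.\<close>

lemma sum_conv_mult:
  fixes f g F :: "'a::{finite, field} mat \<Rightarrow> rat"
  assumes "supported n f" "supported n g"
  shows "(\<Sum>x\<in>carrier_mat n n. conv f g x * F x) =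
    (\<Sum>y\<in>carrier_mat n n. \<Sum>z\<in>carrier_mat n n. f y * g z * F (y * z))"
proof -
  let ?C = "carrier_mat n n :: 'a mat set"
  have "(\<Sum>x\<in>?C. conv f g x * F x) = (\<Sum>x\<in>?C. \<Sum>y\<in>?C. \<Sum>z\<in>?C. if y * z = x then f y * g z * F x else 0)"
    unfolding conv_eq[OF assms] sum_distrib_right by (intro sum.cong refl) auto
  also have "\<dots> = (\<Sum>y\<in>?C. \<Sum>x\<in>?C. \<Sum>z\<in>?C. if y * z = x then f y * g z * F x else 0)"
    by (rule sum.swap)
  also have "\<dots> = (\<Sum>y\<in>?C. \<Sum>z\<in>?C. \<Sum>x\<in>?C. if y * z = x then f y * g z * F x else 0)"
    by (rule sum.cong[OF refl]) (rule sum.swap)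
  also have "\<dots> = (\<Sum>y\<in>?C. \<Sum>z\<in>?C. f y * g z * F (y * z))"
  proof (intro sum.cong refl)
    fix y z assume "y \<in> ?C" "z \<in> ?C"
    then have "y * z \<in> ?C" by (rule mult_square)
    then show "(\<Sum>x\<in>?C. if y * z = x then f y * g z * F x else 0) = f y * g z * F (y * z)"
      using finite_carrier_mat by (subst sum.delta') auto
  qed
  finally show ?thesis .
qed

lemma conv_assoc:
  fixes f g h :: "'a::{finite, field} mat \<Rightarrow> rat"
  assumes f: "supported n f" and g: "supported n g" and h: "supported n h"
  shows "conv (conv f g) h = conv f (conv g h)"
proof
  fix x :: "'a mat"
  let ?C = "carrier_mat n n :: 'a mat set"
  \<comment> \<open>The value at x is the pairing of \<open>conv f g\<close> with the function that
    sends w to the sum of h z over all z with w z = x.\<close>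
  have "conv (conv f g) h x = (\<Sum>w\<in>?C. conv f g w * (\<Sum>z\<in>?C. if w * z = x then h z else 0))"
    unfolding conv_eq[OF supported_conv[OF f g] h] sum_distrib_left by (intro sum.cong refl) auto
  also have "\<dots> = (\<Sum>y\<in>?C. \<Sum>w\<in>?C. f y * g w * (\<Sum>z\<in>?C. if y * w * z = x then h z else 0))"
    by (rule sum_conv_mult[OF f g])
  also have "\<dots> = (\<Sum>y\<in>?C. f y * (\<Sum>w\<in>?C. \<Sum>z\<in>?C. g w * h z * (if y * (w * z) = x then 1 else 0)))"
    unfolding sum_distrib_left
  proof (intro sum.cong refl)
    fix y w z assume "y \<in> ?C" "w \<in> ?C" "z \<in> ?C"
    then have "y * (w * z) = y * w * z" by (rule assoc_square)
    then show "f y * g w * (if y * w * z = x then h z else 0) =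
      f y * (g w * h z * (if y * (w * z) = x then 1 else 0))" by simp
  qed
  also have "\<dots> = (\<Sum>y\<in>?C. f y * (\<Sum>z\<in>?C. conv g h z * (if y * z = x then 1 else 0)))"
    unfolding sum_conv_mult[OF g h] ..
  also have "\<dots> = conv f (conv g h) x"
    unfolding conv_eq[OF f supported_conv[OF g h]] sum_distrib_left by (intro sum.cong refl) auto
  finally show "conv (conv f g) h x = conv f (conv g h) x" .
qed

lemma supported_sum:
  "(\<And>i. i \<in> I \<Longrightarrow> supported n (f i)) \<Longrightarrow> supported n (\<lambda>x. \<Sum>i\<in>I. c i * f i x)"
  unfolding supported_def by (auto intro!: sum.neutral)

lemma supported_scale: "supported n f \<Longrightarrow> supported n (scale c f)"
  unfolding supported_def scale_def by simp

lemma conv_sum_right: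
  fixes f :: "'a::{finite, field} mat \<Rightarrow> rat"
  assumes f: "supported n f" and g: "\<And>i. i \<in> I \<Longrightarrow> supported n (g i)"
  shows "conv f (\<lambda>x. \<Sum>i\<in>I. c i * g i x) = (\<lambda>x. \<Sum>i\<in>I. c i * conv f (g i) x)"
proof
  fix x :: "'a mat"
  let ?C = "carrier_mat n n :: 'a mat set"
  have s: "supported n (\<lambda>x. \<Sum>i\<in>I. c i * g i x)" by (rule supported_sum[OF g])
  have "conv f (\<lambda>x. \<Sum>i\<in>I. c i * g i x) x =
      (\<Sum>y\<in>?C. \<Sum>z\<in>?C. \<Sum>i\<in>I. c i * (if y * z = x then f y * g i z else 0))"
    unfolding conv_eq[OF f s] by (intro sum.cong refl) (auto simp: sum_distrib_left mult_ac)
  also have "\<dots> = (\<Sum>y\<in>?C. \<Sum>i\<in>I. \<Sum>z\<in>?C. c i * (if y * z = x then f y * g i z else 0))"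
    by (rule sum.cong[OF refl]) (rule sum.swap)
  also have "\<dots> = (\<Sum>i\<in>I. \<Sum>y\<in>?C. \<Sum>z\<in>?C. c i * (if y * z = x then f y * g i z else 0))"
    by (rule sum.swap)
  also have "\<dots> = (\<Sum>i\<in>I. c i * conv f (g i) x)"
    using conv_eq[OF f g] by (intro sum.cong refl) (simp add: sum_distrib_left)
  finally show "conv f (\<lambda>x. \<Sum>i\<in>I. c i * g i x) x = (\<Sum>i\<in>I. c i * conv f (g i) x)" .
qed

text \<open>The linear extension of the anti-automorphism to functions. \<open>flip\<close> returns
  an n by n matrix for arguments of any size, so the value 0 outside \<open>carrier_mat n n\<close>
  is imposed separately.\<close>

definition flip_fun :: "nat \<Rightarrow> ('a mat \<Rightarrow> rat) \<Rightarrow> 'a mat \<Rightarrow> rat" where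
  "flip_fun n f = (\<lambda>x. if x \<in> carrier_mat n n then f (flip n x) else 0)"

lemma supported_flip_fun [simp]: "supported n (flip_fun n f)"
  by (simp add: supported_def flip_fun_def)

lemma flip_fun_flip_fun: "supported n f \<Longrightarrow> flip_fun n (flip_fun n f) = f"
  by (rule ext) (auto simp: supported_def flip_fun_def)

lemma sum_flip:
  fixes F :: "'a::{finite, field} mat \<Rightarrow> rat"
  shows "(\<Sum>x\<in>carrier_mat n n. F (flip n x)) = (\<Sum>x\<in>carrier_mat n n. F x)"
  by (rule sum.reindex_bij_witness[where i = "flip n" and j = "flip n"]) auto

lemma flip_eq_iff: "x \<in> carrier_mat n n \<Longrightarrow> y \<in> carrier_mat n n \<Longrightarrow> flip n x = flip n y \<longleftrightarrow> x = y"
  by (metis flip_flip)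

lemma flip_fun_conv:
  fixes f g :: "'a::{finite, field} mat \<Rightarrow> rat"
  assumes f: "supported n f" and g: "supported n g"
  shows "flip_fun n (conv f g) = conv (flip_fun n g) (flip_fun n f)"
proof
  fix x :: "'a mat"
  let ?C = "carrier_mat n n :: 'a mat set"
  show "flip_fun n (conv f g) x = conv (flip_fun n g) (flip_fun n f) x"
  proof (cases "x \<in> ?C")
    case False
    then show ?thesis
      using supported_conv[OF supported_flip_fun[of n g] supported_flip_fun[of n f]]
      by (simp add: flip_fun_def supported_def)
  next
    case x: True
    have "conv (flip_fun n g) (flip_fun n f) x =
        (\<Sum>y\<in>?C. \<Sum>z\<in>?C. if y * z = x then g (flip n y) * f (flip n z) else 0)"
      unfolding conv_eq[OF supported_flip_fun supported_flip_fun]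
      by (intro sum.cong refl) (simp add: flip_fun_def)
    also have "\<dots> = (\<Sum>y\<in>?C. \<Sum>z\<in>?C. if flip n z * flip n y = flip n x then g (flip n y) * f (flip n z) else 0)"
    proof (intro sum.cong refl)
      fix y z assume yz: "y \<in> ?C" "z \<in> ?C"
      have "flip n z * flip n y = flip n x \<longleftrightarrow> y * z = x"
        unfolding flip_mult[OF yz, symmetric] using mult_square[OF yz] x by (rule flip_eq_iff)
      then show "(if y * z = x then g (flip n y) * f (flip n z) else 0) =
        (if flip n z * flip n y = flip n x then g (flip n y) * f (flip n z) else 0)" by simp
    qed
    also have "\<dots> = (\<Sum>y\<in>?C. \<Sum>z\<in>?C. if z * flip n y = flip n x then g (flip n y) * f z else 0)"
      by (rule sum.cong[OF refl], rule sum_flip)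
    also have "\<dots> = (\<Sum>y\<in>?C. \<Sum>z\<in>?C. if z * y = flip n x then g y * f z else 0)"
      by (rule sum_flip[of "\<lambda>y. \<Sum>z\<in>?C. if z * y = flip n x then g y * f z else 0"])
    also have "\<dots> = (\<Sum>z\<in>?C. \<Sum>y\<in>?C. if z * y = flip n x then g y * f z else 0)"
      by (rule sum.swap)
    also have "\<dots> = flip_fun n (conv f g) x"
      using x by (simp add: flip_fun_def conv_eq[OF f g] mult.commute cong: if_cong)
    finally show ?thesis by simp
  qed
qed

section \<open>Averages over double cosets\<close>

lemma sum_unitriangular_mult:
  fixes F :: "'a::{finite, field} mat \<Rightarrow> rat"
  assumes a: "a \<in> unitriangulars n"
  shows "(\<Sum>u\<in>unitriangulars n. F (u * a)) = (\<Sum>u\<in>unitriangulars n. F u)"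
    and "(\<Sum>u\<in>unitriangulars n. F (a * u)) = (\<Sum>u\<in>unitriangulars n. F u)"
proof -
  obtain b where b: "b \<in> unitriangulars n" "a * b = 1\<^sub>m n" "b * a = 1\<^sub>m n"
    using unitriangular_inverse[OF a] by blast
  note c = unitriangulars_carrier[OF a] unitriangulars_carrier[OF b(1)]
  have r: "u * a * b = u" "u * b * a = u" "b * (a * u) = u" "a * (b * u) = u" if "u \<in> unitriangulars n" for u
    using unitriangulars_carrier[OF that] c b(2,3)
    by (simp_all only: assoc_mult_mat[where n\<^sub>1 = n and n\<^sub>2 = n] right_mult_one_mat
        assoc_square[where n = n] left_mult_one_mat)
  show "(\<Sum>u\<in>unitriangulars n. F (u * a)) = (\<Sum>u\<in>unitriangulars n. F u)"
    by (rule sum.reindex_bij_witness[where i = "\<lambda>u. u * b" and j = "\<lambda>u. u * a"])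
      (use r a b unitriangular_mult in auto)
  show "(\<Sum>u\<in>unitriangulars n. F (a * u)) = (\<Sum>u\<in>unitriangulars n. F u)"
    by (rule sum.reindex_bij_witness[where i = "\<lambda>u. b * u" and j = "\<lambda>u. a * u"])
      (use r a b unitriangular_mult in auto)
qed

text \<open>This is $[x] = e x e$.\<close>

definition coset_avg :: "nat \<Rightarrow> 'a::{finite, field} mat \<Rightarrow> 'a mat \<Rightarrow> rat" where
  "coset_avg n x = (\<lambda>m. (\<Sum>u\<in>unitriangulars n. \<Sum>v\<in>unitriangulars n. if u * x * v = m then 1 else 0)
     / of_nat (card (unitriangulars n :: 'a mat set)) ^ 2)"

lemma unitriangular_sandwich_carrier:
  "u \<in> unitriangulars n \<Longrightarrow> v \<in> unitriangulars n \<Longrightarrow> x \<in> carrier_mat n n \<Longrightarrow> u * x * v \<in> carrier_mat n n"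
  by (rule mult_square[OF mult_square]) (assumption | rule unitriangulars_carrier)+

lemma supported_coset_avg:
  fixes x :: "'a::{finite, field} mat"
  assumes x: "x \<in> carrier_mat n n" shows "supported n (coset_avg n x)"
  unfolding supported_def
proof (intro allI impI)
  fix m :: "'a mat" assume "m \<notin> carrier_mat n n"
  then have "(if u * x * v = m then 1 else 0 :: rat) = 0"
    if "u \<in> unitriangulars n" "v \<in> unitriangulars n" for u v
    using unitriangular_sandwich_carrier[OF that x] by auto
  then have "(\<Sum>u\<in>unitriangulars n. \<Sum>v\<in>unitriangulars n. if u * x * v = m then 1 else 0 :: rat) = 0"
    by (intro sum.neutral ballI)
  then show "coset_avg n x m = 0" unfolding coset_avg_def by simp
qed

lemma sum_coset_avg_mult:
  fixes x :: "'a::{finite, field} mat"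
  assumes x: "x \<in> carrier_mat n n"
  shows "(\<Sum>m\<in>carrier_mat n n. coset_avg n x m * F m) =
    (\<Sum>u\<in>unitriangulars n. \<Sum>v\<in>unitriangulars n. F (u * x * v))
      / of_nat (card (unitriangulars n :: 'a mat set)) ^ 2"
proof -
  let ?C = "carrier_mat n n :: 'a mat set" and ?U = "unitriangulars n :: 'a mat set"
  have "(\<Sum>m\<in>?C. coset_avg n x m * F m) =
      (\<Sum>m\<in>?C. \<Sum>u\<in>?U. \<Sum>v\<in>?U. if u * x * v = m then F m else 0) / of_nat (card ?U) ^ 2"
    unfolding coset_avg_def sum_divide_distrib[symmetric] times_divide_eq_left sum_distrib_right
    by (intro arg_cong2[where f = "(/)"] sum.cong refl) auto
  also have "(\<Sum>m\<in>?C. \<Sum>u\<in>?U. \<Sum>v\<in>?U. if u * x * v = m then F m else 0) =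
      (\<Sum>u\<in>?U. \<Sum>m\<in>?C. \<Sum>v\<in>?U. if u * x * v = m then F m else 0)"
    by (rule sum.swap)
  also have "\<dots> = (\<Sum>u\<in>?U. \<Sum>v\<in>?U. \<Sum>m\<in>?C. if u * x * v = m then F m else 0)"
    by (rule sum.cong[OF refl]) (rule sum.swap)
  also have "\<dots> = (\<Sum>u\<in>?U. \<Sum>v\<in>?U. F (u * x * v))"
  proof (intro sum.cong refl)
    fix u v assume "u \<in> ?U" "v \<in> ?U"
    then have "u * x * v \<in> ?C" using x by (intro unitriangular_sandwich_carrier)
    then show "(\<Sum>m\<in>?C. if u * x * v = m then F m else 0) = F (u * x * v)"
      using finite_carrier_mat by (subst sum.delta') auto
  qed
  finally show ?thesis .
qed

lemma coset_avg_mult: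
  fixes x :: "'a::{finite, field} mat"
  assumes a: "a \<in> unitriangulars n" and b: "b \<in> unitriangulars n" and x: "x \<in> carrier_mat n n"
  shows "coset_avg n (a * x * b) = coset_avg n x"
proof
  fix m
  let ?U = "unitriangulars n :: 'a mat set"
  let ?F = "\<lambda>u v. if u * x * v = m then 1 else 0 :: rat"
  have "(\<Sum>u\<in>?U. \<Sum>v\<in>?U. if u * (a * x * b) * v = m then 1 else 0 :: rat) =
      (\<Sum>u\<in>?U. \<Sum>v\<in>?U. ?F (u * a) (b * v))"
  proof (intro sum.cong refl)
    fix u v assume "u \<in> ?U" "v \<in> ?U"
    then have "u * (a * x * b) * v = u * a * x * (b * v)"
      using a b x by (simp only: square_mat_simps[where n = n])
    then show "(if u * (a * x * b) * v = m then 1 else 0) = ?F (u * a) (b * v)" by simp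
  qed
  also have "\<dots> = (\<Sum>u\<in>?U. \<Sum>v\<in>?U. ?F (u * a) v)"
    by (rule sum.cong[OF refl]) (rule sum_unitriangular_mult(2)[OF b])
  also have "\<dots> = (\<Sum>u\<in>?U. \<Sum>v\<in>?U. ?F u v)"
    by (rule sum_unitriangular_mult(1)[OF a, of "\<lambda>u. \<Sum>v\<in>?U. ?F u v"])
  finally show "coset_avg n (a * x * b) m = coset_avg n x m"
    unfolding coset_avg_def by simp
qed

text \<open>Translation invariance of sums over U makes the average constant on the double coset, it
  vanishes elsewhere, and its total mass is 1. This determines the constant without counting
  stabilisers.\<close>

lemma coset_avg_eq:
  fixes x :: "'a::{finite, field} mat"
  assumes x: "x \<in> carrier_mat n n"
  shows "coset_avg n x m = (if m \<in> double_coset n x then 1 / of_nat (card (double_coset n x)) else 0)"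
proof -
  let ?U = "unitriangulars n :: 'a mat set" and ?C = "carrier_mat n n :: 'a mat set"
  let ?D = "double_coset n x"
  have out: "coset_avg n x m = 0" if "m \<notin> ?D" for m
  proof -
    have "(if u * x * v = m then 1 else 0 :: rat) = 0" if "u \<in> ?U" "v \<in> ?U" for u v
      using double_cosetI[OF that, of x] \<open>m \<notin> ?D\<close> by auto
    then have "(\<Sum>u\<in>?U. \<Sum>v\<in>?U. if u * x * v = m then 1 else 0 :: rat) = 0"
      by (intro sum.neutral ballI)
    then show ?thesis unfolding coset_avg_def by simp
  qed
  have const: "coset_avg n x m = coset_avg n x x" if m: "m \<in> ?D" for m
  proof -
    obtain a b where ab: "a \<in> ?U" "b \<in> ?U" "m = a * x * b" using m by (rule double_cosetE)
    obtain a' where a': "a' \<in> ?U" "a' * a = 1\<^sub>m n" "a * a' = 1\<^sub>m n" using unitriangular_inverse[OF ab(1)] by blast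
    obtain b' where b': "b' \<in> ?U" "b * b' = 1\<^sub>m n" "b' * b = 1\<^sub>m n" using unitriangular_inverse[OF ab(2)] by blast
    note c = x unitriangulars_carrier[OF ab(1)] unitriangulars_carrier[OF ab(2)]
      unitriangulars_carrier[OF a'(1)] unitriangulars_carrier[OF b'(1)]
    have iff: "u * x * v = m \<longleftrightarrow> a' * u * x * (v * b') = x" if "u \<in> ?U" "v \<in> ?U" for u v
    proof -
      note c' = c unitriangulars_carrier[OF that(1)] unitriangulars_carrier[OF that(2)]
      have y: "u * x * v \<in> ?C" by (intro unitriangular_sandwich_carrier that x)
      have e: "a' * u * x * (v * b') = a' * (u * x * v) * b'"
        using c' by (simp only: assoc_square[where n = n] mult_square[where n = n])
      show ?thesis
      proof
        assume "u * x * v = m"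
        then have "a' * (u * x * v) * b' = (a' * a) * x * b * b'"
          using c by (simp only: ab(3) assoc_square[where n = n] mult_square[where n = n])
        also have "\<dots> = x * (b * b')" using c by (simp add: a'(2) assoc_mult_mat[where n\<^sub>2 = n])
        finally show "a' * u * x * (v * b') = x" using e x b'(2) by simp
      next
        assume "a' * u * x * (v * b') = x"
        then have "m = a * (a' * (u * x * v) * b') * b" using e ab(3) by simp
        also have "\<dots> = (a * a') * (u * x * v) * b' * b"
          using c y by (simp only: assoc_square[where n = n] mult_square[where n = n])
        also have "\<dots> = u * x * v * (b' * b)"
          unfolding a'(3) left_mult_one_mat[OF y] by (rule assoc_mult_mat[OF y c(5) c(3)])
        finally show "u * x * v = m" unfolding b'(3) right_mult_one_mat[OF y] by (rule sym)
      qed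
    qed
    let ?F = "\<lambda>u v. if u * x * v = x then 1 else 0 :: rat"
    have "(\<Sum>u\<in>?U. \<Sum>v\<in>?U. if u * x * v = m then 1 else 0 :: rat) = (\<Sum>u\<in>?U. \<Sum>v\<in>?U. ?F (a' * u) (v * b'))"
      by (intro sum.cong refl) (simp only: iff)
    also have "\<dots> = (\<Sum>u\<in>?U. \<Sum>v\<in>?U. ?F (a' * u) v)"
      by (rule sum.cong[OF refl]) (rule sum_unitriangular_mult(1)[OF b'(1)])
    also have "\<dots> = (\<Sum>u\<in>?U. \<Sum>v\<in>?U. ?F u v)"
      by (rule sum_unitriangular_mult(2)[OF a'(1), of "\<lambda>u. \<Sum>v\<in>?U. ?F u v"])
    finally show ?thesis unfolding coset_avg_def by simp
  qed
  have "(\<Sum>m\<in>?C. coset_avg n x m) = 1"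
    using sum_coset_avg_mult[OF x, of "\<lambda>_. 1"] card_unitriangulars_pos[where n = n and 'a = 'a]
    by (simp add: power2_eq_square)
  moreover have "(\<Sum>m\<in>?C. coset_avg n x m) = (\<Sum>m\<in>?D. coset_avg n x x)"
    by (rule sum.mono_neutral_cong_right)
      (use finite_carrier_mat double_coset_carrier[OF x] out const in auto)
  ultimately have "of_nat (card ?D) * coset_avg n x x = 1" by simp
  then have "coset_avg n x x = 1 / of_nat (card ?D)"
    using card_double_coset_pos[OF x] by (simp add: field_simps)
  then show ?thesis using out const by auto
qed

text \<open>Since e is idempotent, e x e e y e = e x e y e; expanding the middle e gives the average
  of [x w y] over w in U.\<close>

lemma conv_coset_avg:
  fixes x y :: "'a::{finite, field} mat"
  assumes x: "x \<in> carrier_mat n n" and y: "y \<in> carrier_mat n n"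
  shows "conv (coset_avg n x) (coset_avg n y) m =
    (\<Sum>w\<in>unitriangulars n. coset_avg n (x * w * y) m) / of_nat (card (unitriangulars n :: 'a mat set))"
proof -
  let ?U = "unitriangulars n :: 'a mat set" and ?C = "carrier_mat n n :: 'a mat set"
  let ?N = "of_nat (card ?U) :: rat"
  let ?I = "\<lambda>a. if a = m then 1 else 0 :: rat"
  have N: "?N \<noteq> 0" using card_unitriangulars_pos[where n = n and 'a = 'a] by simp
  have "conv (coset_avg n x) (coset_avg n y) m =
      (\<Sum>a\<in>?C. coset_avg n x a * (\<Sum>b\<in>?C. coset_avg n y b * ?I (a * b)))"
    unfolding conv_eq[OF supported_coset_avg[OF x] supported_coset_avg[OF y]] sum_distrib_left
    by (intro sum.cong refl) auto
  also have "\<dots> = (\<Sum>u\<in>?U. \<Sum>v\<in>?U. (\<Sum>u'\<in>?U. \<Sum>v'\<in>?U. ?I (u * x * v * (u' * y * v'))) / ?N ^ 2) / ?N ^ 2"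
    unfolding sum_coset_avg_mult[OF y] sum_coset_avg_mult[OF x] ..
  also have "(\<Sum>u\<in>?U. \<Sum>v\<in>?U. (\<Sum>u'\<in>?U. \<Sum>v'\<in>?U. ?I (u * x * v * (u' * y * v'))) / ?N ^ 2) =
      (\<Sum>u\<in>?U. \<Sum>v\<in>?U. (\<Sum>w\<in>?U. \<Sum>v'\<in>?U. ?I (u * (x * w * y) * v')) / ?N ^ 2)"
  proof (rule sum.cong[OF refl], rule sum.cong[OF refl], rule arg_cong[where f = "\<lambda>z. z / ?N ^ 2"])
    fix u v assume u: "u \<in> ?U" and v: "v \<in> ?U"
    have "(\<Sum>u'\<in>?U. \<Sum>v'\<in>?U. ?I (u * x * v * (u' * y * v'))) =
        (\<Sum>u'\<in>?U. \<Sum>v'\<in>?U. ?I (u * (x * (v * u') * y) * v'))"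
    proof (intro sum.cong refl)
      fix u' v' assume "u' \<in> ?U" "v' \<in> ?U"
      then have "u * x * v * (u' * y * v') = u * (x * (v * u') * y) * v'"
        using u v x y by (simp only: square_mat_simps[where n = n])
      then show "?I (u * x * v * (u' * y * v')) = ?I (u * (x * (v * u') * y) * v')" by simp
    qed
    also have "\<dots> = (\<Sum>w\<in>?U. \<Sum>v'\<in>?U. ?I (u * (x * w * y) * v'))"
      by (rule sum_unitriangular_mult(2)[OF v])
    finally show "(\<Sum>u'\<in>?U. \<Sum>v'\<in>?U. ?I (u * x * v * (u' * y * v'))) =
      (\<Sum>w\<in>?U. \<Sum>v'\<in>?U. ?I (u * (x * w * y) * v'))" .
  qed
  \<comment> \<open>The summand no longer depends on v, so the sum over v contributes one factor
    N.\<close>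
  also have "\<dots> / ?N ^ 2 = (\<Sum>u\<in>?U. \<Sum>w\<in>?U. \<Sum>v'\<in>?U. ?I (u * (x * w * y) * v')) / ?N ^ 3"
    using N by (simp add: sum_divide_distrib[symmetric] sum_distrib_left[symmetric] power2_eq_square power3_eq_cube field_simps)
  also have "(\<Sum>u\<in>?U. \<Sum>w\<in>?U. \<Sum>v'\<in>?U. ?I (u * (x * w * y) * v')) =
      (\<Sum>w\<in>?U. \<Sum>u\<in>?U. \<Sum>v'\<in>?U. ?I (u * (x * w * y) * v'))" by (rule sum.swap)
  also have "\<dots> / ?N ^ 3 = (\<Sum>w\<in>?U. coset_avg n (x * w * y) m) / ?N"
    using N by (simp add: coset_avg_def sum_divide_distrib[symmetric] power2_eq_square power3_eq_cube)
  finally show ?thesis .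
qed

subsection \<open>Product formulas\<close>

lemma T_elt_eq:
  fixes \<sigma> :: "'a::{finite, field} mat"
  assumes \<sigma>: "\<sigma> \<in> rooks n"
  shows "T_elt n \<sigma> = scale (of_nat CARD('a) ^ rook_length n \<sigma>) (coset_avg n \<sigma>)"
proof
  fix x
  let ?q = "of_nat CARD('a) :: rat"
  define r where "r = vec_space.rank n \<sigma>"
  define N where "N = r * (r - 1) div 2"
  have q: "?q \<noteq> 0" by simp
  have "even (r * (r - 1))" by (cases r) auto
  then have "2 * N = r * (r - 1)" unfolding N_def by simp
  \<comment> \<open>The exponent is -N, so the normalisation cancels the factor q^N in the size of
    the double coset and leaves q^l with l the length.\<close>
  then have "int r * (1 - int r) = 2 * - int N"
    by (cases r) (auto simp: algebra_simps simp flip: of_nat_mult of_nat_add)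
  then have "(int r * (1 - int r)) div 2 = - int N" by simp
  then have "?q powi ((int r * (1 - int r)) div 2) = 1 / ?q ^ N"
    by (simp add: power_int_minus inverse_eq_divide)
  moreover have "coset_avg n \<sigma> x = (if x \<in> double_coset n \<sigma> then 1 / (?q ^ rook_length n \<sigma> * ?q ^ N) else 0)"
    unfolding coset_avg_eq[OF rooks_carrier[OF \<sigma>]] card_double_coset_rook[OF \<sigma>]
    by (simp add: N_def r_def power_add)
  ultimately show "T_elt n \<sigma> x = scale (?q ^ rook_length n \<sigma>) (coset_avg n \<sigma>) x"
    using q by (simp add: T_elt_def Let_def scale_def flip: r_def)
qed

lemma scale_scale: "scale a (scale b f) = scale (a * b) f"
  by (simp add: scale_def mult.assoc)

lemma scale_1: "scale 1 f = f"
  by (simp add: scale_def)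

lemma supported_T_elt:
  fixes \<sigma> :: "'a::{finite, field} mat"
  shows "\<sigma> \<in> rooks n \<Longrightarrow> supported n (T_elt n \<sigma>)"
  by (simp add: T_elt_eq supported_scale supported_coset_avg rooks_carrier)

lemma flip_fun_T_elt:
  fixes \<sigma> :: "'a::{finite, field} mat"
  assumes \<sigma>: "\<sigma> \<in> rooks n"
  shows "flip_fun n (T_elt n \<sigma>) = T_elt n (flip n \<sigma>)"
proof
  fix x :: "'a mat"
  note c = rooks_carrier[OF \<sigma>]
  have "flip n x \<in> double_coset n \<sigma> \<longleftrightarrow> x \<in> double_coset n (flip n \<sigma>)" if x: "x \<in> carrier_mat n n"
  proof
    assume "flip n x \<in> double_coset n \<sigma>"
    then have "flip n (flip n x) \<in> flip n ` double_coset n \<sigma>" by (rule imageI)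
    then show "x \<in> double_coset n (flip n \<sigma>)" using x flip_double_coset[OF c] by simp
  next
    assume "x \<in> double_coset n (flip n \<sigma>)"
    then obtain y where "y \<in> double_coset n \<sigma>" "x = flip n y" unfolding flip_double_coset[OF c] by blast
    then show "flip n x \<in> double_coset n \<sigma>" using double_coset_carrier[OF c] by auto
  qed
  moreover have "x \<notin> double_coset n (flip n \<sigma>)" if "x \<notin> carrier_mat n n"
    using double_coset_carrier[OF flip_carrier[of n \<sigma>]] that by blast
  ultimately show "flip_fun n (T_elt n \<sigma>) x = T_elt n (flip n \<sigma>) x"
    unfolding flip_fun_def T_elt_def Let_def scale_def rank_flip[OF \<sigma>] by auto
qed

lemma conv_scale:
  fixes f g :: "'a::{finite, field} mat \<Rightarrow> rat"
  assumes f: "supported n f" and g: "supported n g"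
  shows "conv (scale a f) (scale b g) = scale (a * b) (conv f g)"
  unfolding fun_eq_iff scale_def[of "a * b"] conv_eq[OF supported_scale[OF f] supported_scale[OF g]] conv_eq[OF f g]
  by (auto simp: scale_def sum_distrib_left intro!: sum.cong)

text \<open>The case in which all products \<sigma> w \<tau> have the same average, so that the
  average over w is trivial. It applies when w can be moved out to the left, as for torus elements
  and \<nu>.\<close>

lemma conv_T_elt:
  fixes \<sigma> \<tau> :: "'a::{finite, field} mat"
  assumes \<sigma>: "\<sigma> \<in> rooks n" and \<tau>: "\<tau> \<in> rooks n"
    and eq: "\<And>w. w \<in> unitriangulars n \<Longrightarrow> coset_avg n (\<sigma> * w * \<tau>) = f"
  shows "conv (T_elt n \<sigma>) (T_elt n \<tau>) = scale (of_nat CARD('a) ^ (rook_length n \<sigma> + rook_length n \<tau>)) f"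
proof -
  note c = rooks_carrier[OF \<sigma>] rooks_carrier[OF \<tau>]
  have "conv (coset_avg n \<sigma>) (coset_avg n \<tau>) = f"
    unfolding fun_eq_iff conv_coset_avg[OF c]
    using eq card_unitriangulars_pos[where n = n and 'a = 'a] by simp
  then show ?thesis
    unfolding T_elt_eq[OF \<sigma>] T_elt_eq[OF \<tau>] conv_scale[OF supported_coset_avg[OF c(1)] supported_coset_avg[OF c(2)]]
    by (simp add: power_add)
qed

lemma rook_length_one: "rook_length n (1\<^sub>m n :: 'a::{finite, field} mat) = 0"
  using rook_length_nu_pow[of n 0, where 'a = 'a] by simp

lemma rook_length_torus:
  fixes t :: "'a::{finite, field} mat"
  shows "t \<in> torus n \<Longrightarrow> rook_length n t = 0"
  using rook_length_torus_mult[OF one_rook, of t n] rook_length_one[of n, where 'a = 'a]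
  by (simp add: right_mult_one_mat[OF torus_carrier])

lemma rook_length_nu: "rook_length n (nu n :: 'a::{finite, field} mat) = 0"
  using rook_length_nu_pow[of n 1, where 'a = 'a] by (simp add: left_mult_one_mat[OF nu_carrier])

lemma T_elt_torus_mult:
  fixes \<sigma> :: "'a::{finite, field} mat"
  assumes t: "t \<in> torus n" and \<sigma>: "\<sigma> \<in> rooks n"
  shows "conv (T_elt n t) (T_elt n \<sigma>) = T_elt n (t * \<sigma>)"
proof -
  note c = torus_carrier[OF t] rooks_carrier[OF \<sigma>]
  have "conv (T_elt n t) (T_elt n \<sigma>) =
      scale (of_nat CARD('a) ^ (rook_length n t + rook_length n \<sigma>)) (coset_avg n (t * \<sigma>))"
  proof (rule conv_T_elt[OF torus_rook[OF t] \<sigma>])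
    fix w :: "'a mat" assume w: "w \<in> unitriangulars n"
    obtain w' where w': "w' \<in> unitriangulars n" "t * w = w' * t" using torus_unitriangular[OF t w] by blast
    have "t * w * \<sigma> = w' * (t * \<sigma>) * 1\<^sub>m n"
      unfolding right_mult_one_mat[OF mult_square[OF unitriangulars_carrier[OF w'(1)] mult_square[OF c]]]
      using c unitriangulars_carrier[OF w'(1)] w'(2)
      by (simp only: assoc_square[where n = n] mult_square[where n = n])
    then show "coset_avg n (t * w * \<sigma>) = coset_avg n (t * \<sigma>)"
      using coset_avg_mult[OF w'(1) one_unitriangular mult_square[OF c]] by simp
  qed
  then show ?thesis
    by (simp add: T_elt_eq[OF torus_mult_rook[OF t \<sigma>]] rook_length_torus[OF t] rook_length_torus_mult[OF \<sigma> t])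
qed

text \<open>As \<nu> has length 0, the scalar on the left is q^{\<ell>(\<sigma>)}, and passing from
  [\<nu>\<sigma>] to T_{\<nu>\<sigma>} divides by q^{\<ell>(\<nu>\<sigma>)}. The exponent is an
  integer difference here; its sign is settled by \<open>rook_length_nu_mult_le\<close>.\<close>

lemma T_elt_nu_mult:
  fixes \<sigma> :: "'a::{finite, field} mat"
  assumes \<sigma>: "\<sigma> \<in> rooks n"
  shows "conv (T_elt n (nu n)) (T_elt n \<sigma>) =
    scale (of_nat CARD('a) powi (int (rook_length n \<sigma>) - int (rook_length n (nu n * \<sigma>)))) (T_elt n (nu n * \<sigma>))"
proof -
  note c = nu_carrier[of n] rooks_carrier[OF \<sigma>]
  have "conv (T_elt n (nu n)) (T_elt n \<sigma>) =
      scale (of_nat CARD('a) ^ (rook_length n (nu n :: 'a mat) + rook_length n \<sigma>)) (coset_avg n (nu n * \<sigma>))"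
  proof (rule conv_T_elt[OF nu_rook \<sigma>])
    fix w :: "'a mat" assume w: "w \<in> unitriangulars n"
    obtain w' where w': "w' \<in> unitriangulars n" "nu n * w = w' * nu n" using nu_unitriangular[OF w] by blast
    have "nu n * w * \<sigma> = w' * (nu n * \<sigma>) * 1\<^sub>m n"
      unfolding right_mult_one_mat[OF mult_square[OF unitriangulars_carrier[OF w'(1)] mult_square[OF c]]]
      using c unitriangulars_carrier[OF w'(1)] w'(2)
      by (simp only: assoc_square[where n = n] mult_square[where n = n] nu_carrier)
    then show "coset_avg n (nu n * w * \<sigma>) = coset_avg n (nu n * \<sigma>)"
      using coset_avg_mult[OF w'(1) one_unitriangular mult_square[OF c]] by simp
  qed
  then show ?thesis
    by (simp add: T_elt_eq[OF nu_mult_rook[OF \<sigma>]] rook_length_nu scale_scale power_int_diff)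
qed

text \<open>[s_k w \<sigma>] depends only on the entry w_{k,k+1}. That this entry is equidistributed
  in the field is obtained by translating U by x_k(b) and averaging over b, in place of counting
  fibres.\<close>

lemma sum_elem_mat_shift:
  fixes \<sigma> :: "'a::{finite, field} mat"
  assumes \<sigma>: "\<sigma> \<in> rooks n" and k: "Suc k < n"
  shows "conv (coset_avg n (simple_refl n k)) (coset_avg n \<sigma>) m =
    (\<Sum>b\<in>UNIV. coset_avg n (simple_refl n k * (elem_mat n k (Suc k) b * \<sigma>)) m) / of_nat CARD('a)"
proof -
  let ?s = "simple_refl n k :: 'a mat" and ?x = "elem_mat n k (Suc k) :: 'a \<Rightarrow> 'a mat"
  let ?U = "unitriangulars n :: 'a mat set"
  let ?G = "\<lambda>b. coset_avg n (?s * (?x b * \<sigma>)) m"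
  note c = rooks_carrier[OF \<sigma>]
  have xU: "?x a \<in> ?U" for a by (rule elem_mat_unitriangular) simp
  have N: "(of_nat (card ?U) :: rat) \<noteq> 0" using card_unitriangulars_pos[where n = n and 'a = 'a] by simp
  have G: "coset_avg n (?s * w * \<sigma>) m = ?G (w $$ (k, Suc k))" if w: "w \<in> ?U" for w
  proof -
    obtain u where u: "u \<in> ?U" "?s * w = u * ?s * ?x (w $$ (k, Suc k))"
      using unitriangular_refl_factor[OF w k] by blast
    have cx: "?s * (?x (w $$ (k, Suc k)) * \<sigma>) \<in> carrier_mat n n"
      by (intro mult_square simple_refl_carrier elem_mat_carrier c)
    have "?s * w * \<sigma> = u * (?s * (?x (w $$ (k, Suc k)) * \<sigma>)) * 1\<^sub>m n"
      unfolding u(2) right_mult_one_mat[OF mult_square[OF unitriangulars_carrier[OF u(1)] cx]]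
      using c unitriangulars_carrier[OF u(1)]
      by (simp only: assoc_square[where n = n] mult_square[where n = n] simple_refl_carrier elem_mat_carrier)
    then show ?thesis using coset_avg_mult[OF u(1) one_unitriangular cx] by simp
  qed
  have S: "(\<Sum>w\<in>?U. coset_avg n (?s * w * \<sigma>) m) = (\<Sum>w\<in>?U. ?G (w $$ (k, Suc k) + b))" for b
  proof -
    have "(\<Sum>w\<in>?U. coset_avg n (?s * w * \<sigma>) m) = (\<Sum>w\<in>?U. coset_avg n (?s * (w * ?x b) * \<sigma>) m)"
      by (rule sum_unitriangular_mult(1)[OF xU, symmetric])
    also have "\<dots> = (\<Sum>w\<in>?U. ?G (w $$ (k, Suc k) + b))"
    proof (rule sum.cong[OF refl])
      fix w assume w: "w \<in> ?U"
      have "(w * ?x b) $$ (k, Suc k) = w $$ (k, Suc k) + b"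
        using k unitriangular_diag[OF w, of k] by (simp add: elem_mat_mult_right[OF unitriangulars_carrier[OF w]])
      then show "coset_avg n (?s * (w * ?x b) * \<sigma>) m = ?G (w $$ (k, Suc k) + b)"
        using G[OF unitriangular_mult[OF w xU]] by simp
    qed
    finally show ?thesis .
  qed
  \<comment> \<open>By \<open>S\<close> the sum may be shifted by any b; adding up over all b lets
    w_{k,k+1} + b run through the field once for each w.\<close>
  have "of_nat CARD('a) * (\<Sum>w\<in>?U. coset_avg n (?s * w * \<sigma>) m) =
      (\<Sum>b\<in>(UNIV :: 'a set). \<Sum>w\<in>?U. coset_avg n (?s * w * \<sigma>) m)" by simp
  also have "\<dots> = (\<Sum>b\<in>UNIV. \<Sum>w\<in>?U. ?G (w $$ (k, Suc k) + b))" by (rule sum.cong[OF refl]) (rule S)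
  also have "\<dots> = (\<Sum>w\<in>?U. \<Sum>b\<in>UNIV. ?G (w $$ (k, Suc k) + b))" by (rule sum.swap)
  also have "\<dots> = (\<Sum>w\<in>?U. \<Sum>b\<in>UNIV. ?G b)"
  proof (rule sum.cong[OF refl])
    fix w :: "'a mat"
    show "(\<Sum>b\<in>UNIV. ?G (w $$ (k, Suc k) + b)) = (\<Sum>b\<in>UNIV. ?G b)"
      by (rule sum.reindex_bij_witness[where i = "\<lambda>b. b - w $$ (k, Suc k)" and j = "\<lambda>b. w $$ (k, Suc k) + b"]) auto
  qed
  also have "\<dots> = of_nat (card ?U) * (\<Sum>b\<in>UNIV. ?G b)" by simp
  finally show ?thesis
    unfolding conv_coset_avg[OF simple_refl_carrier c] using N by (simp add: field_simps)
qed

lemma rook_length_simple_refl: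
  assumes k: "Suc k < n"
  shows "rook_length n (simple_refl n k :: 'a::{finite, field} mat) = 1"
proof -
  have "\<not> desc n k (1\<^sub>m n :: 'a mat)" using k by (auto simp: desc_def)
  moreover have "simple_refl n k * 1\<^sub>m n \<noteq> (1\<^sub>m n :: 'a mat)"
    unfolding simple_refl_mult_eq_iff[OF one_rook k] using k by (auto intro!: exI[of _ k])
  ultimately have "rook_length n (simple_refl n k * 1\<^sub>m n :: 'a mat) = Suc (rook_length n (1\<^sub>m n :: 'a mat))"
    by (rule rook_length_not_desc[OF one_rook k])
  then show ?thesis by (simp add: right_mult_one_mat[OF simple_refl_carrier] rook_length_one)
qed

lemma conv_T_elt_simple_refl:
  fixes \<sigma> :: "'a::{finite, field} mat"
  assumes \<sigma>: "\<sigma> \<in> rooks n" and k: "Suc k < n"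
  shows "conv (T_elt n (simple_refl n k)) (T_elt n \<sigma>) =
    (\<lambda>m. of_nat CARD('a) ^ rook_length n \<sigma> *
      (\<Sum>b\<in>UNIV. coset_avg n (simple_refl n k * (elem_mat n k (Suc k) b * \<sigma>)) m))"
  unfolding T_elt_eq[OF \<sigma>] T_elt_eq[OF simple_refl_rook[OF k]] rook_length_simple_refl[OF k]
    conv_scale[OF supported_coset_avg[OF simple_refl_carrier] supported_coset_avg[OF rooks_carrier[OF \<sigma>]]]
  unfolding scale_def sum_elem_mat_shift[OF \<sigma> k] by (simp add: field_simps)

lemma T_elt_simple_refl_not_desc:
  fixes \<sigma> :: "'a::{finite, field} mat"
  assumes \<sigma>: "\<sigma> \<in> rooks n" and k: "Suc k < n" and nd: "\<not> desc n k \<sigma>"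
  shows "conv (T_elt n (simple_refl n k)) (T_elt n \<sigma>) =
    scale (of_nat CARD('a) ^ Suc (rook_length n \<sigma>)) (coset_avg n (simple_refl n k * \<sigma>))"
proof -
  let ?s = "simple_refl n k :: 'a mat"
  note c = rooks_carrier[OF \<sigma>]
  have cs: "?s * \<sigma> \<in> carrier_mat n n" by (rule mult_square[OF simple_refl_carrier c])
  have "coset_avg n (?s * (elem_mat n k (Suc k) b * \<sigma>)) = coset_avg n (?s * \<sigma>)" for b
  proof -
    obtain v where v: "v \<in> unitriangulars n" "elem_mat n k (Suc k) b * \<sigma> = \<sigma> * v"
      using not_desc_elem_mat[OF \<sigma> k nd] by blast
    have "?s * (elem_mat n k (Suc k) b * \<sigma>) = 1\<^sub>m n * (?s * \<sigma>) * v"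
      unfolding v(2) left_mult_one_mat[OF cs]
      by (rule assoc_square[OF simple_refl_carrier c unitriangulars_carrier[OF v(1)]])
    then show ?thesis using coset_avg_mult[OF one_unitriangular v(1) cs] by simp
  qed
  then show ?thesis unfolding conv_T_elt_simple_refl[OF \<sigma> k] by (simp add: scale_def mult_ac)
qed

lemma T_elt_simple_refl_fixed:
  fixes \<sigma> :: "'a::{finite, field} mat"
  assumes \<sigma>: "\<sigma> \<in> rooks n" and k: "Suc k < n" and eq: "simple_refl n k * \<sigma> = \<sigma>"
  shows "conv (T_elt n (simple_refl n k)) (T_elt n \<sigma>) = scale (of_nat CARD('a)) (T_elt n \<sigma>)"
proof -
  have "\<not> desc n k \<sigma>" using desc_simple_refl_neq[OF \<sigma> k] eq by blast
  from T_elt_simple_refl_not_desc[OF \<sigma> k this] show ?thesis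
    unfolding eq T_elt_eq[OF \<sigma>] scale_scale by simp
qed

lemma T_elt_simple_refl_up:
  fixes \<sigma> :: "'a::{finite, field} mat"
  assumes \<sigma>: "\<sigma> \<in> rooks n" and k: "Suc k < n" and nd: "\<not> desc n k \<sigma>" and neq: "simple_refl n k * \<sigma> \<noteq> \<sigma>"
  shows "conv (T_elt n (simple_refl n k)) (T_elt n \<sigma>) = T_elt n (simple_refl n k * \<sigma>)"
  unfolding T_elt_simple_refl_not_desc[OF \<sigma> k nd] T_elt_eq[OF simple_refl_mult_rook[OF k \<sigma>]]
    rook_length_not_desc[OF \<sigma> k nd neq] ..

text \<open>The summand b = 0 is q^{\<ell>(\<sigma>)} [s_k \<sigma>], which is q T_{s_k \<sigma>}
  because s_k \<sigma> is shorter by one. A summand b \<noteq> 0 is T_{h_k(b) \<sigma>}, as torus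
  factors keep the length.\<close>

lemma T_elt_simple_refl_desc:
  fixes \<sigma> :: "'a::{finite, field} mat"
  assumes \<sigma>: "\<sigma> \<in> rooks n" and k: "Suc k < n" and d: "desc n k \<sigma>"
  shows "conv (T_elt n (simple_refl n k)) (T_elt n \<sigma>) =
    (\<lambda>x. of_nat CARD('a) * T_elt n (simple_refl n k * \<sigma>) x + (\<Sum>r\<in>UNIV - {0}. T_elt n (h_mat n k r * \<sigma>) x))"
proof
  fix m
  let ?s = "simple_refl n k :: 'a mat" and ?x = "elem_mat n k (Suc k) :: 'a \<Rightarrow> 'a mat"
  let ?q = "of_nat CARD('a) :: rat"
  note c = rooks_carrier[OF \<sigma>]
  have h: "?q ^ rook_length n \<sigma> * coset_avg n (?s * (?x b * \<sigma>)) m = T_elt n (h_mat n k b * \<sigma>) m" if b: "b \<noteq> 0" for b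
  proof -
    obtain u v where uv: "u \<in> unitriangulars n" "v \<in> unitriangulars n"
      "?s * (?x b * \<sigma>) = u * (h_mat n k b * \<sigma>) * v"
      using desc_elem_mat[OF \<sigma> k d b] by blast
    have hr: "h_mat n k b * \<sigma> \<in> rooks n" by (rule torus_mult_rook[OF h_mat_torus[OF b] \<sigma>])
    have "coset_avg n (?s * (?x b * \<sigma>)) = coset_avg n (h_mat n k b * \<sigma>)"
      unfolding uv(3) by (rule coset_avg_mult[OF uv(1,2) rooks_carrier[OF hr]])
    then show ?thesis
      unfolding T_elt_eq[OF hr] rook_length_torus_mult[OF \<sigma> h_mat_torus[OF b]] by (simp add: scale_def)
  qed
  have z: "?q ^ rook_length n \<sigma> * coset_avg n (?s * (?x 0 * \<sigma>)) m = ?q * T_elt n (?s * \<sigma>) m"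
    unfolding elem_mat_0 left_mult_one_mat[OF c] T_elt_eq[OF simple_refl_mult_rook[OF k \<sigma>]]
      rook_length_desc[OF \<sigma> k d] by (simp add: scale_def mult.assoc)
  have "conv (T_elt n ?s) (T_elt n \<sigma>) m = (\<Sum>b\<in>UNIV. ?q ^ rook_length n \<sigma> * coset_avg n (?s * (?x b * \<sigma>)) m)"
    unfolding conv_T_elt_simple_refl[OF \<sigma> k] by (simp add: sum_distrib_left)
  also have "\<dots> = ?q * T_elt n (?s * \<sigma>) m + (\<Sum>b\<in>UNIV - {0}. ?q ^ rook_length n \<sigma> * coset_avg n (?s * (?x b * \<sigma>)) m)"
    using sum.remove[of "UNIV :: 'a set" 0 "\<lambda>b. ?q ^ rook_length n \<sigma> * coset_avg n (?s * (?x b * \<sigma>)) m"] z by simp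
  also have "(\<Sum>b\<in>UNIV - {0}. ?q ^ rook_length n \<sigma> * coset_avg n (?s * (?x b * \<sigma>)) m) =
      (\<Sum>r\<in>UNIV - {0}. T_elt n (h_mat n k r * \<sigma>) m)"
    by (rule sum.cong[OF refl]) (use h in auto)
  finally show "conv (T_elt n ?s) (T_elt n \<sigma>) m =
    ?q * T_elt n (?s * \<sigma>) m + (\<Sum>r\<in>UNIV - {0}. T_elt n (h_mat n k r * \<sigma>) m)" .
qed

section \<open>Length under multiplication by the shift\<close>

lemma rook_length_simple_refl_mult_le:
  fixes \<sigma> :: "'a::{finite, field} mat"
  assumes \<sigma>: "\<sigma> \<in> rooks n" and k: "Suc k < n"
  shows "rook_length n (simple_refl n k * \<sigma>) \<le> Suc (rook_length n \<sigma>)"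
proof (cases "desc n k \<sigma>")
  case True
  then show ?thesis using rook_length_desc[OF \<sigma> k] by simp
next
  case False
  then show ?thesis using rook_length_not_desc[OF \<sigma> k] by (cases "simple_refl n k * \<sigma> = \<sigma>") simp_all
qed

lemma rook_length_mult_simple_refl:
  fixes \<sigma> :: "'a::{finite, field} mat"
  assumes \<sigma>: "\<sigma> \<in> rooks n" and k: "Suc k < n"
  shows "rook_length n (\<sigma> * simple_refl n k) = rook_length n (simple_refl n (n - 2 - k) * flip n \<sigma>)"
  unfolding flip_mult_simple_refl[OF rooks_carrier[OF \<sigma>] k, symmetric]
  by (rule rook_length_flip[OF mult_simple_refl_rook[OF k \<sigma>], symmetric])

lemma mult_simple_refl_cancel:
  assumes "Suc k < n" "A \<in> carrier_mat n n"
  shows "A * simple_refl n k * simple_refl n k = A"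
  unfolding assoc_mult_mat[OF assms(2) simple_refl_carrier simple_refl_carrier] simple_refl_square[OF assms(1)]
  by (rule right_mult_one_mat[OF assms(2)])

text \<open>Row i of \<nu> A is row i + 1 of A, so the index of the reflection drops by one. Index 0
  has no such partner, which is why the next induction sets it apart.\<close>

lemma nu_mult_simple_refl:
  fixes A :: "'a::field mat"
  assumes k: "Suc (Suc k) < n" and A: "A \<in> carrier_mat n n"
  shows "nu n * (simple_refl n (Suc k) * A) = simple_refl n k * (nu n * A)"
proof (rule eq_matI)
  have k': "Suc k < n" using k by simp
  have sA: "simple_refl n (Suc k) * A \<in> carrier_mat n n" by (rule mult_square[OF simple_refl_carrier A])
  have nA: "nu n * A \<in> carrier_mat n n" by (rule mult_square[OF nu_carrier A])
  fix i j assume "i < dim_row (simple_refl n k * (nu n * A))" "j < dim_col (simple_refl n k * (nu n * A))"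
  then have ij: "i < n" "j < n" using A by auto
  have sw: "Suc (swap k i) = swap (Suc k) (Suc i)" by (auto simp: Transposition.transpose_def)
  show "(nu n * (simple_refl n (Suc k) * A)) $$ (i, j) = (simple_refl n k * (nu n * A)) $$ (i, j)"
  proof (cases "Suc i < n")
    case True
    then have "Suc (swap k i) < n" unfolding sw by (rule swap_less[OF k])
    then show ?thesis using True ij swap_less[OF k' ij(1)]
      by (simp add: nu_mult_left[OF sA] simple_refl_mult_left[OF k A] simple_refl_mult_left[OF k' nA]
          nu_mult_left[OF A] sw del: Suc_less_eq)
  next
    case False
    then have "swap k i = i" using k by (auto simp: Transposition.transpose_def)
    then show ?thesis using False ij
      by (simp add: nu_mult_left[OF sA] simple_refl_mult_left[OF k' nA] nu_mult_left[OF A])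
  qed
qed (use A in auto)

text \<open>Multiplication by $\nu$ shifts the rows up.  Descents on the right, and on the left at all
  positions but the first, are removed compatibly; if there are none, $\nu \sigma$ has no
  descents at all.\<close>

lemma rook_length_nu_mult_le:
  fixes \<sigma> :: "'a::{finite, field} mat"
  assumes "\<sigma> \<in> rooks n"
  shows "rook_length n (nu n * \<sigma>) \<le> rook_length n \<sigma>"
  using assms
proof (induction "rook_length n \<sigma>" arbitrary: \<sigma> rule: less_induct)
  case less
  note \<sigma> = less.prems
  note c = rooks_carrier[OF \<sigma>]
  show ?case
  proof (cases "\<exists>k. Suc k < n \<and> desc n k (flip n \<sigma>)")
    case True
    then obtain k' where k': "Suc k' < n" "desc n k' (flip n \<sigma>)" by blast
    define k where "k = n - 2 - k'"
    have k: "Suc k < n" "n - 2 - k = k'" using k' by (auto simp: k_def)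
    define \<tau> where "\<tau> = \<sigma> * simple_refl n k"
    have \<tau>: "\<tau> \<in> rooks n" unfolding \<tau>_def by (rule mult_simple_refl_rook[OF k(1) \<sigma>])
    have len: "rook_length n \<sigma> = Suc (rook_length n \<tau>)"
      unfolding \<tau>_def rook_length_mult_simple_refl[OF \<sigma> k(1)] k(2)
      using rook_length_desc[OF flip_rooks[OF \<sigma>] k'] rook_length_flip[OF \<sigma>] by simp
    have "\<sigma> = \<tau> * simple_refl n k" unfolding \<tau>_def by (rule mult_simple_refl_cancel[OF k(1) c, symmetric])
    then have "nu n * \<sigma> = nu n * \<tau> * simple_refl n k"
      using assoc_square[OF nu_carrier rooks_carrier[OF \<tau>] simple_refl_carrier] by simp
    \<comment> \<open>Removing the descent shortens \<sigma> by exactly one, while putting the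
      reflection back lengthens \<nu> \<tau> by at most one.\<close>
    moreover have "rook_length n (nu n * \<tau> * simple_refl n k) \<le> Suc (rook_length n (nu n * \<tau>))"
      unfolding rook_length_mult_simple_refl[OF nu_mult_rook[OF \<tau>] k(1)] k(2)
      using rook_length_simple_refl_mult_le[OF flip_rooks[OF nu_mult_rook[OF \<tau>]] k'(1)]
        rook_length_flip[OF nu_mult_rook[OF \<tau>]] by simp
    ultimately show ?thesis using less.hyps[OF _ \<tau>] len by simp
  next
    case no_right: False
    show ?thesis
    proof (cases "\<exists>k. Suc (Suc k) < n \<and> desc n (Suc k) \<sigma>")
      case True
      then obtain k where k: "Suc (Suc k) < n" "desc n (Suc k) \<sigma>" by blast
      then have k': "Suc k < n" by simp
      define \<tau> where "\<tau> = simple_refl n (Suc k) * \<sigma>"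
      have \<tau>: "\<tau> \<in> rooks n" unfolding \<tau>_def by (rule simple_refl_mult_rook[OF k(1) \<sigma>])
      have len: "rook_length n \<sigma> = Suc (rook_length n \<tau>)"
        unfolding \<tau>_def by (rule rook_length_desc[OF \<sigma> k])
      have "\<sigma> = simple_refl n (Suc k) * \<tau>"
        unfolding \<tau>_def by (rule simple_refl_cancel[OF k(1) c, symmetric])
      then have "nu n * \<sigma> = simple_refl n k * (nu n * \<tau>)"
        using nu_mult_simple_refl[OF k(1) rooks_carrier[OF \<tau>]] by simp
      then show ?thesis
        using rook_length_simple_refl_mult_le[OF nu_mult_rook[OF \<tau>] k'] less.hyps[OF _ \<tau>] len by simp
    next
      case no_left: False
      \<comment> \<open>A descent at index 0 may survive in \<sigma>, but it compares rows 0 and 1,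
        and row 0 is lost in \<nu> \<sigma>.\<close>
      have "rook_length n (nu n * \<sigma>) = 0"
      proof (rule rook_length_reduced[OF nu_mult_rook[OF \<sigma>]])
        fix k assume k: "Suc k < n"
        show "\<not> desc n k (nu n * \<sigma>)"
          unfolding not_desc_iff
        proof (intro allI impI)
          fix j assume j: "j < n" "(nu n * \<sigma>) $$ (Suc k, j) \<noteq> 0"
          then have k2: "Suc (Suc k) < n" "\<sigma> $$ (Suc (Suc k), j) \<noteq> 0"
            using k by (auto simp: nu_mult_left[OF c] split: if_splits)
          then obtain j' where "j' < j" "\<sigma> $$ (Suc k, j') \<noteq> 0"
            using no_left j not_desc_iff[of n "Suc k" \<sigma>] by blast
          then show "\<exists>j'<j. (nu n * \<sigma>) $$ (k, j') \<noteq> 0"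
            using k j by (intro exI[of _ j']) (simp add: nu_mult_left[OF c])
        qed
      next
        have R: "\<exists>i'. i < i' \<and> i' < n \<and> \<sigma> $$ (i', Suc j) \<noteq> 0"
          if "i < n" "Suc j < n" "\<sigma> $$ (i, j) \<noteq> 0" for i j
          using no_right that not_desc_flip_iff[of n \<sigma>] by blast
        have "\<exists>i'. i < i' \<and> i' < n \<and> (nu n * \<sigma>) $$ (i', Suc j) \<noteq> 0"
          if ij: "i < n" "Suc j < n" "(nu n * \<sigma>) $$ (i, j) \<noteq> 0" for i j
        proof -
          have "Suc i < n" "\<sigma> $$ (Suc i, j) \<noteq> 0"
            using ij by (auto simp: nu_mult_left[OF c] split: if_splits)
          then obtain i' where i': "Suc i < i'" "i' < n" "\<sigma> $$ (i', Suc j) \<noteq> 0" using R ij(2) by blast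
          then show ?thesis
            using ij by (intro exI[of _ "i' - 1"]) (auto simp: nu_mult_left[OF c])
        qed
        then show "\<And>k. Suc k < n \<Longrightarrow> \<not> desc n k (flip n (nu n * \<sigma>))"
          using not_desc_flip_iff[of n "nu n * \<sigma>"] by blast
      qed
      then show ?thesis by simp
    qed
  qed
qed

section \<open>Right multiplication by reflection\<close>

lemma conv_T_elt_flip:
  fixes \<sigma> \<tau> :: "'a::{finite, field} mat"
  assumes "\<sigma> \<in> rooks n" "\<tau> \<in> rooks n"
  shows "conv (T_elt n \<sigma>) (T_elt n \<tau>) = flip_fun n (conv (T_elt n (flip n \<tau>)) (T_elt n (flip n \<sigma>)))"
  unfolding flip_fun_T_elt[OF assms(1), symmetric] flip_fun_T_elt[OF assms(2), symmetric]
    flip_fun_conv[OF supported_T_elt[OF assms(1)] supported_T_elt[OF assms(2)], symmetric]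
  by (rule flip_fun_flip_fun[OF supported_conv[OF supported_T_elt[OF assms(1)] supported_T_elt[OF assms(2)]], symmetric])

lemma flip_fun_scale: "flip_fun n (scale c f) = scale c (flip_fun n f)"
  by (auto simp: flip_fun_def scale_def)

lemma flip_fun_T_elt_flip:
  fixes \<sigma> :: "'a::{finite, field} mat"
  shows "\<sigma> \<in> rooks n \<Longrightarrow> flip_fun n (T_elt n (flip n \<sigma>)) = T_elt n \<sigma>"
  using flip_fun_T_elt[OF flip_rooks] flip_flip[OF rooks_carrier] by metis

lemma T_elt_mult_torus:
  fixes \<sigma> :: "'a::{finite, field} mat"
  assumes t: "t \<in> torus n" and \<sigma>: "\<sigma> \<in> rooks n"
  shows "conv (T_elt n \<sigma>) (T_elt n t) = T_elt n (\<sigma> * t)"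
  unfolding conv_T_elt_flip[OF \<sigma> torus_rook[OF t]] T_elt_torus_mult[OF flip_torus[OF t] flip_rooks[OF \<sigma>]]
    flip_mult[OF rooks_carrier[OF \<sigma>] torus_carrier[OF t], symmetric]
  by (rule flip_fun_T_elt_flip[OF mult_torus_rook[OF t \<sigma>]])

lemma T_elt_mult_nu:
  fixes \<sigma> :: "'a::{finite, field} mat"
  assumes \<sigma>: "\<sigma> \<in> rooks n"
  shows "conv (T_elt n \<sigma>) (T_elt n (nu n)) =
    scale (of_nat CARD('a) powi (int (rook_length n \<sigma>) - int (rook_length n (\<sigma> * nu n)))) (T_elt n (\<sigma> * nu n))"
proof -
  have f: "nu n * flip n \<sigma> = flip n (\<sigma> * nu n)"
    using flip_mult[OF rooks_carrier[OF \<sigma>] nu_carrier] unfolding flip_nu by simp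
  show ?thesis
    unfolding conv_T_elt_flip[OF \<sigma> nu_rook] flip_nu T_elt_nu_mult[OF flip_rooks[OF \<sigma>]] f
      rook_length_flip[OF \<sigma>] rook_length_flip[OF mult_nu_rook[OF \<sigma>]] flip_fun_scale
      flip_fun_T_elt_flip[OF mult_nu_rook[OF \<sigma>]] ..
qed

lemma T_elt_mult_simple_refl_flip:
  fixes \<sigma> :: "'a::{finite, field} mat"
  assumes \<sigma>: "\<sigma> \<in> rooks n" and k: "Suc k < n"
  shows "conv (T_elt n \<sigma>) (T_elt n (simple_refl n k)) =
    flip_fun n (conv (T_elt n (simple_refl n (n - 2 - k))) (T_elt n (flip n \<sigma>)))"
  unfolding conv_T_elt_flip[OF \<sigma> simple_refl_rook[OF k]] flip_simple_refl[OF k] ..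

text \<open>The products are computed by descents while the theorem distinguishes lengths; this is
  the dictionary between the two.\<close>

lemma simple_refl_mult_cases:
  fixes \<sigma> :: "'a::{finite, field} mat"
  assumes \<sigma>: "\<sigma> \<in> rooks n" and k: "Suc k < n"
  obtains (fixed) "simple_refl n k * \<sigma> = \<sigma>" "rook_length n (simple_refl n k * \<sigma>) = rook_length n \<sigma>"
  | (up) "\<not> desc n k \<sigma>" "simple_refl n k * \<sigma> \<noteq> \<sigma>"
      "rook_length n (simple_refl n k * \<sigma>) = rook_length n \<sigma> + 1"
  | (down) "desc n k \<sigma>" "rook_length n (simple_refl n k * \<sigma>) + 1 = rook_length n \<sigma>"
proof (cases "desc n k \<sigma>")
  case True
  then show ?thesis using down rook_length_desc[OF \<sigma> k True] by simp
next
  case nd: False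
  show ?thesis
  proof (cases "simple_refl n k * \<sigma> = \<sigma>")
    case True
    show ?thesis by (rule fixed) (simp_all only: True)
  next
    case False
    show ?thesis by (rule up[OF nd False]) (simp only: rook_length_not_desc[OF \<sigma> k nd False] Suc_eq_plus1)
  qed
qed

lemma T_elt_simple_refl_mult_cases:
  fixes \<sigma> :: "'a::{finite, field} mat"
  assumes \<sigma>: "\<sigma> \<in> rooks n" and k: "Suc k < n"
  shows "rook_length n (simple_refl n k * \<sigma>) = rook_length n \<sigma> \<and>
      conv (T_elt n (simple_refl n k)) (T_elt n \<sigma>) = scale (of_nat CARD('a)) (T_elt n \<sigma>)
    \<or> rook_length n (simple_refl n k * \<sigma>) = rook_length n \<sigma> + 1 \<and>
      conv (T_elt n (simple_refl n k)) (T_elt n \<sigma>) = T_elt n (simple_refl n k * \<sigma>)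
    \<or> rook_length n (simple_refl n k * \<sigma>) + 1 = rook_length n \<sigma> \<and>
      conv (T_elt n (simple_refl n k)) (T_elt n \<sigma>) =
        (\<lambda>x. of_nat CARD('a) * T_elt n (simple_refl n k * \<sigma>) x + (\<Sum>r\<in>UNIV - {0}. T_elt n (h_mat n k r * \<sigma>) x))"
  using \<sigma> k
proof (cases rule: simple_refl_mult_cases)
  case fixed
  then show ?thesis using T_elt_simple_refl_fixed[OF \<sigma> k fixed(1)] by blast
next
  case up
  then show ?thesis using T_elt_simple_refl_up[OF \<sigma> k up(1,2)] by blast
next
  case down
  then show ?thesis using T_elt_simple_refl_desc[OF \<sigma> k down(1)] by blast
qed

lemma T_elt_mult_simple_refl_cases:
  fixes \<sigma> :: "'a::{finite, field} mat"
  assumes \<sigma>: "\<sigma> \<in> rooks n" and k: "Suc k < n"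
  shows "rook_length n (\<sigma> * simple_refl n k) = rook_length n \<sigma> \<and>
      conv (T_elt n \<sigma>) (T_elt n (simple_refl n k)) = scale (of_nat CARD('a)) (T_elt n \<sigma>)
    \<or> rook_length n (\<sigma> * simple_refl n k) = rook_length n \<sigma> + 1 \<and>
      conv (T_elt n \<sigma>) (T_elt n (simple_refl n k)) = T_elt n (\<sigma> * simple_refl n k)
    \<or> rook_length n (\<sigma> * simple_refl n k) + 1 = rook_length n \<sigma> \<and>
      conv (T_elt n \<sigma>) (T_elt n (simple_refl n k)) = (\<lambda>x. of_nat CARD('a) * T_elt n (\<sigma> * simple_refl n k) x +
        (\<Sum>r\<in>UNIV - {0}. T_elt n (\<sigma> * hs_mat n k r) x))"
proof -
  define k' where "k' = n - 2 - k"
  have k': "Suc k' < n" using k by (auto simp: k'_def)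
  note c = rooks_carrier[OF \<sigma>]
  note f\<sigma> = flip_rooks[OF \<sigma>]
  have s\<sigma>: "\<sigma> * simple_refl n k \<in> rooks n" by (rule mult_simple_refl_rook[OF k \<sigma>])
  have fs: "simple_refl n k' * flip n \<sigma> = flip n (\<sigma> * simple_refl n k)"
    unfolding k'_def by (rule flip_mult_simple_refl[OF c k, symmetric])
  note conv_eq = T_elt_mult_simple_refl_flip[OF \<sigma> k, folded k'_def]
  show ?thesis
    using f\<sigma> k'
  proof (cases rule: simple_refl_mult_cases)
    case fixed
    have "rook_length n (\<sigma> * simple_refl n k) = rook_length n \<sigma>"
      using fixed(2) unfolding fs rook_length_flip[OF s\<sigma>] rook_length_flip[OF \<sigma>] .
    moreover have "conv (T_elt n \<sigma>) (T_elt n (simple_refl n k)) = scale (of_nat CARD('a)) (T_elt n \<sigma>)"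
      unfolding conv_eq T_elt_simple_refl_fixed[OF f\<sigma> k' fixed(1)] flip_fun_scale flip_fun_T_elt_flip[OF \<sigma>] ..
    ultimately show ?thesis by blast
  next
    case up
    have "rook_length n (\<sigma> * simple_refl n k) = rook_length n \<sigma> + 1"
      using up(3) unfolding fs rook_length_flip[OF s\<sigma>] rook_length_flip[OF \<sigma>] .
    moreover have "conv (T_elt n \<sigma>) (T_elt n (simple_refl n k)) = T_elt n (\<sigma> * simple_refl n k)"
      unfolding conv_eq T_elt_simple_refl_up[OF f\<sigma> k' up(1,2)] fs flip_fun_T_elt_flip[OF s\<sigma>] ..
    ultimately show ?thesis by blast
  next
    case down
    have "rook_length n (\<sigma> * simple_refl n k) + 1 = rook_length n \<sigma>"
      using down(2) unfolding fs rook_length_flip[OF s\<sigma>] rook_length_flip[OF \<sigma>] .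
    moreover have "conv (T_elt n \<sigma>) (T_elt n (simple_refl n k)) = (\<lambda>x. of_nat CARD('a) * T_elt n (\<sigma> * simple_refl n k) x +
        (\<Sum>r\<in>UNIV - {0}. T_elt n (\<sigma> * hs_mat n k r) x))"
    proof
      fix x :: "'a mat"
      have h: "flip_fun n (T_elt n (h_mat n k' r * flip n \<sigma>)) x = T_elt n (\<sigma> * hs_mat n k r) x" if "r \<noteq> 0" for r
      proof -
        have ht: "hs_mat n k r \<in> torus n" by (rule hs_mat_torus[OF k that])
        have "h_mat n k' r * flip n \<sigma> = flip n (\<sigma> * hs_mat n k r)"
          unfolding flip_mult[OF c torus_carrier[OF ht]] flip_hs_mat[OF k] k'_def ..
        then show ?thesis using flip_fun_T_elt_flip[OF mult_torus_rook[OF ht \<sigma>]] by simp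
      qed
      have "conv (T_elt n \<sigma>) (T_elt n (simple_refl n k)) x =
          of_nat CARD('a) * flip_fun n (T_elt n (flip n (\<sigma> * simple_refl n k))) x +
          (\<Sum>r\<in>UNIV - {0}. flip_fun n (T_elt n (h_mat n k' r * flip n \<sigma>)) x)"
        unfolding conv_eq T_elt_simple_refl_desc[OF f\<sigma> k' down(1)] fs by (simp add: flip_fun_def)
      also have "(\<Sum>r\<in>UNIV - {0}. flip_fun n (T_elt n (h_mat n k' r * flip n \<sigma>)) x) =
          (\<Sum>r\<in>UNIV - {0}. T_elt n (\<sigma> * hs_mat n k r) x)"
        by (rule sum.cong[OF refl]) (use h in auto)
      finally show "conv (T_elt n \<sigma>) (T_elt n (simple_refl n k)) x =
          of_nat CARD('a) * T_elt n (\<sigma> * simple_refl n k) x + (\<Sum>r\<in>UNIV - {0}. T_elt n (\<sigma> * hs_mat n k r) x)"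
        unfolding flip_fun_T_elt_flip[OF s\<sigma>] .
    qed
    ultimately show ?thesis by blast
  qed
qed

subsection \<open>The torus action and the ring structure\<close>

text \<open>At a least point x of disagreement the smaller value, say f x, is also g y for some y,
  and y < x. There f and g agree, so f y = f x, against strict monotonicity.\<close>

lemma strict_mono_on_same_image:
  fixes f g :: "nat \<Rightarrow> nat"
  assumes f: "strict_mono_on A f" and g: "strict_mono_on A g" and im: "f ` A = g ` A" and "x \<in> A"
  shows "f x = g x"
  using assms(4)
proof (induction x rule: less_induct)
  case (less x)
  have False if f: "strict_mono_on A f" and g: "strict_mono_on A g" and im: "f ` A = g ` A"
    and IH: "\<And>y. y < x \<Longrightarrow> y \<in> A \<Longrightarrow> f y = g y" and lt: "f x < g x" for f g :: "nat \<Rightarrow> nat"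
  proof -
    have "f x \<in> g ` A" using im less.prems by blast
    then obtain y where y: "y \<in> A" "f x = g y" by blast
    then have "g y < g x" using lt by simp
    then have "y < x" using strict_mono_on_less[OF g y(1) less.prems] by simp
    then have "f y = f x" using IH[of y] y by simp
    then show False using strict_mono_on_less[OF f y(1) less.prems] \<open>y < x\<close> by simp
  qed
  from this[OF f g im] this[OF g f im[symmetric]] less.IH show ?case
    by (metis linorder_neqE_nat)
qed

lemma ex_strict_mono_bij_betw:
  fixes A B :: "nat set"
  assumes "finite A" "finite B" "card A = card B"
  obtains g where "bij_betw g A B" "strict_mono_on A g"
proof -
  obtain a where a: "bij_betw a {..<card A} A" "strict_mono_on {..<card A} a"
    using ex_bij_betw_strict_mono_card[OF assms(1)] .
  obtain b where b: "bij_betw b {..<card A} B" "strict_mono_on {..<card A} b"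
    using ex_bij_betw_strict_mono_card[OF assms(2)] unfolding assms(3)[symmetric] .
  define a' where "a' = the_inv_into {..<card A} a"
  have a': "bij_betw a' A {..<card A}" unfolding a'_def by (rule bij_betw_the_inv_into[OF a(1)])
  have aa': "a (a' x) = x" if "x \<in> A" for x
    unfolding a'_def using f_the_inv_into_f_bij_betw[OF a(1)] that by blast
  have "strict_mono_on A (b \<circ> a')"
  proof (rule strict_mono_onI)
    fix x y assume xy: "x \<in> A" "y \<in> A" "x < y"
    have m: "a' x \<in> {..<card A}" "a' y \<in> {..<card A}" using bij_betwE[OF a'] xy by auto
    have "a' x < a' y" using strict_mono_on_less[OF a(2) m] aa' xy by simp
    then show "(b \<circ> a') x < (b \<circ> a') y" using strict_mono_on_less[OF b(2) m] by simp
  qed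
  then show ?thesis using that bij_betw_trans[OF a' b(1)] by blast
qed

text \<open>\<open>hat\<close> is a definite description, so existence and uniqueness have to come
  before any use of it. Existence glues \<open>row_col\<close> with the increasing bijection from
  the zero rows onto the zero columns. Any other candidate is a permutation too, hence maps the zero
  rows onto the zero columns, and increasing maps with the same image agree.\<close>

lemma hat_spec:
  fixes \<sigma> :: "'a::field mat"
  assumes \<sigma>: "\<sigma> \<in> rooks n"
  shows "hat n \<sigma> permutes {..<n}" and "\<And>i j. i < n \<Longrightarrow> j < n \<Longrightarrow> \<sigma> $$ (i, j) \<noteq> 0 \<Longrightarrow> hat n \<sigma> i = j"
proof -
  note c = rooks_carrier[OF \<sigma>]
  let ?I = "rows_supp \<sigma>" and ?f = "row_col \<sigma>"
  let ?A = "{..<n} - ?I" and ?B = "{..<n} - ?f ` ?I"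
  have I: "i \<in> ?I \<longleftrightarrow> i < n \<and> (\<exists>j<n. \<sigma> $$ (i, j) \<noteq> 0)" for i using c by (auto simp: rows_supp_def)
  have f: "?f i = j" if "i < n" "j < n" "\<sigma> $$ (i, j) \<noteq> 0" for i j
    unfolding row_col_def by (rule the_equality) (use that c rook_row_eq[OF \<sigma>, of i] in auto)
  have fI: "?f i < n \<and> \<sigma> $$ (i, ?f i) \<noteq> 0" if "i \<in> ?I" for i
    using that f unfolding I by auto
  have inj: "inj_on ?f ?I"
  proof (rule inj_onI)
    fix i i' assume i: "i \<in> ?I" and i': "i' \<in> ?I" and eq: "?f i = ?f i'"
    have "\<sigma> $$ (i', ?f i) \<noteq> 0" using fI[OF i'] unfolding eq by blast
    then show "i = i'" using rook_col_eq[OF \<sigma>, of i "?f i" i'] fI[OF i] i i' I by blast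
  qed
  have sub: "?I \<subseteq> {..<n}" "?f ` ?I \<subseteq> {..<n}" using I fI by auto
  have "card ?A = card ?B" using sub card_image[OF inj]
    by (simp add: card_Diff_subset finite_subset)
  then obtain g where g: "bij_betw g ?A ?B" "strict_mono_on ?A g"
    using ex_strict_mono_bij_betw[of ?A ?B] by auto
  let ?P = "\<lambda>p. p permutes {..<n} \<and> (\<forall>i \<in> ?I. p i = ?f i) \<and> strict_mono_on ?A p"
  define p where "p = (\<lambda>i. if i \<in> ?I then ?f i else if i < n then g i else i)"
  have pI: "p i = ?f i" if "i \<in> ?I" for i using that by (simp add: p_def)
  have pA: "p i = g i" if "i \<in> ?A" for i using that by (simp add: p_def)
  have "bij_betw p ?I (?f ` ?I)"
    by (rule iffD2[OF bij_betw_cong[OF pI] inj_on_imp_bij_betw[OF inj]])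
  moreover have "bij_betw p ?A ?B"
    by (rule iffD2[OF bij_betw_cong[OF pA] g(1)])
  ultimately have "bij_betw p (?I \<union> ?A) (?f ` ?I \<union> ?B)" by (rule bij_betw_combine) auto
  moreover have "?I \<union> ?A = {..<n}" "?f ` ?I \<union> ?B = {..<n}" using sub by auto
  ultimately have "bij_betw p {..<n} {..<n}" by simp
  then have "p permutes {..<n}" by (rule bij_imp_permutes) (use sub in \<open>auto simp: p_def\<close>)
  moreover have "strict_mono_on ?A p"
    using g(2) pA by (simp add: strict_mono_on_def)
  ultimately have Pp: "?P p" using pI by blast
  have "p' = p" if p': "?P p'" for p'
  proof
    fix i
    have im: "r ` ?A = ?B" if "?P r" for r
    proof -
      have "r ` ?A = r ` {..<n} - r ` ?I"
        using that by (intro image_set_diff permutes_inj) blast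
      also have "r ` ?I = ?f ` ?I" using that by (intro image_cong) blast+
      also have "r ` {..<n} = {..<n}" using that permutes_image by blast
      finally show ?thesis .
    qed
    consider "i \<in> ?I" | "i \<in> ?A" | "i \<notin> {..<n}" by blast
    then show "p' i = p i"
    proof cases
      case 1
      then show ?thesis using p' Pp by simp
    next
      case 2
      show ?thesis
        by (rule strict_mono_on_same_image[OF _ _ trans[OF im[OF p'] im[OF Pp, symmetric]] 2])
          (use p' Pp in blast)+
    next
      case 3
      then show ?thesis using p' Pp permutes_not_in by metis
    qed
  qed
  then have hat_eq: "hat n \<sigma> = p" unfolding hat_def by (intro the_equality Pp)
  have hat: "?P (hat n \<sigma>)" unfolding hat_eq by (rule Pp)
  then show "hat n \<sigma> permutes {..<n}" by blast
  show "hat n \<sigma> i = j" if "i < n" "j < n" "\<sigma> $$ (i, j) \<noteq> 0" for i j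
  proof -
    have "i \<in> ?I" using that I by blast
    then show ?thesis using hat f[OF that] by simp
  qed
qed

text \<open>If \<sigma> is nonzero at (i, j), then \<open>hat n \<sigma>\<close> sends i to j, so
  scaling row i by t_i is scaling column j by the entry of \<open>torus_act n t \<sigma>\<close>
  there. The remaining entries scale zero columns.\<close>

lemma torus_act_torus:
  fixes \<sigma> :: "'a::field mat"
  assumes t: "t \<in> torus n" and \<sigma>: "\<sigma> \<in> rooks n"
  shows "torus_act n t \<sigma> \<in> torus n" and "t * \<sigma> = \<sigma> * torus_act n t \<sigma>"
proof -
  obtain d where d: "t = mat_diag n d" "\<forall>i<n. d i \<noteq> 0" using t torus_iff by blast
  note c = rooks_carrier[OF \<sigma>] and hat = hat_spec[OF \<sigma>]
  have act: "(\<Sum>i | i < n \<and> hat n \<sigma> i = hat n \<sigma> i'. t $$ (i, i)) = d i'" if "i' < n" for i'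
  proof -
    have "{i. i < n \<and> hat n \<sigma> i = hat n \<sigma> i'} = {i'}"
      using that permutes_inj[OF hat(1)] by (auto simp: inj_eq)
    then show ?thesis using that by (simp add: d(1) mat_diag_def)
  qed
  show "torus_act n t \<sigma> \<in> torus n"
    unfolding torus_act_def
  proof (rule mat_diag_torus)
    fix j assume "j < n"
    then have "j \<in> hat n \<sigma> ` {..<n}" using permutes_image[OF hat(1)] by simp
    then obtain i where "i < n" "j = hat n \<sigma> i" by auto
    then show "(\<Sum>i | i < n \<and> hat n \<sigma> i = j. t $$ (i, i)) \<noteq> 0" using act d(2) by simp
  qed
  show "t * \<sigma> = \<sigma> * torus_act n t \<sigma>"
    unfolding torus_act_def mat_diag_mult_right[OF c]
  proof (rule eq_matI)
    let ?R = "mat n n (\<lambda>(i, j). \<sigma> $$ (i, j) * (\<Sum>i | i < n \<and> hat n \<sigma> i = j. t $$ (i, i)))"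
    fix i j assume "i < dim_row ?R" "j < dim_col ?R"
    then have ij: "i < n" "j < n" by auto
    have "(t * \<sigma>) $$ (i, j) = d i * \<sigma> $$ (i, j)" using ij unfolding d(1) mat_diag_mult_left[OF c] by simp
    then show "(t * \<sigma>) $$ (i, j) = ?R $$ (i, j)"
      using ij act[OF ij(1)] hat(2)[OF ij] by (cases "\<sigma> $$ (i, j) = 0") auto
  qed (use c torus_carrier[OF t] in auto)
qed

text \<open>Multiplication by a permutes the nonzero elements of the field; compare the products
  over them.\<close>

lemma finite_field_power_card_minus_1:
  fixes a :: "'a::{finite, field}"
  assumes "a \<noteq> 0" shows "a ^ (CARD('a) - 1) = 1"
proof -
  let ?S = "UNIV - {0 :: 'a}"
  have "(\<Prod>x\<in>?S. a * x) = (\<Prod>x\<in>?S. x)"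
    by (rule prod.reindex_bij_witness[where i = "\<lambda>x. x / a" and j = "\<lambda>x. a * x"]) (use assms in auto)
  then have "a ^ card ?S * (\<Prod>x\<in>?S. x) = (\<Prod>x\<in>?S. x)" by (simp add: prod.distrib)
  moreover have "(\<Prod>x\<in>?S. x) \<noteq> 0" by simp
  ultimately show ?thesis by (simp add: card_Diff_singleton)
qed

section \<open>Integral combinations, closure and generation\<close>

lemma carrier_HMU: "carrier (HMU n) = range (int_comb n)"
  and add_HMU: "add (HMU n) = (\<lambda>f g x. f x + g x)"
  and zero_HMU: "zero (HMU n) = (\<lambda>x. 0)"
  and one_HMU: "one (HMU n) = T_elt n (1\<^sub>m n)"
  by (simp_all add: HMU_def mat_algebra_def monoid_algebra_def)

lemma finite_rooks: "finite (rooks n :: 'a::{finite, field} mat set)"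
  by (rule finite_subset[OF _ finite_carrier_mat]) (auto simp: rooks_def)

lemma supported_int_comb: "supported n (int_comb n c)"
  unfolding int_comb_def by (rule supported_sum[OF supported_T_elt])

lemma T_elt_in_HMU:
  fixes \<sigma> :: "'a::{finite, field} mat"
  assumes \<sigma>: "\<sigma> \<in> rooks n" shows "T_elt n \<sigma> \<in> range (int_comb n)"
proof (rule range_eqI)
  show "T_elt n \<sigma> = int_comb n (\<lambda>\<tau>. if \<tau> = \<sigma> then 1 else 0)"
  proof
    fix x
    have "(\<Sum>\<tau>\<in>rooks n. of_int (if \<tau> = \<sigma> then 1 else 0) * T_elt n \<tau> x) =
        (\<Sum>\<tau>\<in>rooks n. if \<tau> = \<sigma> then T_elt n \<sigma> x else 0)" by (intro sum.cong) auto
    then show "T_elt n \<sigma> x = int_comb n (\<lambda>\<tau>. if \<tau> = \<sigma> then 1 else 0) x"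
      using \<sigma> finite_rooks[of n, where 'a = 'a] by (simp add: int_comb_def)
  qed
qed

lemma HMU_add_closed:
  assumes "f \<in> range (int_comb n)" "g \<in> range (int_comb n)"
  shows "(\<lambda>x. f x + g x) \<in> range (int_comb n)"
proof -
  obtain c d where "f = int_comb n c" "g = int_comb n d" using assms by blast
  then have "(\<lambda>x. f x + g x) = int_comb n (\<lambda>\<sigma>. c \<sigma> + d \<sigma>)"
    by (simp add: int_comb_def sum.distrib ring_distribs)
  then show ?thesis by blast
qed

lemma HMU_scale_closed:
  assumes "f \<in> range (int_comb n)" shows "(\<lambda>x. of_int a * f x) \<in> range (int_comb n)"
proof -
  obtain c where "f = int_comb n c" using assms by blast
  then have "(\<lambda>x. of_int a * f x) = int_comb n (\<lambda>\<sigma>. a * c \<sigma>)"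
    by (simp add: int_comb_def sum_distrib_left mult.assoc)
  then show ?thesis by blast
qed

lemma HMU_zero_closed: "(\<lambda>x. 0) \<in> range (int_comb n)"
  by (rule range_eqI[of _ _ "\<lambda>_. 0"]) (simp add: int_comb_def)

lemma HMU_sum_closed:
  assumes "\<And>i. i \<in> I \<Longrightarrow> f i \<in> range (int_comb n)"
  shows "(\<lambda>x. \<Sum>i\<in>I. f i x) \<in> range (int_comb n)"
  using assms
proof (induction I rule: infinite_finite_induct)
  case (insert i I)
  then show ?case using HMU_add_closed[of "f i" n "\<lambda>x. \<Sum>i\<in>I. f i x"] by simp
qed (simp_all add: HMU_zero_closed)

lemma conv_add_left:
  fixes f g h :: "'a::{finite, field} mat \<Rightarrow> rat"
  assumes f: "supported n f" and g: "supported n g" and h: "supported n h"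
  shows "conv (\<lambda>x. f x + g x) h = (\<lambda>x. conv f h x + conv g h x)"
proof -
  have s: "supported n (\<lambda>x. f x + g x)" using f g by (simp add: supported_def)
  show ?thesis
    unfolding conv_eq[OF s h] conv_eq[OF f h] conv_eq[OF g h] sum.distrib[symmetric]
    by (intro ext sum.cong) (auto simp: distrib_right)
qed

lemma conv_add_right:
  fixes f g h :: "'a::{finite, field} mat \<Rightarrow> rat"
  assumes f: "supported n f" and g: "supported n g" and h: "supported n h"
  shows "conv h (\<lambda>x. f x + g x) = (\<lambda>x. conv h f x + conv h g x)"
proof -
  have s: "supported n (\<lambda>x. f x + g x)" using f g by (simp add: supported_def)
  show ?thesis
    unfolding conv_eq[OF h s] conv_eq[OF h f] conv_eq[OF h g] sum.distrib[symmetric]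
    by (intro ext sum.cong) (auto simp: distrib_left)
qed

text \<open>Follows from linearity in the second argument, since the anti-automorphism exchanges the
  arguments.\<close>

lemma conv_sum_left:
  fixes f :: "'a::{finite, field} mat \<Rightarrow> rat"
  assumes f: "supported n f" and g: "\<And>i. i \<in> I \<Longrightarrow> supported n (g i)"
  shows "conv (\<lambda>x. \<Sum>i\<in>I. c i * g i x) f = (\<lambda>x. \<Sum>i\<in>I. c i * conv (g i) f x)"
proof -
  have s: "supported n (\<lambda>x. \<Sum>i\<in>I. c i * g i x)" by (rule supported_sum[OF g])
  have e: "flip_fun n (\<lambda>x. \<Sum>i\<in>I. c i * h i x) = (\<lambda>x. \<Sum>i\<in>I. c i * flip_fun n (h i) x)"
    for h :: "_ \<Rightarrow> 'a mat \<Rightarrow> rat" by (auto simp: flip_fun_def)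
  have "conv (\<lambda>x. \<Sum>i\<in>I. c i * g i x) f =
      flip_fun n (conv (flip_fun n f) (\<lambda>x. \<Sum>i\<in>I. c i * flip_fun n (g i) x))"
    using flip_fun_conv[OF s f] flip_fun_flip_fun[OF supported_conv[OF s f]] unfolding e by simp
  also have "\<dots> = (\<lambda>x. \<Sum>i\<in>I. c i * flip_fun n (conv (flip_fun n f) (flip_fun n (g i))) x)"
    unfolding conv_sum_right[OF supported_flip_fun supported_flip_fun] e ..
  also have "\<dots> = (\<lambda>x. \<Sum>i\<in>I. c i * conv (g i) f x)"
  proof (intro ext sum.cong refl)
    fix i x assume i: "i \<in> I"
    have "flip_fun n (conv (flip_fun n f) (flip_fun n (g i))) = conv (g i) f"
      unfolding flip_fun_conv[OF g[OF i] f, symmetric]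
      by (rule flip_fun_flip_fun[OF supported_conv[OF g[OF i] f]])
    then show "c i * flip_fun n (conv (flip_fun n f) (flip_fun n (g i))) x = c i * conv (g i) f x" by simp
  qed
  finally show ?thesis .
qed

text \<open>Undoing a descent falls under the case of growing length, so T_\<sigma> is T_{s_k}
  T_{s_k \<sigma>} or T_{\<sigma> s_k} T_{s_k} with no further terms. Every T_\<sigma> is thus a
  product of generators, which serves both the closure under products and the generation of the
  ring.\<close>

lemma T_elt_induct [consumes 1, case_names simple_refl torus nu mult]:
  fixes \<sigma> :: "'a::{finite, field} mat"
  assumes "\<sigma> \<in> rooks n"
    and s: "\<And>k. Suc k < n \<Longrightarrow> Q (T_elt n (simple_refl n k :: 'a mat))"
    and t: "\<And>t. t \<in> torus n \<Longrightarrow> Q (T_elt n (t :: 'a mat))"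
    and v: "Q (T_elt n (nu n :: 'a mat))"
    and m: "\<And>\<sigma> \<tau>. \<sigma> \<in> rooks n \<Longrightarrow> \<tau> \<in> rooks n \<Longrightarrow> Q (T_elt n \<sigma>) \<Longrightarrow> Q (T_elt n \<tau>) \<Longrightarrow>
      Q (conv (T_elt n \<sigma>) (T_elt n (\<tau> :: 'a mat)))"
  shows "Q (T_elt n \<sigma>)"
  using assms(1)
proof (induction rule: rook_desc_induct)
  case (reduced \<sigma>)
  have nu_pow: "Q (T_elt n (nu n ^\<^sub>m d :: 'a mat))" for d
  proof (induction d)
    case 0
    then show ?case using t[OF one_torus] by simp
  next
    case (Suc d)
    \<comment> \<open>All powers of \<nu> have length 0, so the power of q is 1.\<close>
    have "conv (T_elt n (nu n ^\<^sub>m d :: 'a mat)) (T_elt n (nu n)) = T_elt n (nu n ^\<^sub>m Suc d)"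
      using T_elt_mult_nu[OF nu_pow_rook[of n d], where 'a = 'a] rook_length_nu_pow[of n d, where 'a = 'a]
        rook_length_nu_pow[of n "Suc d", where 'a = 'a]
      by (simp add: scale_1)
    then show ?case using m[OF nu_pow_rook nu_rook Suc v] by simp
  qed
  obtain u where u: "u \<in> torus n" "\<sigma> = u * nu n ^\<^sub>m (n - vec_space.rank n \<sigma>)"
    using no_desc_rook[OF reduced] by blast
  have "Q (T_elt n (u * nu n ^\<^sub>m (n - vec_space.rank n \<sigma>)))"
    using m[OF torus_rook[OF u(1)] nu_pow_rook t[OF u(1)] nu_pow] T_elt_torus_mult[OF u(1) nu_pow_rook]
    by (simp only:)
  then show ?case using u(2) by simp
next
  case (left \<sigma> k)
  let ?\<tau> = "simple_refl n k * \<sigma>"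
  have r: "?\<tau> \<in> rooks n" by (rule simple_refl_mult_rook[OF left(2,1)])
  have eq: "simple_refl n k * ?\<tau> = \<sigma>" by (rule simple_refl_cancel[OF left(2) rooks_carrier[OF left(1)]])
  have "simple_refl n k * ?\<tau> \<noteq> ?\<tau>" unfolding eq using desc_simple_refl_neq[OF left(1-3)] by simp
  then have "conv (T_elt n (simple_refl n k)) (T_elt n ?\<tau>) = T_elt n \<sigma>"
    using T_elt_simple_refl_up[OF r left(2) not_desc_simple_refl[OF left(1-3)]] unfolding eq by simp
  then show ?case using m[OF simple_refl_rook[OF left(2)] r s[OF left(2)] left(4)] by simp
next
  case (right \<sigma> k)
  let ?\<tau> = "\<sigma> * simple_refl n k"
  define k' where "k' = n - 2 - k"
  have k': "Suc k' < n" using right(2) by (auto simp: k'_def)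
  note f\<sigma> = flip_rooks[OF right(1)] and d = right(3)[folded k'_def]
  have r: "?\<tau> \<in> rooks n" by (rule mult_simple_refl_rook[OF right(2,1)])
  have f\<tau>: "flip n ?\<tau> = simple_refl n k' * flip n \<sigma>"
    unfolding k'_def by (rule flip_mult_simple_refl[OF rooks_carrier[OF right(1)] right(2)])
  have eq: "simple_refl n k' * flip n ?\<tau> = flip n \<sigma>"
    unfolding f\<tau> by (rule simple_refl_cancel[OF k' flip_carrier])
  have "flip n \<sigma> \<noteq> flip n ?\<tau>" unfolding f\<tau> using desc_simple_refl_neq[OF f\<sigma> k' d] by simp
  then have neq: "simple_refl n k' * flip n ?\<tau> \<noteq> flip n ?\<tau>" by (simp only: eq not_False_eq_True)
  have "\<not> desc n k' (flip n ?\<tau>)" unfolding f\<tau> by (rule not_desc_simple_refl[OF f\<sigma> k' d])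
  from T_elt_simple_refl_up[OF flip_rooks[OF r] k' this neq]
  have "conv (T_elt n ?\<tau>) (T_elt n (simple_refl n k)) = flip_fun n (T_elt n (flip n \<sigma>))"
    unfolding T_elt_mult_simple_refl_flip[OF r right(2), folded k'_def] by (simp only: eq)
  then have "conv (T_elt n ?\<tau>) (T_elt n (simple_refl n k)) = T_elt n \<sigma>"
    unfolding flip_fun_T_elt_flip[OF right(1)] .
  then show ?case using m[OF r simple_refl_rook[OF right(2)] right(4) s[OF right(2)]] by simp
qed

lemma conv_int_comb_closed:
  fixes f :: "'a::{finite, field} mat \<Rightarrow> rat"
  assumes f: "supported n f" and T: "\<And>\<sigma>. \<sigma> \<in> rooks n \<Longrightarrow> conv f (T_elt n \<sigma>) \<in> range (int_comb n)"
    and g: "g \<in> range (int_comb n)"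
  shows "conv f g \<in> range (int_comb n)"
proof -
  obtain c where g: "g = int_comb n c" using g by blast
  have "conv f g = (\<lambda>x. \<Sum>\<sigma>\<in>rooks n. of_int (c \<sigma>) * conv f (T_elt n \<sigma>) x)"
    unfolding g int_comb_def by (rule conv_sum_right[OF f supported_T_elt])
  also have "\<dots> \<in> range (int_comb n)" by (intro HMU_sum_closed HMU_scale_closed T)
  finally show ?thesis .
qed

text \<open>For a generator the product formulas show that each T_\<tau> goes to an integral
  combination. The claim is quantified over all g in the span, so that for a product of two elements
  associativity allows it to be applied twice.\<close>

lemma conv_T_elt_closed:
  fixes \<sigma> :: "'a::{finite, field} mat"
  assumes \<sigma>: "\<sigma> \<in> rooks n"
  shows "\<forall>g\<in>range (int_comb n). conv (T_elt n \<sigma>) g \<in> range (int_comb n)"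
  using \<sigma>
proof (induction rule: T_elt_induct)
  case (simple_refl k)
  have "conv (T_elt n (simple_refl n k)) (T_elt n \<tau>) \<in> range (int_comb n)" if \<tau>: "\<tau> \<in> rooks n" for \<tau> :: "'a mat"
    using \<tau> simple_refl
  proof (cases rule: simple_refl_mult_cases)
    case fixed
    show ?thesis unfolding T_elt_simple_refl_fixed[OF \<tau> simple_refl fixed(1)] scale_def
      using HMU_scale_closed[OF T_elt_in_HMU[OF \<tau>], of "int CARD('a)"] by simp
  next
    case up
    show ?thesis unfolding T_elt_simple_refl_up[OF \<tau> simple_refl up(1,2)]
      by (rule T_elt_in_HMU[OF simple_refl_mult_rook[OF simple_refl \<tau>]])
  next
    case down
    have "(\<lambda>x. of_nat CARD('a) * T_elt n (simple_refl n k * \<tau>) x) \<in> range (int_comb n)"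
      using HMU_scale_closed[OF T_elt_in_HMU[OF simple_refl_mult_rook[OF simple_refl \<tau>]], of "int CARD('a)"]
      by simp
    moreover have "(\<lambda>x. \<Sum>r\<in>UNIV - {0}. T_elt n (h_mat n k r * \<tau>) x) \<in> range (int_comb n)"
      by (intro HMU_sum_closed T_elt_in_HMU torus_mult_rook[OF h_mat_torus \<tau>]) simp
    ultimately show ?thesis unfolding T_elt_simple_refl_desc[OF \<tau> simple_refl down(1)]
      by (rule HMU_add_closed)
  qed
  then show ?case using conv_int_comb_closed[OF supported_T_elt[OF simple_refl_rook[OF simple_refl]]] by blast
next
  case (torus t)
  have "conv (T_elt n t) (T_elt n \<tau>) \<in> range (int_comb n)" if \<tau>: "\<tau> \<in> rooks n" for \<tau> :: "'a mat"
    unfolding T_elt_torus_mult[OF torus \<tau>] by (rule T_elt_in_HMU[OF torus_mult_rook[OF torus \<tau>]])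
  then show ?case using conv_int_comb_closed[OF supported_T_elt[OF torus_rook[OF torus]]] by blast
next
  case nu
  have "conv (T_elt n (nu n)) (T_elt n \<tau>) \<in> range (int_comb n)" if \<tau>: "\<tau> \<in> rooks n" for \<tau> :: "'a mat"
  proof -
    \<comment> \<open>The truncated subtraction is exact because \<open>nu\<close> does not increase
      the length; this makes the coefficient an integer.\<close>
    define m where "m = rook_length n \<tau> - rook_length n (nu n * \<tau>)"
    have "int (rook_length n \<tau>) - int (rook_length n (nu n * \<tau>)) = int m"
      using rook_length_nu_mult_le[OF \<tau>] by (simp add: m_def)
    then have "conv (T_elt n (nu n)) (T_elt n \<tau>) = (\<lambda>x. of_int (int (CARD('a) ^ m)) * T_elt n (nu n * \<tau>) x)"
      unfolding T_elt_nu_mult[OF \<tau>] by (simp add: scale_def)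
    then show ?thesis using HMU_scale_closed[OF T_elt_in_HMU[OF nu_mult_rook[OF \<tau>]]] by metis
  qed
  then show ?case using conv_int_comb_closed[OF supported_T_elt[OF nu_rook]] by blast
next
  case (mult \<sigma> \<tau>)
  show ?case
  proof
    fix g :: "'a mat \<Rightarrow> rat" assume g: "g \<in> range (int_comb n)"
    then have "supported n g" using supported_int_comb by blast
    then have "conv (conv (T_elt n \<sigma>) (T_elt n \<tau>)) g = conv (T_elt n \<sigma>) (conv (T_elt n \<tau>) g)"
      by (rule conv_assoc[OF supported_T_elt[OF mult(1)] supported_T_elt[OF mult(2)]])
    then show "conv (conv (T_elt n \<sigma>) (T_elt n \<tau>)) g \<in> range (int_comb n)"
      using bspec[OF mult(3) bspec[OF mult(4) g]] by (simp only:)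
  qed
qed

lemma conv_closed:
  fixes f g :: "'a::{finite, field} mat \<Rightarrow> rat"
  assumes f: "f \<in> range (int_comb n)" and g: "g \<in> range (int_comb n)"
  shows "conv f g \<in> range (int_comb n)"
proof -
  obtain c where c: "f = int_comb n c" using f by blast
  have sg: "supported n g" using g supported_int_comb by blast
  have "conv f g = (\<lambda>x. \<Sum>\<sigma>\<in>rooks n. of_int (c \<sigma>) * conv (T_elt n \<sigma>) g x)"
    unfolding c int_comb_def by (rule conv_sum_left[OF sg supported_T_elt])
  also have "\<dots> \<in> range (int_comb n)"
    by (intro HMU_sum_closed HMU_scale_closed) (use conv_T_elt_closed g in blast)
  finally show ?thesis .
qed

text \<open>The matrix 1 is a torus element, so the torus formulas apply on the spanning
  elements.\<close>

lemma T_elt_one_conv: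
  fixes f :: "'a::{finite, field} mat \<Rightarrow> rat"
  assumes "f \<in> range (int_comb n)"
  shows "conv (T_elt n (1\<^sub>m n)) f = f" and "conv f (T_elt n (1\<^sub>m n)) = f"
proof -
  obtain c where c: "f = int_comb n c" using assms by blast
  have one: "supported n (T_elt n (1\<^sub>m n :: 'a mat))" by (rule supported_T_elt[OF one_rook])
  have "conv (T_elt n (1\<^sub>m n)) f = (\<lambda>x. \<Sum>\<sigma>\<in>rooks n. of_int (c \<sigma>) * conv (T_elt n (1\<^sub>m n)) (T_elt n \<sigma>) x)"
    unfolding c int_comb_def by (rule conv_sum_right[OF one supported_T_elt])
  also have "\<dots> = f"
    unfolding c int_comb_def
  proof (intro ext sum.cong refl)
    fix x :: "'a mat" and \<sigma> :: "'a mat" assume \<sigma>: "\<sigma> \<in> rooks n"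
    show "of_int (c \<sigma>) * conv (T_elt n (1\<^sub>m n)) (T_elt n \<sigma>) x = of_int (c \<sigma>) * T_elt n \<sigma> x"
      unfolding T_elt_torus_mult[OF one_torus \<sigma>] left_mult_one_mat[OF rooks_carrier[OF \<sigma>]] ..
  qed
  finally show "conv (T_elt n (1\<^sub>m n)) f = f" .
  have "conv f (T_elt n (1\<^sub>m n)) = (\<lambda>x. \<Sum>\<sigma>\<in>rooks n. of_int (c \<sigma>) * conv (T_elt n \<sigma>) (T_elt n (1\<^sub>m n)) x)"
    unfolding c int_comb_def by (rule conv_sum_left[OF one supported_T_elt])
  also have "\<dots> = f"
    unfolding c int_comb_def
  proof (intro ext sum.cong refl)
    fix x :: "'a mat" and \<sigma> :: "'a mat" assume \<sigma>: "\<sigma> \<in> rooks n"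
    show "of_int (c \<sigma>) * conv (T_elt n \<sigma>) (T_elt n (1\<^sub>m n)) x = of_int (c \<sigma>) * T_elt n \<sigma> x"
      unfolding T_elt_mult_torus[OF one_torus \<sigma>] right_mult_one_mat[OF rooks_carrier[OF \<sigma>]] ..
  qed
  finally show "conv f (T_elt n (1\<^sub>m n)) = f" .
qed

lemma ring_HMU: "ring (HMU n :: ('a::{finite, field} mat \<Rightarrow> rat) ring)"
proof (rule ringI)
  have supp: "supported n f" if "f \<in> range (int_comb n)" for f :: "'a mat \<Rightarrow> rat"
    using that supported_int_comb by blast
  show "abelian_group (HMU n :: ('a mat \<Rightarrow> rat) ring)"
  proof (rule abelian_groupI, unfold carrier_HMU add_HMU zero_HMU)
    fix f :: "'a mat \<Rightarrow> rat" assume "f \<in> range (int_comb n)"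
    then have "(\<lambda>x. of_int (-1) * f x) \<in> range (int_comb n)" by (rule HMU_scale_closed)
    then show "\<exists>g\<in>range (int_comb n). (\<lambda>x. g x + f x) = (\<lambda>x. 0)" by (rule rev_bexI) simp
  qed (auto intro: HMU_add_closed HMU_zero_closed simp: add_ac)
  show "monoid (HMU n :: ('a mat \<Rightarrow> rat) ring)"
  proof (rule monoidI, unfold carrier_HMU mult_HMU one_HMU)
    show "T_elt n (1\<^sub>m n) \<in> range (int_comb n)" by (rule T_elt_in_HMU[OF one_rook])
    fix f g h :: "'a mat \<Rightarrow> rat"
    assume "f \<in> range (int_comb n)" "g \<in> range (int_comb n)" "h \<in> range (int_comb n)"
    then show "conv (conv f g) h = conv f (conv g h)" by (intro conv_assoc[where n = n] supp)
  qed (rule conv_closed T_elt_one_conv; assumption)+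
  fix f g h :: "'a mat \<Rightarrow> rat"
  assume "f \<in> carrier (HMU n)" "g \<in> carrier (HMU n)" "h \<in> carrier (HMU n)"
  then have s: "supported n f" "supported n g" "supported n h" unfolding carrier_HMU by (auto intro: supp)
  show "(f \<oplus>\<^bsub>HMU n\<^esub> g) \<otimes>\<^bsub>HMU n\<^esub> h = f \<otimes>\<^bsub>HMU n\<^esub> h \<oplus>\<^bsub>HMU n\<^esub> g \<otimes>\<^bsub>HMU n\<^esub> h"
    unfolding add_HMU mult_HMU by (rule conv_add_left[OF s])
  show "h \<otimes>\<^bsub>HMU n\<^esub> (f \<oplus>\<^bsub>HMU n\<^esub> g) = h \<otimes>\<^bsub>HMU n\<^esub> f \<oplus>\<^bsub>HMU n\<^esub> h \<otimes>\<^bsub>HMU n\<^esub> g"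
    unfolding add_HMU mult_HMU by (rule conv_add_right[OF s])
qed

text \<open>Connects the ring-theoretic sum over r in the statement with the pointwise sums in which
  the descent formulas are proved.\<close>

lemma finsum_HMU:
  fixes f :: "'i \<Rightarrow> 'a::{finite, field} mat \<Rightarrow> rat"
  assumes "finite I" "\<And>i. i \<in> I \<Longrightarrow> f i \<in> range (int_comb n)"
  shows "(\<Oplus>\<^bsub>HMU n\<^esub> i\<in>I. f i) = (\<lambda>x. \<Sum>i\<in>I. f i x)"
proof -
  interpret ring "HMU n :: ('a mat \<Rightarrow> rat) ring" by (rule ring_HMU)
  show ?thesis using assms
  proof (induction I rule: finite_induct)
    case empty
    show ?case by (simp add: zero_HMU)
  next
    case (insert i I)
    then have "f \<in> I \<rightarrow> carrier (HMU n)" "f i \<in> carrier (HMU n)" by (auto simp: carrier_HMU)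
    then show ?case using insert by (simp add: finsum_insert add_HMU)
  qed
qed

text \<open>Each T_\<sigma> is a product of generators. Scaling is no ring operation, so integer
  multiples are obtained by repeated addition and negation inside the generated subring.\<close>

lemma generate_ring_HMU:
  "generate_ring (HMU n :: ('a::{finite, field} mat \<Rightarrow> rat) ring)
     (T_elt n ` ({simple_refl n k | k. Suc k < n} \<union> torus n \<union> {nu n})) = carrier (HMU n)"
proof
  define X :: "('a mat \<Rightarrow> rat) set"
    where "X = T_elt n ` ({simple_refl n k | k. Suc k < n} \<union> torus n \<union> {nu n})"
  define G where "G = generate_ring (HMU n) X"
  interpret ring "HMU n :: ('a mat \<Rightarrow> rat) ring" by (rule ring_HMU)
  have "X \<subseteq> carrier (HMU n)"
    unfolding carrier_HMU X_def using simple_refl_rook torus_rook nu_rook by (blast intro: T_elt_in_HMU)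
  then have sub: "G \<subseteq> carrier (HMU n)" unfolding G_def by (rule generate_ring_incl)
  then show "generate_ring (HMU n :: ('a mat \<Rightarrow> rat) ring)
     (T_elt n ` ({simple_refl n k | k. Suc k < n} \<union> torus n \<union> {nu n})) \<subseteq> carrier (HMU n)"
    unfolding G_def X_def .
  have add: "(\<lambda>x. f x + g x) \<in> G" if "f \<in> G" "g \<in> G" for f g
    using generate_ring.eng_add[OF that[unfolded G_def]] unfolding add_HMU G_def .
  have zero: "(\<lambda>x. 0) \<in> G" using zero_in_generate[of X] unfolding zero_HMU G_def .
  have uminus: "(\<lambda>x. - f x) \<in> G" if f: "f \<in> G" for f
  proof -
    have f': "f \<in> range (int_comb n)" using sub f unfolding carrier_HMU by blast
    have m: "(\<lambda>x. - f x) \<in> range (int_comb n)" using HMU_scale_closed[OF f', of "-1"] by simp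
    have "\<ominus>\<^bsub>HMU n\<^esub> f = (\<lambda>x. - f x)"
      by (rule minus_equality) (use f' m in \<open>simp_all only: carrier_HMU add_HMU zero_HMU left_minus\<close>)
    then show ?thesis using generate_ring.a_inv[OF f[unfolded G_def]] unfolding G_def by (simp only:)
  qed
  have nat_scale: "(\<lambda>x. of_nat a * f x) \<in> G" if f: "f \<in> G" for f a
  proof (induction a)
    case (Suc a)
    have "(\<lambda>x. of_nat (Suc a) * f x) = (\<lambda>x. of_nat a * f x + f x)" by (simp add: distrib_right add.commute)
    then show ?case using add[OF Suc f] by (simp only:)
  qed (simp add: zero)
  have int_scale: "(\<lambda>x. of_int a * f x) \<in> G" if f: "f \<in> G" for f a
    using nat_scale[OF f, of "nat a"] uminus[OF nat_scale[OF f, of "nat (- a)"]]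
    by (cases "a \<ge> 0") simp_all
  have T: "T_elt n \<sigma> \<in> G" if "\<sigma> \<in> rooks n" for \<sigma>
    using that
  proof (induction rule: T_elt_induct)
    case (mult \<sigma> \<tau>)
    then show ?case unfolding G_def mult_HMU[of n, symmetric] by (intro generate_ring.eng_mult)
  qed (auto simp: G_def X_def intro!: generate_ring.incl)
  have sum: "(\<lambda>x. \<Sum>\<sigma>\<in>S. of_int (c \<sigma>) * T_elt n \<sigma> x) \<in> G" if "finite S" "S \<subseteq> rooks n" for S c
    using that
  proof (induction S rule: finite_induct)
    case (insert \<sigma> S)
    then have "(\<lambda>x. of_int (c \<sigma>) * T_elt n \<sigma> x + (\<Sum>\<sigma>\<in>S. of_int (c \<sigma>) * T_elt n \<sigma> x)) \<in> G"
      by (intro add int_scale T) auto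
    then show ?case using insert(1,2) by simp
  qed (simp add: zero)
  have "carrier (HMU n) \<subseteq> G"
    unfolding carrier_HMU using sum[OF finite_rooks subset_refl] by (auto simp: int_comb_def)
  then show "carrier (HMU n) \<subseteq> generate_ring (HMU n :: ('a mat \<Rightarrow> rat) ring)
     (T_elt n ` ({simple_refl n k | k. Suc k < n} \<union> torus n \<union> {nu n}))"
    unfolding G_def X_def .
qed

text \<open>A rook matrix lies in no double coset of another one, so evaluation at \<sigma> isolates
  the coefficient of T_\<sigma>.\<close>

lemma int_comb_eq_zero:
  fixes c :: "'a::{finite, field} mat \<Rightarrow> int"
  assumes "int_comb n c = (\<lambda>x. 0)" and \<sigma>: "\<sigma> \<in> rooks n"
  shows "c \<sigma> = 0"
proof -
  have T: "T_elt n \<tau> \<sigma> = (if \<tau> = \<sigma> then T_elt n \<sigma> \<sigma> else 0)" if \<tau>: "\<tau> \<in> rooks n" for \<tau>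
    using rook_in_double_coset[OF \<tau> \<sigma>] by (auto simp: T_elt_def Let_def scale_def)
  have "(\<Sum>\<tau>\<in>rooks n. of_int (c \<tau>) * T_elt n \<tau> \<sigma>) = (\<Sum>\<tau>\<in>rooks n. if \<tau> = \<sigma> then of_int (c \<sigma>) * T_elt n \<sigma> \<sigma> else 0)"
  proof (rule sum.cong[OF refl])
    fix \<tau> :: "'a mat" assume "\<tau> \<in> rooks n"
    from T[OF this] show "of_int (c \<tau>) * T_elt n \<tau> \<sigma> = (if \<tau> = \<sigma> then of_int (c \<sigma>) * T_elt n \<sigma> \<sigma> else 0)"
      by (cases "\<tau> = \<sigma>") simp_all
  qed
  then have "of_int (c \<sigma>) * T_elt n \<sigma> \<sigma> = 0"
    using fun_cong[OF assms(1), of \<sigma>] finite_rooks[of n, where 'a = 'a] \<sigma> by (simp add: int_comb_def)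
  moreover have "T_elt n \<sigma> \<sigma> \<noteq> 0"
    using double_coset_self[OF rooks_carrier[OF \<sigma>]] by (simp add: T_elt_def Let_def scale_def)
  ultimately show ?thesis by simp
qed

lemma T_elt_torus_pow:
  fixes t :: "'a::{finite, field} mat"
  assumes t: "t \<in> torus n"
  shows "T_elt n t [^]\<^bsub>HMU n\<^esub> (CARD('a) - 1) = T_elt n (1\<^sub>m n)"
proof -
  interpret ring "HMU n :: ('a mat \<Rightarrow> rat) ring" by (rule ring_HMU)
  obtain d where d: "t = mat_diag n d" "\<forall>i<n. d i \<noteq> 0" using t torus_iff by blast
  have "T_elt n t [^]\<^bsub>HMU n\<^esub> m = T_elt n (mat_diag n (\<lambda>i. d i ^ m))" for m :: nat
  proof (induction m)
    case 0
    show ?case by (simp add: one_HMU)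
  next
    case (Suc m)
    have dm: "mat_diag n (\<lambda>i. d i ^ m) \<in> torus n" by (rule mat_diag_torus) (use d in simp)
    have "T_elt n t [^]\<^bsub>HMU n\<^esub> Suc m = conv (T_elt n (mat_diag n (\<lambda>i. d i ^ m))) (T_elt n t)"
      using Suc by (simp add: mult_HMU)
    also have "\<dots> = T_elt n (mat_diag n (\<lambda>i. d i ^ m) * t)" by (rule T_elt_torus_mult[OF dm torus_rook[OF t]])
    finally show ?case by (simp add: d(1) mult.commute)
  qed
  moreover have "mat_diag n (\<lambda>i. d i ^ (CARD('a) - 1)) = 1\<^sub>m n"
    by (rule mat_diag_eq_one, rule finite_field_power_card_minus_1) (use d(2) in blast)
  ultimately show ?thesis by (simp only:)
qed

theorem theorem4p1:
  fixes n p e :: nat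
  assumes "prime p" and "odd p" and "CARD('a::{finite, field}) = p ^ e" and "n \<ge> 1"
  shows
    "carrier (HMU n) \<subseteq> carrier (mat_algebra n :: ('a mat \<Rightarrow> rat) ring) \<and>
     (\<forall>c :: 'a mat \<Rightarrow> int. int_comb n c = (\<lambda>x. 0) \<longrightarrow> (\<forall>\<sigma> \<in> rooks n. c \<sigma> = 0)) \<and>
     ring (HMU n :: ('a mat \<Rightarrow> rat) ring) \<and>
     generate_ring (HMU n)
       (T_elt n ` ({simple_refl n k | k. Suc k < n} \<union> torus n \<union> {nu n :: 'a mat}))
       = carrier (HMU n) \<and>
     (\<forall>t \<in> torus n :: 'a mat set.
        T_elt n t [^]\<^bsub>HMU n\<^esub> (CARD('a) - 1) = T_elt n (1\<^sub>m n)) \<and>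
     (\<forall>t \<in> torus n :: 'a mat set. \<forall>t' \<in> torus n.
        T_elt n t \<otimes>\<^bsub>HMU n\<^esub> T_elt n t' = T_elt n t' \<otimes>\<^bsub>HMU n\<^esub> T_elt n t) \<and>
     (\<forall>t\<^sub>I \<in> torus n :: 'a mat set. \<forall>\<sigma> \<in> rooks n.
        let t\<^sub>J = torus_act n t\<^sub>I \<sigma> in
        T_elt n t\<^sub>I \<otimes>\<^bsub>HMU n\<^esub> T_elt n \<sigma> = T_elt n (t\<^sub>I * \<sigma>) \<and>
        T_elt n (t\<^sub>I * \<sigma>) = T_elt n (\<sigma> * t\<^sub>J) \<and>
        T_elt n (\<sigma> * t\<^sub>J) = T_elt n \<sigma> \<otimes>\<^bsub>HMU n\<^esub> T_elt n t\<^sub>J) \<and>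
     (\<forall>k. Suc k < n \<longrightarrow> (\<forall>\<sigma> \<in> rooks n :: 'a mat set.
        let s = simple_refl n k; l = rook_length n \<sigma>; l' = rook_length n (s * \<sigma>) in
        (l' = l \<or> l' = l + 1 \<or> l' + 1 = l) \<and>
        (l' = l \<longrightarrow>
           T_elt n s \<otimes>\<^bsub>HMU n\<^esub> T_elt n \<sigma> = scale (of_nat CARD('a)) (T_elt n \<sigma>)) \<and>
        (l' = l + 1 \<longrightarrow>
           T_elt n s \<otimes>\<^bsub>HMU n\<^esub> T_elt n \<sigma> = T_elt n (s * \<sigma>)) \<and>
        (l' + 1 = l \<longrightarrow>
           T_elt n s \<otimes>\<^bsub>HMU n\<^esub> T_elt n \<sigma> =
             scale (of_nat CARD('a)) (T_elt n (s * \<sigma>)) \<oplus>\<^bsub>HMU n\<^esub>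
             (\<Oplus>\<^bsub>HMU n\<^esub> r \<in> UNIV - {0}. T_elt n (h_mat n k r) \<otimes>\<^bsub>HMU n\<^esub> T_elt n \<sigma>)))) \<and>
     (\<forall>k. Suc k < n \<longrightarrow> (\<forall>\<sigma> \<in> rooks n :: 'a mat set.
        let s = simple_refl n k; l = rook_length n \<sigma>; l' = rook_length n (\<sigma> * s) in
        (l' = l \<or> l' = l + 1 \<or> l' + 1 = l) \<and>
        (l' = l \<longrightarrow>
           T_elt n \<sigma> \<otimes>\<^bsub>HMU n\<^esub> T_elt n s = scale (of_nat CARD('a)) (T_elt n \<sigma>)) \<and>
        (l' = l + 1 \<longrightarrow>
           T_elt n \<sigma> \<otimes>\<^bsub>HMU n\<^esub> T_elt n s = T_elt n (\<sigma> * s)) \<and>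
        (l' + 1 = l \<longrightarrow>
           T_elt n \<sigma> \<otimes>\<^bsub>HMU n\<^esub> T_elt n s =
             scale (of_nat CARD('a)) (T_elt n (\<sigma> * s)) \<oplus>\<^bsub>HMU n\<^esub>
             (\<Oplus>\<^bsub>HMU n\<^esub> r \<in> UNIV - {0}. T_elt n \<sigma> \<otimes>\<^bsub>HMU n\<^esub> T_elt n (hs_mat n k r))))) \<and>
     (\<forall>\<sigma> \<in> rooks n :: 'a mat set.
        T_elt n (nu n) \<otimes>\<^bsub>HMU n\<^esub> T_elt n \<sigma> =
          scale (of_nat CARD('a) powi (int (rook_length n \<sigma>) - int (rook_length n (nu n * \<sigma>))))
            (T_elt n (nu n * \<sigma>)) \<and>
        T_elt n \<sigma> \<otimes>\<^bsub>HMU n\<^esub> T_elt n (nu n) =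
          scale (of_nat CARD('a) powi (int (rook_length n \<sigma>) - int (rook_length n (\<sigma> * nu n))))
            (T_elt n (\<sigma> * nu n)))"
proof (intro conjI allI ballI impI, unfold mult_HMU)
  have T: "T_elt n \<sigma> \<in> range (int_comb n)" if "\<sigma> \<in> rooks n" for \<sigma> :: "'a mat"
    using that by (rule T_elt_in_HMU)
  show "carrier (HMU n) \<subseteq> carrier (mat_algebra n :: ('a mat \<Rightarrow> rat) ring)"
  proof
    fix f :: "'a mat \<Rightarrow> rat" assume "f \<in> carrier (HMU n)"
    then have "supported n f" unfolding carrier_HMU using supported_int_comb by blast
    then have "{x. f x \<noteq> 0} \<subseteq> carrier_mat n n" unfolding supported_def by blast
    moreover from this have "finite {x. f x \<noteq> 0}" using finite_carrier_mat by (rule finite_subset)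
    ultimately show "f \<in> carrier (mat_algebra n)"
      by (simp add: mat_algebra_def monoid_algebra_def ring_mat_def)
  qed
  show "c \<sigma> = 0" if "int_comb n c = (\<lambda>x. 0)" "\<sigma> \<in> rooks n" for c :: "'a mat \<Rightarrow> int" and \<sigma>
    using that by (rule int_comb_eq_zero)
  show "ring (HMU n :: ('a mat \<Rightarrow> rat) ring)" by (rule ring_HMU)
  show "generate_ring (HMU n)
      (T_elt n ` ({simple_refl n k | k. Suc k < n} \<union> torus n \<union> {nu n :: 'a mat})) = carrier (HMU n)"
    by (rule generate_ring_HMU)
  show "T_elt n t [^]\<^bsub>HMU n\<^esub> (CARD('a) - 1) = T_elt n (1\<^sub>m n)" if "t \<in> torus n" for t :: "'a mat"
    using that by (rule T_elt_torus_pow)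
  show "conv (T_elt n t) (T_elt n t') = conv (T_elt n t') (T_elt n t)"
    if t: "t \<in> torus n" "t' \<in> torus n" for t t' :: "'a mat"
    unfolding T_elt_torus_mult[OF t(1) torus_rook[OF t(2)]] T_elt_torus_mult[OF t(2) torus_rook[OF t(1)]]
      torus_commute[OF t] ..
  show "let t\<^sub>J = torus_act n t\<^sub>I \<sigma> in
      conv (T_elt n t\<^sub>I) (T_elt n \<sigma>) = T_elt n (t\<^sub>I * \<sigma>) \<and>
      T_elt n (t\<^sub>I * \<sigma>) = T_elt n (\<sigma> * t\<^sub>J) \<and>
      T_elt n (\<sigma> * t\<^sub>J) = conv (T_elt n \<sigma>) (T_elt n t\<^sub>J)"
    if t: "t\<^sub>I \<in> torus n" and \<sigma>: "\<sigma> \<in> rooks n" for t\<^sub>I \<sigma> :: "'a mat"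
    unfolding Let_def T_elt_torus_mult[OF t \<sigma>] T_elt_mult_torus[OF torus_act_torus(1)[OF t \<sigma>] \<sigma>]
      torus_act_torus(2)[OF t \<sigma>, symmetric] by blast
  fix k and \<sigma> :: "'a mat"
  assume k: "Suc k < n" and \<sigma>: "\<sigma> \<in> rooks n"
  \<comment> \<open>The three length relations exclude one another, so a hypothesis on lengths
    selects one case of the disjunctions proved above.\<close>
  have lin: "a = b \<Longrightarrow> a \<noteq> b + 1" "a = b \<Longrightarrow> a + 1 \<noteq> b" "a = b + 1 \<Longrightarrow> a + 1 \<noteq> b" for a b :: nat
    by simp_all
  show "let s = simple_refl n k; l = rook_length n \<sigma>; l' = rook_length n (s * \<sigma>) in
      (l' = l \<or> l' = l + 1 \<or> l' + 1 = l) \<and>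
      (l' = l \<longrightarrow> conv (T_elt n s) (T_elt n \<sigma>) = scale (of_nat CARD('a)) (T_elt n \<sigma>)) \<and>
      (l' = l + 1 \<longrightarrow> conv (T_elt n s) (T_elt n \<sigma>) = T_elt n (s * \<sigma>)) \<and>
      (l' + 1 = l \<longrightarrow> conv (T_elt n s) (T_elt n \<sigma>) =
         scale (of_nat CARD('a)) (T_elt n (s * \<sigma>)) \<oplus>\<^bsub>HMU n\<^esub>
         (\<Oplus>\<^bsub>HMU n\<^esub> r \<in> UNIV - {0}. conv (T_elt n (h_mat n k r)) (T_elt n \<sigma>)))"
  proof -
    have "(\<Oplus>\<^bsub>HMU n\<^esub> r \<in> UNIV - {0}. conv (T_elt n (h_mat n k r)) (T_elt n \<sigma>)) =
        (\<lambda>x. \<Sum>r\<in>UNIV - {0}. conv (T_elt n (h_mat n k r)) (T_elt n \<sigma>) x)"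
      by (rule finsum_HMU) (auto intro!: conv_closed T h_mat_torus torus_rook \<sigma>)
    also have "\<dots> = (\<lambda>x. \<Sum>r\<in>UNIV - {0}. T_elt n (h_mat n k r * \<sigma>) x)"
      by (intro ext sum.cong refl) (simp add: T_elt_torus_mult h_mat_torus \<sigma>)
    finally have sum: "scale (of_nat CARD('a)) (T_elt n (simple_refl n k * \<sigma>)) \<oplus>\<^bsub>HMU n\<^esub>
         (\<Oplus>\<^bsub>HMU n\<^esub> r \<in> UNIV - {0}. conv (T_elt n (h_mat n k r)) (T_elt n \<sigma>)) =
       (\<lambda>x. of_nat CARD('a) * T_elt n (simple_refl n k * \<sigma>) x + (\<Sum>r\<in>UNIV - {0}. T_elt n (h_mat n k r * \<sigma>) x))"
      by (simp add: add_HMU scale_def)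
    show ?thesis unfolding Let_def sum
      using T_elt_simple_refl_mult_cases[OF \<sigma> k] lin[of "rook_length n (simple_refl n k * \<sigma>)" "rook_length n \<sigma>"]
      by blast
  qed
  show "let s = simple_refl n k; l = rook_length n \<sigma>; l' = rook_length n (\<sigma> * s) in
      (l' = l \<or> l' = l + 1 \<or> l' + 1 = l) \<and>
      (l' = l \<longrightarrow> conv (T_elt n \<sigma>) (T_elt n s) = scale (of_nat CARD('a)) (T_elt n \<sigma>)) \<and>
      (l' = l + 1 \<longrightarrow> conv (T_elt n \<sigma>) (T_elt n s) = T_elt n (\<sigma> * s)) \<and>
      (l' + 1 = l \<longrightarrow> conv (T_elt n \<sigma>) (T_elt n s) =
         scale (of_nat CARD('a)) (T_elt n (\<sigma> * s)) \<oplus>\<^bsub>HMU n\<^esub>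
         (\<Oplus>\<^bsub>HMU n\<^esub> r \<in> UNIV - {0}. conv (T_elt n \<sigma>) (T_elt n (hs_mat n k r))))"
  proof -
    have "(\<Oplus>\<^bsub>HMU n\<^esub> r \<in> UNIV - {0}. conv (T_elt n \<sigma>) (T_elt n (hs_mat n k r))) =
        (\<lambda>x. \<Sum>r\<in>UNIV - {0}. conv (T_elt n \<sigma>) (T_elt n (hs_mat n k r)) x)"
      by (rule finsum_HMU) (auto intro!: conv_closed T hs_mat_torus torus_rook \<sigma> k)
    also have "\<dots> = (\<lambda>x. \<Sum>r\<in>UNIV - {0}. T_elt n (\<sigma> * hs_mat n k r) x)"
      by (intro ext sum.cong refl) (simp add: T_elt_mult_torus hs_mat_torus \<sigma> k)
    finally have sum: "scale (of_nat CARD('a)) (T_elt n (\<sigma> * simple_refl n k)) \<oplus>\<^bsub>HMU n\<^esub>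
         (\<Oplus>\<^bsub>HMU n\<^esub> r \<in> UNIV - {0}. conv (T_elt n \<sigma>) (T_elt n (hs_mat n k r))) =
       (\<lambda>x. of_nat CARD('a) * T_elt n (\<sigma> * simple_refl n k) x + (\<Sum>r\<in>UNIV - {0}. T_elt n (\<sigma> * hs_mat n k r) x))"
      by (simp add: add_HMU scale_def)
    show ?thesis unfolding Let_def sum
      using T_elt_mult_simple_refl_cases[OF \<sigma> k] lin[of "rook_length n (\<sigma> * simple_refl n k)" "rook_length n \<sigma>"]
      by blast
  qed
next
  fix \<sigma> :: "'a mat" assume \<sigma>: "\<sigma> \<in> rooks n"
  show "conv (T_elt n (nu n)) (T_elt n \<sigma>) =
      scale (of_nat CARD('a) powi (int (rook_length n \<sigma>) - int (rook_length n (nu n * \<sigma>)))) (T_elt n (nu n * \<sigma>))"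
    by (rule T_elt_nu_mult[OF \<sigma>])
  show "conv (T_elt n \<sigma>) (T_elt n (nu n)) =
      scale (of_nat CARD('a) powi (int (rook_length n \<sigma>) - int (rook_length n (\<sigma> * nu n)))) (T_elt n (\<sigma> * nu n))"
    by (rule T_elt_mult_nu[OF \<sigma>])
qed

end
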